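(* Let $\Lambda$ be a $\lambda$-ring with a good modifier $S$. The trace of an $S$-admissible operator $U$ of trace class is $S$-admissible over $\Lambda$, i.e. $\mathrm{Tr}\,U=\mathrm{Exp}\left[\frac{L}{S}\right]$ for some $L\in\Lambda$.
   Context: A $\lambda$-ring is a (commutative) $\mathbb Q$-algebra $\Lambda$ with an action $F[G]$ ($F$ a symmetric function over $\mathbb Q$, $G\in\Lambda$) in which the power sums $p_n$ act by ring endomorphisms, $p_1[G]=G$, $p_m[p_n[G]]=p_{mn}[G]$. $\Lambda$ is assumed complete with respect to a decreasing filtration $\Lambda=J^0\supset J^1\supset\cdots$ with $J^iJ^{i'}\subset J^{i+i'}$ (with the $p_n$ continuous); tensor products are completed. A sequence $A_1,A_2,\ldots\in\Lambda$ is well-behaved if for each $k$ there is $i_0$ such that $p_\lambda[A_i]\in J^k$ whenever $i>i_0$ or $|\lambda|>i_0$; an element $A$ is well-behaved if the sequence $A,0,0,\ldots$ is. The plethystic exponential is $\mathrm{Exp}[G]=\exp\left(\sum_{k\ge1}p_k[G]/k\right)$. $S\in\Lambda$ is a good modifier if: (i) for each $n\ge1$, $p_n[S]$ is not a zero divisor; (ii) for each $n\ge1$, $S\mid p_n[S]$; (iii) for each relatively prime pair $m,n\ge1$, $p_m[S]\,p_n[S]\mid S\,p_{mn}[S]$. Put $\Lambda_S=\Lambda[S^{-1},p_2[S]^{-1},p_3[S]^{-1},\ldots]$ (with the induced filtration, completed where infinite sums occur). $\mathrm{Sym}[X]$ is the ring of symmetric functions over $\mathbb Q$ in $X$; $\mathrm{Sym}[[X]]$,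 $\mathrm{Sym}[[X,Y]]$ are degree completions (in one, resp. two independent alphabets). For a $\Lambda$-linear operator $U:\Lambda\otimes\mathrm{Sym}[X]\to\Lambda_S\otimes\mathrm{Sym}[[X]]$ (extended linearly to coefficients in $\Lambda_S$ and $Y$), its kernel is $K_U^S[X,Y]=U\,\mathrm{Exp}\left[\frac{XY}{S}\right]\in\Lambda_S\otimes\mathrm{Sym}[[X,Y]]$, $U$ acting on functions of $X$. $U$ is $S$-admissible over $\Lambda$ if $K_U^S[X,Y]=\mathrm{Exp}\left[\frac{L_U^S[X,Y]}{S}\right]$ with $L_U^S[X,Y]\in\Lambda\otimes\mathrm{Sym}[[X,Y]]$ whose constant term $L_U^S[0,0]$ is well-behaved. An $S$-admissible operator $U$ is of trace class if the sequence of the coefficients of $L_U^S[X,Y]$ (in the basis $p_\lambda[X]p_\mu[Y]$) is well-behaved. In this case its trace is $$\mathrm{Tr}\,U:=\int_X^SK_U^S[X,X^*],$$ where $\int_X^S$ is the linear map (over the coefficients) with $\int_X^SF[X]G[X^*]=(F,G)^S$, and $(F[X],G[X])^S=(F[SX],G[X])$ is the $S$-modified Hall inner product ($(\cdot,\cdot)$ the usual Hall inner product, $p_k[SX]=p_k[S]p_k[X]$). *)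

theory Defs
  imports Complex_Main "HOL-Library.Multiset" "HOL-Library.Product_Plus"
begin

section \<open>Complete lambda-rings\<close>

text \<open>Commutative unital \<open>\<rat>\<close>-algebras. The superclass is not \<^class>\<open>comm_ring_1\<close>, because the
  zero ring must be allowed: the completed localization \<open>\<Lambda>\<^sub>S\<close> can vanish, for instance if \<open>S\<close>
  lies in \<open>J\<^sup>1\<close>.\<close>

class rat_algebra = comm_ring + comm_monoid_mult +
  fixes scaleQ :: "rat \<Rightarrow> 'a \<Rightarrow> 'a"  (infixr \<open>*\<^sub>Q\<close> 75)
  assumes scaleQ_add_right: "c *\<^sub>Q (x + y) = c *\<^sub>Q x + c *\<^sub>Q y"
    and scaleQ_add_left: "(c + d) *\<^sub>Q x = c *\<^sub>Q x + d *\<^sub>Q x"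
    and scaleQ_scaleQ: "c *\<^sub>Q d *\<^sub>Q x = (c * d) *\<^sub>Q x"
    and scaleQ_one: "1 *\<^sub>Q x = x"
    and scaleQ_mult_left: "(c *\<^sub>Q x) * y = c *\<^sub>Q (x * y)"

text \<open>\<open>adams n G\<close> is \<open>p\<^sub>n[G]\<close>, meaningful for \<open>n \<ge> 1\<close> only; \<open>filt k\<close> is \<open>J\<^sup>k\<close>. Since
  \<open>J\<^sup>0 = \<Lambda>\<close>, multiplicativity makes every \<open>J\<^sup>k\<close> an ideal. Complete means Hausdorff and
  Cauchy complete.\<close>

class complete_lambda_ring = rat_algebra +
  fixes adams :: "nat \<Rightarrow> 'a \<Rightarrow> 'a"
    and filt :: "nat \<Rightarrow> 'a set"
  assumes adams_add: "n \<ge> 1 \<Longrightarrow> adams n (x + y) = adams n x + adams n y"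
    and adams_mult: "n \<ge> 1 \<Longrightarrow> adams n (x * y) = adams n x * adams n y"
    and adams_one: "n \<ge> 1 \<Longrightarrow> adams n 1 = 1"
    and adams_1: "adams 1 x = x"
    and adams_adams: "m \<ge> 1 \<Longrightarrow> n \<ge> 1 \<Longrightarrow> adams m (adams n x) = adams (m * n) x"
    and filt_0: "filt 0 = UNIV"
    and filt_Suc: "filt (Suc k) \<subseteq> filt k"
    and filt_zero: "0 \<in> filt k"
    and filt_diff: "x \<in> filt k \<Longrightarrow> y \<in> filt k \<Longrightarrow> x - y \<in> filt k"
    and filt_mult: "x \<in> filt i \<Longrightarrow> y \<in> filt j \<Longrightarrow> x * y \<in> filt (i + j)"
    and adams_continuous: "n \<ge> 1 \<Longrightarrow> \<exists>m. \<forall>x\<in>filt m. adams n x \<in> filt k"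
    and filt_separated: "(\<And>k. x \<in> filt k) \<Longrightarrow> x = 0"
    and filt_complete:
      "(\<And>k. \<exists>N. \<forall>m\<ge>N. \<forall>n\<ge>N. X m - X n \<in> filt k) \<Longrightarrow>
       \<exists>x. \<forall>k. \<exists>N. \<forall>n\<ge>N. X (n :: nat) - x \<in> filt k"
begin

text \<open>Unordered infinite sums in the topology defined by the filtration.\<close>

definition has_fsum :: "('i \<Rightarrow> 'a) \<Rightarrow> 'i set \<Rightarrow> 'a \<Rightarrow> bool" where
  "has_fsum f A s \<longleftrightarrow> (\<forall>k. \<forall>\<^sub>F X in finite_subsets_at_top A. sum f X - s \<in> filt k)"

definition fsum :: "('i \<Rightarrow> 'a) \<Rightarrow> 'i set \<Rightarrow> 'a" where
  "fsum f A = (THE s. has_fsum f A s)"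

definition fexp :: "'a \<Rightarrow> 'a" where
  "fexp x = fsum (\<lambda>n. (1 / fact n) *\<^sub>Q x ^ n) UNIV"

definition Exp :: "'a \<Rightarrow> 'a" where
  "Exp G = fexp (fsum (\<lambda>k. (1 / of_nat k) *\<^sub>Q adams k G) {1..})"

lemma filt_antimono: "i \<le> j \<Longrightarrow> filt j \<subseteq> filt i"
  by (rule lift_Suc_antimono_le[of filt]) (auto simp: filt_Suc)

lemma filt_uminus: "x \<in> filt k \<Longrightarrow> - x \<in> filt k"
  using filt_diff[OF filt_zero, of x k] by simp

lemma filt_add: "x \<in> filt k \<Longrightarrow> y \<in> filt k \<Longrightarrow> x + y \<in> filt k"
  using filt_diff[OF _ filt_uminus, of x k y] by simp

lemma filt_sum: "(\<And>i. i \<in> A \<Longrightarrow> f i \<in> filt k) \<Longrightarrow> sum f A \<in> filt k"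
  by (induction A rule: infinite_finite_induct) (auto simp: filt_zero filt_add)

lemma adams_zero: "n \<ge> 1 \<Longrightarrow> adams n 0 = 0"
  using adams_add[of n 0 0] by simp

lemma adams_sum: "n \<ge> 1 \<Longrightarrow> adams n (sum f A) = (\<Sum>i\<in>A. adams n (f i))"
  by (induction A rule: infinite_finite_induct) (auto simp: adams_zero adams_add)

end


section \<open>Partitions\<close>

typedef partition = "{M :: nat multiset. 0 \<notin># M}"
  morphisms parts Partition
  by (intro exI[of _ "{#}"]) auto

text \<open>Monomial index sets for (products of) rings of symmetric functions. A partition \<open>\<nu>\<close>
  stands for \<open>p\<^sub>\<nu>\<close>, so that \<open>+\<close> is the union of multisets of parts, and \<open>dilate n\<close>
  multiplies all parts by \<open>n\<close>.\<close>

class graded_index = cancel_comm_monoid_add +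
  fixes deg :: "'a \<Rightarrow> nat"
    and dilate :: "nat \<Rightarrow> 'a \<Rightarrow> 'a"
  assumes deg_add: "deg (x + y) = deg x + deg y"
    and finite_deg: "finite {x. deg x = d}"
    and deg_dilate: "deg (dilate n x) = n * deg x"
    and dilate_1: "dilate 1 x = x"
    and dilate_dilate: "m \<ge> 1 \<Longrightarrow> n \<ge> 1 \<Longrightarrow> dilate m (dilate n x) = dilate (m * n) x"
    and dilate_add: "dilate n (x + y) = dilate n x + dilate n y"
    and inj_dilate: "n \<ge> 1 \<Longrightarrow> inj (dilate n)"
    and dilate_split:
      "n \<ge> 1 \<Longrightarrow> x + y = dilate n z \<Longrightarrow> \<exists>x' y'. x = dilate n x' \<and> y = dilate n y'"
begin

lemma deg_zero: "deg 0 = 0"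
  using deg_add[of 0 0] by simp

lemma dilate_zero: "dilate n 0 = 0"
  using dilate_add[of n 0 0] by simp

lemma finite_deg_le: "finite {x. deg x \<le> d}"
proof -
  have "{x. deg x \<le> d} = (\<Union>e\<le>d. {x. deg x = e})" by auto
  then show ?thesis by (simp add: finite_deg)
qed

lemma finite_splits: "finite {(x, y). x + y = z}"
proof (rule finite_subset)
  show "{(x, y). x + y = z} \<subseteq> {x. deg x \<le> deg z} \<times> {x. deg x \<le> deg z}"
    by (auto simp: deg_add)
qed (simp add: finite_deg_le)

end

instantiation partition :: graded_index
begin

definition "0 = Partition {#}"
definition "\<mu> + \<nu> = Partition (parts \<mu> + parts \<nu>)"
definition "\<mu> - \<nu> = Partition (parts \<mu> - parts \<nu>)"
definition "deg \<nu> = sum_mset (parts \<nu>)"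
definition "dilate n \<nu> = (if n = 0 then 0 else Partition (image_mset ((*) n) (parts \<nu>)))"

lemma parts_pos: "0 \<notin># parts \<nu>"
  using parts[of \<nu>] by simp

lemma parts_zero: "parts 0 = {#}"
  by (simp add: zero_partition_def Partition_inverse)

lemma parts_add: "parts (\<mu> + \<nu>) = parts \<mu> + parts \<nu>"
  by (simp add: plus_partition_def Partition_inverse parts_pos)

lemma parts_diff: "parts (\<mu> - \<nu>) = parts \<mu> - parts \<nu>"
  using in_diffD[of 0 "parts \<mu>" "parts \<nu>"]
  by (subst minus_partition_def, subst Partition_inverse) (auto simp: parts_pos)

lemma parts_dilate: "n \<ge> 1 \<Longrightarrow> parts (dilate n \<nu>) = image_mset ((*) n) (parts \<nu>)"
proof -
  assume "n \<ge> 1"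
  then have "0 \<notin># image_mset ((*) n) (parts \<nu>)" using parts_pos[of \<nu>] by auto
  with \<open>n \<ge> 1\<close> show ?thesis by (simp add: dilate_partition_def Partition_inverse)
qed

lemma size_le_sum_mset: "0 \<notin># M \<Longrightarrow> size M \<le> sum_mset (M :: nat multiset)"
  by (induction M) auto

lemma set_mset_le_sum_mset: "x \<in># M \<Longrightarrow> x \<le> sum_mset (M :: nat multiset)"
  by (induction M) auto

instance
proof
  fix \<mu> \<nu> \<rho> :: partition and d m n :: nat
  show "\<mu> + \<nu> + \<rho> = \<mu> + (\<nu> + \<rho>)" "\<mu> + \<nu> = \<nu> + \<mu>" "0 + \<mu> = \<mu>"
    by (simp_all add: parts_inject[symmetric] parts_add parts_zero ac_simps)
  show "\<mu> + \<nu> - \<mu> = \<nu>" "\<mu> - \<nu> - \<rho> = \<mu> - (\<nu> + \<rho>)"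
    by (simp_all add: parts_inject[symmetric] parts_add parts_diff)
  show "deg (\<mu> + \<nu>) = deg \<mu> + deg \<nu>"
    by (simp add: deg_partition_def parts_add)
  show "deg (dilate n \<mu>) = n * deg \<mu>"
  proof (cases "n = 0")
    case False
    have "sum_mset (image_mset ((*) n) M) = n * sum_mset M" for M :: "nat multiset"
      by (induction M) (simp_all add: distrib_left)
    with False show ?thesis
      by (simp add: deg_partition_def parts_dilate)
  qed (simp add: dilate_partition_def deg_partition_def parts_zero)
  have "(*) 1 = (\<lambda>x :: nat. x)" by (simp add: fun_eq_iff)
  then show "dilate 1 \<mu> = \<mu>"
    by (simp add: parts_inject[symmetric] parts_dilate)
  have "(*) m \<circ> (*) n = (*) (m * n)" by (simp add: fun_eq_iff)
  then show "m \<ge> 1 \<Longrightarrow> n \<ge> 1 \<Longrightarrow> dilate m (dilate n \<mu>) = dilate (m * n) \<mu>"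
    by (simp add: parts_inject[symmetric] parts_dilate multiset.map_comp)
  show "dilate n (\<mu> + \<nu>) = dilate n \<mu> + dilate n \<nu>"
  proof (cases "n = 0")
    case True
    then show ?thesis by (simp add: parts_inject[symmetric] parts_add parts_zero dilate_partition_def)
  qed (simp add: parts_inject[symmetric] parts_dilate parts_add)
  show "inj (dilate n :: partition \<Rightarrow> _)" if n: "n \<ge> 1"
  proof (rule injI)
    fix \<alpha> \<beta> :: partition assume "dilate n \<alpha> = dilate n \<beta>"
    then have "image_mset ((*) n) (parts \<alpha>) = image_mset ((*) n) (parts \<beta>)"
      using n by (simp flip: parts_dilate)
    moreover have "inj ((*) n)" using n by (simp add: inj_on_def)
    then have "inj (image_mset ((*) n))" by (rule multiset.inj_map)
    ultimately have "parts \<alpha> = parts \<beta>" by (blast dest: injD)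
    then show "\<alpha> = \<beta>" by (simp add: parts_inject)
  qed
  show "\<exists>\<alpha> \<beta>. \<mu> = dilate n \<alpha> \<and> \<nu> = dilate n \<beta>" if n: "n \<ge> 1" and eq: "\<mu> + \<nu> = dilate n \<rho>"
  proof -
    have "image_mset ((*) n) (parts \<rho>) = parts \<mu> + parts \<nu>"
      using eq n by (simp flip: parts_add parts_dilate)
    then obtain M N where MN: "parts \<rho> = M + N" "parts \<mu> = image_mset ((*) n) M"
        "parts \<nu> = image_mset ((*) n) N"
      using image_mset_eq_plusD by metis
    then have "0 \<notin># M" "0 \<notin># N" using parts_pos[of \<rho>] by auto
    then have "\<mu> = dilate n (Partition M)" "\<nu> = dilate n (Partition N)"
      using n MN by (simp_all add: parts_inject[symmetric] parts_dilate Partition_inverse)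
    then show ?thesis by blast
  qed
  show "finite {\<nu>::partition. deg \<nu> = d}"
  proof (rule finite_imageD)
    have "parts ` {\<nu>. deg \<nu> = d} \<subseteq> mset ` {xs. set xs \<subseteq> {..d} \<and> length xs \<le> d}"
    proof
      fix M assume "M \<in> parts ` {\<nu>. deg \<nu> = d}"
      then have M: "0 \<notin># M" "sum_mset M = d" by (auto simp: deg_partition_def parts_pos)
      obtain xs where xs: "M = mset xs" by (metis ex_mset)
      have "set xs \<subseteq> {..d}" using set_mset_le_sum_mset[of _ M] M xs by auto
      moreover have "length xs \<le> d" using size_le_sum_mset[of M] M xs by simp
      ultimately show "M \<in> mset ` {xs. set xs \<subseteq> {..d} \<and> length xs \<le> d}" using xs by blast
    qed
    then show "finite (parts ` {\<nu>. deg \<nu> = d})"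
      by (rule finite_subset) (simp add: finite_lists_length_le)
  qed (simp add: inj_on_def parts_inject)
qed

end

instantiation prod :: (graded_index, graded_index) graded_index
begin

definition "deg x = deg (fst x) + deg (snd x)"
definition "dilate n x = (dilate n (fst x), dilate n (snd x))"

instance
proof
  fix x y z :: "'a \<times> 'b" and d m n :: nat
  show "deg (x + y) = deg x + deg y"
    by (simp add: deg_prod_def deg_add)
  show "deg (dilate n x) = n * deg x"
    by (simp add: deg_prod_def dilate_prod_def deg_dilate distrib_left)
  show "dilate 1 x = x" by (simp add: dilate_prod_def dilate_1 del: One_nat_def)
  show "m \<ge> 1 \<Longrightarrow> n \<ge> 1 \<Longrightarrow> dilate m (dilate n x) = dilate (m * n) x"
    by (simp add: dilate_prod_def dilate_dilate)
  show "dilate n (x + y) = dilate n x + dilate n y"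
    by (simp add: dilate_prod_def dilate_add)
  show "inj (dilate n :: 'a \<times> 'b \<Rightarrow> _)" if "n \<ge> 1"
    using inj_dilate[OF that, where 'a = 'a] inj_dilate[OF that, where 'a = 'b]
    by (auto simp: inj_def dilate_prod_def)
  show "\<exists>x' y'. x = dilate n x' \<and> y = dilate n y'" if n: "n \<ge> 1" and eq: "x + y = dilate n z"
  proof -
    have "fst x + fst y = dilate n (fst z)" "snd x + snd y = dilate n (snd z)"
      using arg_cong[OF eq, of fst] arg_cong[OF eq, of snd] by (simp_all add: dilate_prod_def)
    then obtain a b c e where "fst x = dilate n a" "fst y = dilate n b"
        "snd x = dilate n c" "snd y = dilate n e"
      using dilate_split[OF n] by metis
    then have "x = dilate n (a, c)" "y = dilate n (b, e)"
      by (simp_all add: dilate_prod_def prod_eq_iff)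
    then show ?thesis by blast
  qed
  show "finite {x::'a \<times> 'b. deg x = d}"
  proof (rule finite_subset)
    show "{x::'a \<times> 'b. deg x = d} \<subseteq> {x. deg x \<le> d} \<times> {x. deg x \<le> d}"
      by (auto simp: deg_prod_def)
  qed (simp add: finite_deg_le)
qed

end


section \<open>Completed rings of symmetric functions over a complete lambda-ring\<close>

text \<open>\<open>(partition, 'a) series\<close> is \<open>\<Lambda> \<otimes> Sym[[X]]\<close> and \<open>(partition \<times> partition, 'a) series\<close>
  is \<open>\<Lambda> \<otimes> Sym[[X,Y]]\<close>, the tensor products being completed. As \<open>\<rat> \<subseteq> \<Lambda>\<close>, symmetric functions
  are given by their coefficients in the power sum basis \<open>p\<^sub>\<nu>[X]\<close>, respectively
  \<open>p\<^sub>\<mu>[X] p\<^sub>\<nu>[Y]\<close>; completing by degree imposes no condition on the coefficients.\<close>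

typedef ('m, 'a) series = "UNIV :: ('m \<Rightarrow> 'a) set"
  morphisms coeff Series
  by simp

lemma coeff_Series [simp]: "coeff (Series f) m = f m"
  by (simp add: Series_inverse)

lemma series_eqI: "(\<And>m. coeff F m = coeff G m) \<Longrightarrow> F = G"
  by (simp add: coeff_inject[symmetric] fun_eq_iff)

instantiation series :: (graded_index, rat_algebra) rat_algebra
begin

definition "0 = Series (\<lambda>_. 0)"
definition "1 = Series (\<lambda>m. if m = 0 then 1 else 0)"
definition "F + G = Series (\<lambda>m. coeff F m + coeff G m)"
definition "F - G = Series (\<lambda>m. coeff F m - coeff G m)"
definition "- F = Series (\<lambda>m. - coeff F m)"
definition "F * G = Series (\<lambda>m. \<Sum>(a, b) | a + b = m. coeff F a * coeff G b)"
definition "c *\<^sub>Q F = Series (\<lambda>m. c *\<^sub>Q coeff F m)"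

lemma coeff_zero: "coeff 0 m = 0"
  and coeff_one: "coeff 1 m = (if m = 0 then 1 else 0)"
  and coeff_add: "coeff (F + G) m = coeff F m + coeff G m"
  and coeff_diff: "coeff (F - G) m = coeff F m - coeff G m"
  and coeff_uminus: "coeff (- F) m = - coeff F m"
  and coeff_mult: "coeff (F * G) m = (\<Sum>(a, b) | a + b = m. coeff F a * coeff G b)"
  and coeff_scaleQ: "coeff (c *\<^sub>Q F) m = c *\<^sub>Q coeff F m"
  by (simp_all add: zero_series_def one_series_def plus_series_def minus_series_def
      uminus_series_def times_series_def scaleQ_series_def)

lemmas coeff_simps = coeff_zero coeff_one coeff_add coeff_diff coeff_uminus coeff_mult coeff_scaleQ

lemma scaleQ_zero_right: "c *\<^sub>Q (0 :: 'c :: rat_algebra) = 0"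
  using scaleQ_add_right[of c "0 :: 'c" 0] by simp

lemma scaleQ_sum_right: "c *\<^sub>Q (sum f A :: 'c :: rat_algebra) = (\<Sum>i\<in>A. c *\<^sub>Q f i)"
  by (induction A rule: infinite_finite_induct) (simp_all add: scaleQ_zero_right scaleQ_add_right)

instance
proof
  fix F G H :: "('a, 'b) series" and c d :: rat
  show "F + G + H = F + (G + H)" "F + G = G + F" "0 + F = F" "- F + F = 0" "F - G = F + - G"
    by (rule series_eqI; simp add: coeff_simps ac_simps)+
  show "c *\<^sub>Q (F + G) = c *\<^sub>Q F + c *\<^sub>Q G" "(c + d) *\<^sub>Q F = c *\<^sub>Q F + d *\<^sub>Q F"
    "c *\<^sub>Q d *\<^sub>Q F = (c * d) *\<^sub>Q F" "1 *\<^sub>Q F = F"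
    by (rule series_eqI; simp add: coeff_simps scaleQ_add_right scaleQ_add_left
        scaleQ_scaleQ scaleQ_one)+
  show "(c *\<^sub>Q F) * G = c *\<^sub>Q (F * G)"
    by (rule series_eqI)
      (simp add: coeff_simps scaleQ_sum_right scaleQ_mult_left case_prod_unfold)
  show "(F + G) * H = F * H + G * H"
    by (rule series_eqI)
      (simp add: coeff_simps distrib_right case_prod_unfold sum.distrib)
  show "F * G = G * F"
  proof (rule series_eqI)
    fix m
    show "coeff (F * G) m = coeff (G * F) m"
      unfolding coeff_mult
      by (rule sum.reindex_bij_witness[of _ prod.swap prod.swap]) (auto simp: ac_simps)
  qed
  show "1 * F = F"
  proof (rule series_eqI)
    fix m
    have "coeff (1 * F) m = (\<Sum>(a, b) | a + b = m. if a = 0 then coeff F b else 0)"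
      unfolding coeff_mult by (intro sum.cong) (auto simp: coeff_one)
    also have "\<dots> = (\<Sum>(a, b) \<in> {(0 :: 'a, m)}. if a = 0 then coeff F b else 0)"
      by (rule sum.mono_neutral_right) (auto simp: finite_splits split: if_splits)
    finally show "coeff (1 * F) m = coeff F m" by simp
  qed
  show "F * G * H = F * (G * H)"
  proof (rule series_eqI)
    fix m
    have fin: "finite {(a, b). a + b = (z :: 'a)}" for z by (rule finite_splits)
    have "coeff (F * G * H) m =
        (\<Sum>x \<in> {(x, c). x + c = m}. \<Sum>y \<in> {(a, b). a + b = fst x}.
           coeff F (fst y) * coeff G (snd y) * coeff H (snd x))"
      unfolding coeff_mult by (intro sum.cong refl) (auto simp: sum_distrib_right case_prod_unfold)
    also have "\<dots> = (\<Sum>(x, y) \<in> (SIGMA x:{(x, c). x + c = m}. {(a, b). a + b = fst x}).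
           coeff F (fst y) * coeff G (snd y) * coeff H (snd x))"
      by (rule sum.Sigma) (auto simp: fin)
    also have "\<dots> = (\<Sum>(x, y) \<in> (SIGMA x:{(a, z). a + z = m}. {(b, c). b + c = snd x}).
           coeff F (fst x) * (coeff G (fst y) * coeff H (snd y)))"
      by (rule sum.reindex_bij_witness
          [of _ "\<lambda>((a, z), (b, c)). ((a + b, c), (a, b))" "\<lambda>((x, c), (a, b)). ((a, b + c), (b, c))"])
        (auto simp: add.assoc mult.assoc)
    also have "\<dots> = (\<Sum>x \<in> {(a, z). a + z = m}. \<Sum>y \<in> {(b, c). b + c = snd x}.
           coeff F (fst x) * (coeff G (fst y) * coeff H (snd y)))"
      by (rule sum.Sigma[symmetric]) (auto simp: fin)
    also have "\<dots> = coeff (F * (G * H)) m"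
      unfolding coeff_mult by (intro sum.cong refl) (auto simp: sum_distrib_left case_prod_unfold)
    finally show "coeff (F * G * H) m = coeff (F * (G * H)) m" .
  qed
qed

end

text \<open>\<open>p\<^sub>n\<close> acts on the coefficients and sends \<open>p\<^sub>k[X]\<close> to \<open>p\<^bsub>nk\<^esub>[X]\<close>. The filtration is the
  tensor product of the filtration of \<open>\<Lambda>\<close> with the filtration by degree; the
  subtraction is truncated, so coefficients of degree at least \<open>k\<close> are unconstrained
  in \<open>filt k\<close>.\<close>

instantiation series :: (graded_index, complete_lambda_ring) complete_lambda_ring
begin

definition "adams n F =
  Series (\<lambda>m. if m \<in> range (dilate n) then adams n (coeff F (inv (dilate n) m)) else 0)"
definition "filt k = {F. \<forall>m. coeff F m \<in> filt (k - deg m)}"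

lemma coeff_adams_dilate:
  "n \<ge> 1 \<Longrightarrow> coeff (adams n F) (dilate n m) = adams n (coeff F m)"
  by (simp add: adams_series_def inv_f_f inj_dilate)

lemma coeff_adams_notin: "m \<notin> range (dilate n) \<Longrightarrow> coeff (adams n F) m = 0"
  by (simp add: adams_series_def)

lemma adams_eqI:
  assumes "n \<ge> 1" "\<And>m. coeff H (dilate n m) = adams n (coeff F m)"
    and "\<And>m. m \<notin> range (dilate n) \<Longrightarrow> coeff H m = 0"
  shows "adams n F = (H :: ('a, 'b) series)"
proof (rule series_eqI)
  fix m show "coeff (adams n F) m = coeff H m"
    using assms by (cases "m \<in> range (dilate n)") (auto simp: coeff_adams_dilate coeff_adams_notin)
qed

instance
proof
  fix F G :: "('a, 'b) series" and X :: "nat \<Rightarrow> ('a, 'b) series" and i j k m n :: nat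
  show "adams n (F + G) = adams n F + adams n G" if "n \<ge> 1"
    using that by (intro adams_eqI)
      (auto simp: coeff_add coeff_adams_dilate coeff_adams_notin adams_add)
  show "adams n (1 :: ('a, 'b) series) = 1" if "n \<ge> 1"
  proof (rule adams_eqI[OF that])
    have "dilate n x = 0 \<longleftrightarrow> x = 0" for x :: 'a
      using inj_dilate[OF that] dilate_zero[of n] by (metis injD)
    then show "coeff 1 (dilate n x) = adams n (coeff (1 :: ('a, 'b) series) x)" for x
      using that by (simp add: coeff_one adams_one adams_zero)
    show "coeff (1 :: ('a, 'b) series) x = 0" if "x \<notin> range (dilate n)" for x
      using that dilate_zero[of n, where ?'a = 'a] by (auto simp: coeff_one)
  qed
  show "adams n (F * G) = adams n F * adams n G" if n: "n \<ge> 1"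
  proof (rule adams_eqI[OF n])
    fix x :: 'a
    have inj: "inj (dilate n :: 'a \<Rightarrow> 'a)" by (rule inj_dilate[OF n])
    let ?d = "map_prod (dilate n) (dilate n) :: 'a \<times> 'a \<Rightarrow> 'a \<times> 'a"
    have eq: "?d ` {(a, b). a + b = x} = {(a, b). a + b = dilate n x}" (is "?L = ?R")
    proof
      show "?L \<subseteq> ?R" by (auto simp: dilate_add)
      show "?R \<subseteq> ?L"
      proof
        fix y assume "y \<in> ?R"
        then obtain a b where y: "y = (a, b)" and ab: "a + b = dilate n x" by auto
        then obtain a' b' where d: "a = dilate n a'" "b = dilate n b'"
          using dilate_split[OF n] by blast
        then have "a' + b' = x" using ab inj by (metis dilate_add injD)
        then show "y \<in> ?L" using y d by force
      qed
    qed
    have "coeff (adams n F * adams n G) (dilate n x) =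
        (\<Sum>(a, b) \<in> ?d ` {(a, b). a + b = x}. coeff (adams n F) a * coeff (adams n G) b)"
      by (simp add: coeff_mult eq)
    also have "\<dots> = (\<Sum>(a, b) | a + b = x.
        coeff (adams n F) (dilate n a) * coeff (adams n G) (dilate n b))"
      by (subst sum.reindex) (auto simp: inj_on_def case_prod_unfold dest!: injD[OF inj])
    also have "\<dots> = adams n (coeff (F * G) x)"
      using n by (simp add: coeff_mult adams_sum coeff_adams_dilate adams_mult case_prod_unfold)
    finally show "coeff (adams n F * adams n G) (dilate n x) = adams n (coeff (F * G) x)" .
  next
    fix x :: 'a assume x: "x \<notin> range (dilate n)"
    show "coeff (adams n F * adams n G) x = 0"
      unfolding coeff_mult
    proof (rule sum.neutral, clarify)
      fix a b assume "x = a + b"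
      with x have "a \<notin> range (dilate n) \<or> b \<notin> range (dilate n)"
        by (auto simp flip: dilate_add)
      then show "coeff (adams n F) a * coeff (adams n G) b = 0"
        by (auto simp: coeff_adams_notin)
    qed
  qed
  show "adams 1 F = F"
  proof (rule adams_eqI)
    have "dilate 1 = (\<lambda>x :: 'a. x)" by (rule ext) (rule dilate_1)
    then show "coeff F (dilate 1 x) = adams 1 (coeff F x)" "x \<notin> range (dilate 1) \<Longrightarrow> coeff F x = 0" for x
      by (simp_all only: adams_1 image_ident UNIV_I not_True_eq_False False_implies_equals)
  qed simp
  show "adams m (adams n F) = adams (m * n) F" if mn: "m \<ge> 1" "n \<ge> 1"
  proof -
    have mn1: "m * n \<ge> 1" using mn by simp
    have "adams (m * n) F = adams m (adams n F)"
    proof (rule adams_eqI[OF mn1])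
      show "coeff (adams m (adams n F)) (dilate (m * n) x) = adams (m * n) (coeff F x)" for x
        using mn by (simp add: coeff_adams_dilate adams_adams flip: dilate_dilate)
      fix x :: 'a assume x: "x \<notin> range (dilate (m * n))"
      show "coeff (adams m (adams n F)) x = 0"
      proof (cases "x \<in> range (dilate m)")
        case True
        then obtain y where y: "x = dilate m y" by blast
        have "y \<notin> range (dilate n)" using x y mn by (auto simp: dilate_dilate)
        then show ?thesis using mn y by (simp add: coeff_adams_dilate coeff_adams_notin adams_zero)
      qed (simp add: coeff_adams_notin)
    qed
    then show ?thesis by simp
  qed
  show "filt 0 = (UNIV :: ('a, 'b) series set)"
    by (simp add: filt_series_def filt_0)
  show "filt (Suc k) \<subseteq> (filt k :: ('a, 'b) series set)"
  proof
    fix H :: "('a, 'b) series" assume H: "H \<in> filt (Suc k)"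
    have "coeff H x \<in> filt (k - deg x)" for x
    proof (rule subsetD[OF filt_antimono])
      show "k - deg x \<le> Suc k - deg x" by simp
      show "coeff H x \<in> filt (Suc k - deg x)" using H by (simp add: filt_series_def)
    qed
    then show "H \<in> filt k" by (simp add: filt_series_def)
  qed
  show "0 \<in> (filt k :: ('a, 'b) series set)"
    by (simp add: filt_series_def coeff_zero filt_zero)
  show "F \<in> filt k \<Longrightarrow> G \<in> filt k \<Longrightarrow> F - G \<in> filt k"
    by (simp add: filt_series_def coeff_diff filt_diff)
  show "F * G \<in> filt (i + j)" if F: "F \<in> filt i" and G: "G \<in> filt j"
  proof -
    have "coeff (F * G) x \<in> filt (i + j - deg x)" for x
      unfolding coeff_mult
    proof (rule filt_sum, clarify)
      fix a b assume x: "x = a + b"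
      have "coeff F a * coeff G b \<in> filt ((i - deg a) + (j - deg b))"
        using F G by (intro filt_mult) (auto simp: filt_series_def)
      moreover have "filt ((i - deg a) + (j - deg b)) \<subseteq> (filt (i + j - deg (a + b)) :: 'b set)"
        by (rule filt_antimono) (simp add: deg_add)
      ultimately show "coeff F a * coeff G b \<in> filt (i + j - deg (a + b))" by blast
    qed
    then show ?thesis by (simp add: filt_series_def)
  qed
  show "\<exists>l. \<forall>F\<in>filt l. adams n F \<in> (filt k :: ('a, 'b) series set)" if n: "n \<ge> 1"
  proof -
    obtain l where l: "\<And>x. x \<in> filt l \<Longrightarrow> adams n x \<in> (filt k :: 'b set)"
      using adams_continuous[OF n] by blast
    have "adams n F \<in> filt k" if F: "F \<in> filt (l + k)" for F :: "('a, 'b) series"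
      unfolding filt_series_def
    proof clarify
      fix x
      show "coeff (adams n F) x \<in> filt (k - deg x)"
      proof (cases "x \<in> range (dilate n)")
        case True
        then obtain y where y: "x = dilate n y" by blast
        show ?thesis
        proof (cases "deg x \<ge> k")
          case False
          have "deg y \<le> deg x" using n y by (cases n) (simp_all add: deg_dilate)
          then have "l \<le> l + k - deg y" using False by simp
          then have "filt (l + k - deg y) \<subseteq> (filt l :: 'b set)" by (rule filt_antimono)
          then have "coeff F y \<in> filt l" using F by (auto simp: filt_series_def)
          then have "adams n (coeff F y) \<in> filt k" by (rule l)
          then have "adams n (coeff F y) \<in> filt (k - deg x)"
            using filt_antimono[of "k - deg x" k] by auto
          then show ?thesis using n y by (simp add: coeff_adams_dilate)
        qed (simp add: filt_0)
      qed (simp add: coeff_adams_notin filt_zero)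
    qed
    then show ?thesis by blast
  qed
  show "F = 0" if "\<And>k. F \<in> filt k"
  proof (rule series_eqI)
    fix x
    have "coeff F x \<in> filt k" for k
    proof -
      have "F \<in> filt (k + deg x)" by (rule that)
      then have "coeff F x \<in> filt (k + deg x - deg x)" unfolding filt_series_def by blast
      then show ?thesis by simp
    qed
    then show "coeff F x = coeff 0 x" by (simp add: coeff_zero filt_separated)
  qed
  show "\<exists>F. \<forall>k. \<exists>N. \<forall>n\<ge>N. X n - F \<in> filt k"
    if cauchy: "\<And>k. \<exists>N. \<forall>m\<ge>N. \<forall>n\<ge>N. X m - X n \<in> filt k"
  proof -
    have "\<exists>y. \<forall>k. \<exists>N. \<forall>n\<ge>N. coeff (X n) x - y \<in> filt k" for x
    proof (rule filt_complete)
      fix k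
      obtain N where N: "\<And>m n. m \<ge> N \<Longrightarrow> n \<ge> N \<Longrightarrow> X m - X n \<in> filt (k + deg x)"
        using cauchy[of "k + deg x"] by blast
      have "coeff (X m) x - coeff (X n) x \<in> filt k" if "m \<ge> N" "n \<ge> N" for m n
      proof -
        have "coeff (X m - X n) x \<in> filt (k + deg x - deg x)"
          using N[OF that] unfolding filt_series_def by blast
        then show ?thesis by (simp add: coeff_diff)
      qed
      then show "\<exists>N. \<forall>m\<ge>N. \<forall>n\<ge>N. coeff (X m) x - coeff (X n) x \<in> filt k" by blast
    qed
    then obtain f where "\<forall>x. \<forall>k. \<exists>N. \<forall>n\<ge>N. coeff (X n) x - f x \<in> filt k"
      using choice[of "\<lambda>x y. \<forall>k. \<exists>N. \<forall>n\<ge>N. coeff (X n) x - y \<in> filt k"] by blast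
    then have f: "\<forall>x. \<exists>N. \<forall>n\<ge>N. coeff (X n) x - f x \<in> filt k" for k
      by simp
    have "\<exists>N. \<forall>n\<ge>N. X n - Series f \<in> filt k" for k
    proof -
      obtain N where N: "\<And>x n. n \<ge> N x \<Longrightarrow> coeff (X n) x - f x \<in> filt k"
        using choice[OF f[of k]] by auto
      have "X n - Series f \<in> filt k" if n: "n \<ge> Max (insert 0 (N ` {x. deg x \<le> k}))" for n
      proof -
        have "coeff (X n - Series f) x \<in> filt (k - deg x)" for x
        proof (cases "deg x \<le> k")
          case True
          have "N x \<le> Max (insert 0 (N ` {x. deg x \<le> k}))"
            using True by (intro Max_ge) (auto simp: finite_deg_le)
          then have "coeff (X n) x - f x \<in> filt k" using n by (intro N) simp
          moreover have "filt k \<subseteq> (filt (k - deg x) :: 'b set)" by (rule filt_antimono) simp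
          ultimately show ?thesis by (auto simp: coeff_diff)
        qed (simp add: filt_0)
        then show ?thesis by (simp add: filt_series_def)
      qed
      then show ?thesis by blast
    qed
    then show ?thesis by blast
  qed
qed

end

text \<open>\<open>c F\<close>, base change of coefficients, and the basis element \<open>p\<^sub>m\<close>.\<close>

definition smult :: "'a \<Rightarrow> ('m, 'a::times) series \<Rightarrow> ('m, 'a) series" where
  "smult c F = Series (\<lambda>m. c * coeff F m)"

definition map_coeff :: "('a \<Rightarrow> 'b) \<Rightarrow> ('m, 'a) series \<Rightarrow> ('m, 'b) series" where
  "map_coeff h F = Series (\<lambda>m. h (coeff F m))"

definition basis :: "'m \<Rightarrow> ('m, 'a::rat_algebra) series" where
  "basis m = Series (\<lambda>m'. if m' = m then 1 else 0)"

text \<open>The completed tensor product \<open>\<Lambda> \<otimes> Sym[X]\<close>: here \<open>Sym[X]\<close> is not completed by degree, so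
  the coefficients must tend to zero in \<open>\<Lambda>\<close>.\<close>

definition Sym :: "(partition, 'a::complete_lambda_ring) series set" where
  "Sym = {F. \<forall>k. finite {\<nu>. coeff F \<nu> \<notin> filt k}}"


section \<open>Good modifiers, well-behaved sequences and localization\<close>

text \<open>\<open>p\<^sub>\<nu>[A]\<close>\<close>

definition padams :: "partition \<Rightarrow> 'a::complete_lambda_ring \<Rightarrow> 'a" where
  "padams \<nu> A = (\<Prod>n\<in>#parts \<nu>. adams n A)"

text \<open>The empty partition is excluded, since \<open>p\<^sub>\<emptyset>[A\<^sub>i] = 1\<close> would have to lie in every \<open>J\<^sup>k\<close>.
  Sequences are indexed from 0, which does not affect the notion.\<close>

definition well_behaved :: "(nat \<Rightarrow> 'a::complete_lambda_ring) \<Rightarrow> bool" where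
  "well_behaved A \<longleftrightarrow> (\<forall>k. \<exists>i0. \<forall>i \<nu>. \<nu> \<noteq> 0 \<and> (i > i0 \<or> deg \<nu> > i0) \<longrightarrow> padams \<nu> (A i) \<in> filt k)"

definition well_behaved_elem :: "'a::complete_lambda_ring \<Rightarrow> bool" where
  "well_behaved_elem A \<longleftrightarrow> well_behaved (\<lambda>i. if i = 0 then A else 0)"

text \<open>Well-behavedness does not depend on the order of the sequence, so the choice of the
  enumeration of the basis is immaterial.\<close>

definition well_behaved_coeffs ::
  "(partition \<times> partition, 'a::complete_lambda_ring) series \<Rightarrow> bool" where
  "well_behaved_coeffs L \<longleftrightarrow>
     (\<exists>e :: nat \<Rightarrow> partition \<times> partition. bij e \<and> well_behaved (\<lambda>i. coeff L (e i)))"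

definition good_modifier :: "'a::complete_lambda_ring \<Rightarrow> bool" where
  "good_modifier S \<longleftrightarrow>
     (\<forall>n\<ge>1. \<forall>x. adams n S * x = 0 \<longrightarrow> x = 0) \<and>
     (\<forall>n\<ge>1. S dvd adams n S) \<and>
     (\<forall>m\<ge>1. \<forall>n\<ge>1. coprime m n \<longrightarrow> adams m S * adams n S dvd S * adams (m * n) S)"

definition unit_inv :: "'a::comm_monoid_mult \<Rightarrow> 'a" where
  "unit_inv x = (THE y. x * y = 1)"

text \<open>\<open>completed_localization S \<iota>\<close>: the ring homomorphism \<open>\<iota>\<close>, compatible with the \<open>p\<^sub>n\<close>,
  exhibits its codomain as the completion of \<open>\<Lambda>\<^sub>S = \<Lambda>[S\<inverse>, p\<^sub>2[S]\<inverse>, \<dots>]\<close> with respect to the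
  induced filtration \<open>J\<^sup>k \<Lambda>\<^sub>S\<close>. The denominators of \<open>\<Lambda>\<^sub>S\<close> are the products \<open>p\<^sub>\<nu>[S]\<close>. They
  become invertible, \<open>a\<close> is mapped into the \<open>k\<close>-th step of the filtration iff \<open>a\<close> lies in
  \<open>J\<^sup>k \<Lambda>\<^sub>S\<close>, that is iff \<open>p\<^sub>\<nu>[S] a \<in> J\<^sup>k\<close> for some \<open>\<nu>\<close>, and the fractions are dense. The
  codomain being complete, this determines it and its filtration up to unique isomorphism.\<close>

definition completed_localization ::
  "'a::complete_lambda_ring \<Rightarrow> ('a \<Rightarrow> 'b::complete_lambda_ring) \<Rightarrow> bool" where
  "completed_localization S \<iota> \<longleftrightarrow>
     \<iota> 1 = 1 \<and> (\<forall>a b. \<iota> (a + b) = \<iota> a + \<iota> b) \<and> (\<forall>a b. \<iota> (a * b) = \<iota> a * \<iota> b) \<and>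
     (\<forall>n\<ge>1. \<forall>a. \<iota> (adams n a) = adams n (\<iota> a)) \<and>
     (\<forall>n\<ge>1. \<iota> (adams n S) dvd 1) \<and>
     (\<forall>k a. \<iota> a \<in> filt k \<longleftrightarrow> (\<exists>\<nu>. padams \<nu> S * a \<in> filt k)) \<and>
     (\<forall>k x. \<exists>a \<nu>. x - \<iota> a * unit_inv (\<iota> (padams \<nu> S)) \<in> filt k)"


section \<open>Modified Hall inner product, kernels and traces\<close>

definition zee :: "partition \<Rightarrow> nat" where
  "zee \<nu> = (\<Prod>i\<in>set_mset (parts \<nu>). i ^ count (parts \<nu>) i * fact (count (parts \<nu>) i))"

text \<open>The Hall inner product, \<open>(p\<^sub>\<mu>, p\<^sub>\<nu>) = \<delta>\<^bsub>\<mu>\<nu>\<^esub> z\<^sub>\<nu>\<close>, extended bilinearly.\<close>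

definition hall ::
  "(partition, 'a::complete_lambda_ring) series \<Rightarrow> (partition, 'a) series \<Rightarrow> 'a" where
  "hall F G = fsum (\<lambda>\<nu>. of_nat (zee \<nu>) *\<^sub>Q (coeff F \<nu> * coeff G \<nu>)) UNIV"

text \<open>\<open>F[SX]\<close>\<close>

definition pleth_scale ::
  "'a::complete_lambda_ring \<Rightarrow> (partition, 'a) series \<Rightarrow> (partition, 'a) series" where
  "pleth_scale S F = Series (\<lambda>\<nu>. padams \<nu> S * coeff F \<nu>)"

definition hall_mod ::
  "'a::complete_lambda_ring \<Rightarrow> (partition, 'a) series \<Rightarrow> (partition, 'a) series \<Rightarrow> 'a" where
  "hall_mod S F G = hall (pleth_scale S F) G"

text \<open>\<open>\<integral>\<^sub>X\<^sup>S K[X,X\<^sup>*]\<close>, the (continuous) linear extension of \<open>F[X] G[X\<^sup>*] \<mapsto> (F, G)\<^sup>S\<close>.\<close>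

definition mod_integral ::
  "'a::complete_lambda_ring \<Rightarrow> (partition \<times> partition, 'a) series \<Rightarrow> 'a" where
  "mod_integral S K = fsum (\<lambda>(\<mu>, \<nu>). coeff K (\<mu>, \<nu>) * hall_mod S (basis \<mu>) (basis \<nu>)) UNIV"

definition Lambda_linear ::
  "('a::complete_lambda_ring \<Rightarrow> 'b::complete_lambda_ring) \<Rightarrow>
   ((partition, 'a) series \<Rightarrow> (partition, 'b) series) \<Rightarrow> bool" where
  "Lambda_linear \<iota> U \<longleftrightarrow>
     (\<forall>F\<in>Sym. \<forall>G\<in>Sym. U (F + G) = U F + U G) \<and>
     (\<forall>a. \<forall>F\<in>Sym. U (smult a F) = smult (\<iota> a) (U F))"

text \<open>The extension of \<open>U\<close> to coefficients in \<open>\<Lambda>\<^sub>S\<close> and in symmetric functions of \<open>Y\<close>: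
  \<open>\<Sum> c\<^bsub>\<mu>\<nu>\<^esub> p\<^sub>\<mu>[X] p\<^sub>\<nu>[Y]\<close> is sent to \<open>\<Sum> c\<^bsub>\<mu>\<nu>\<^esub> (U p\<^sub>\<mu>)[X] p\<^sub>\<nu>[Y]\<close>.\<close>

definition extend_op ::
  "((partition, 'a::complete_lambda_ring) series \<Rightarrow> (partition, 'b::complete_lambda_ring) series) \<Rightarrow>
   (partition \<times> partition, 'b) series \<Rightarrow> (partition \<times> partition, 'b) series" where
  "extend_op U F =
     Series (\<lambda>(\<rho>, \<nu>). fsum (\<lambda>\<mu>. coeff F (\<mu>, \<nu>) * coeff (U (basis \<mu>)) \<rho>) UNIV)"

text \<open>\<open>XY = p\<^sub>1[X] p\<^sub>1[Y]\<close>\<close>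

definition XY :: "(partition \<times> partition, 'a::rat_algebra) series" where
  "XY = basis (Partition {#1#}, Partition {#1#})"

definition kernel ::
  "'a::complete_lambda_ring \<Rightarrow> ('a \<Rightarrow> 'b::complete_lambda_ring) \<Rightarrow>
   ((partition, 'a) series \<Rightarrow> (partition, 'b) series) \<Rightarrow> (partition \<times> partition, 'b) series" where
  "kernel S \<iota> U = extend_op U (Exp (smult (unit_inv (\<iota> S)) XY))"

text \<open>\<open>L\<close> is a possible \<open>L\<^sub>U\<^sup>S\<close>.\<close>

definition is_log_kernel ::
  "'a::complete_lambda_ring \<Rightarrow> ('a \<Rightarrow> 'b::complete_lambda_ring) \<Rightarrow>
   ((partition, 'a) series \<Rightarrow> (partition, 'b) series) \<Rightarrow>
   (partition \<times> partition, 'a) series \<Rightarrow> bool" where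
  "is_log_kernel S \<iota> U L \<longleftrightarrow>
     kernel S \<iota> U = Exp (smult (unit_inv (\<iota> S)) (map_coeff \<iota> L)) \<and>
     well_behaved_elem (coeff L 0)"

definition admissible_op ::
  "'a::complete_lambda_ring \<Rightarrow> ('a \<Rightarrow> 'b::complete_lambda_ring) \<Rightarrow>
   ((partition, 'a) series \<Rightarrow> (partition, 'b) series) \<Rightarrow> bool" where
  "admissible_op S \<iota> U \<longleftrightarrow> (\<exists>L. is_log_kernel S \<iota> U L)"

definition trace_class ::
  "'a::complete_lambda_ring \<Rightarrow> ('a \<Rightarrow> 'b::complete_lambda_ring) \<Rightarrow>
   ((partition, 'a) series \<Rightarrow> (partition, 'b) series) \<Rightarrow> bool" where
  "trace_class S \<iota> U \<longleftrightarrow> (\<exists>L. is_log_kernel S \<iota> U L \<and> well_behaved_coeffs L)"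

definition trace ::
  "'a::complete_lambda_ring \<Rightarrow> ('a \<Rightarrow> 'b::complete_lambda_ring) \<Rightarrow>
   ((partition, 'a) series \<Rightarrow> (partition, 'b) series) \<Rightarrow> 'b" where
  "trace S \<iota> U = mod_integral (\<iota> S) (kernel S \<iota> U)"

text \<open>\<open>S\<close>-admissibility of an element of \<open>\<Lambda>\<^sub>S\<close>. As for kernels, the constant term of \<open>L\<close>, which is
  now \<open>L\<close> itself, is well-behaved; this makes the series defining \<open>Exp[L/S]\<close> converge.\<close>

definition admissible_elem ::
  "'a::complete_lambda_ring \<Rightarrow> ('a \<Rightarrow> 'b::complete_lambda_ring) \<Rightarrow> 'b \<Rightarrow> bool" where
  "admissible_elem S \<iota> F \<longleftrightarrow>
     (\<exists>L. well_behaved_elem L \<and> F = Exp (unit_inv (\<iota> S) * \<iota> L))"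

end

theory Submission
  imports Defs "HOL-Number_Theory.Totient"
begin

text \<open>The trace of \<open>K = Exp[L/S]\<close> is \<open>\<Sum>\<^sub>\<nu> z\<^sub>\<nu> p\<^sub>\<nu>[S] K\<^bsub>\<nu>\<nu>\<^esub>\<close>, the value at \<open>X = Y = 0\<close> of
  \<open>F = exp(\<Sum>\<^sub>k k p\<^sub>k[S] x\<^sub>k y\<^sub>k) K\<close>, where \<open>x\<^sub>k\<close> and \<open>y\<^sub>k\<close> are the derivatives with respect to \<open>p\<^sub>k[X]\<close> and
  \<open>p\<^sub>k[Y]\<close>. Let the coefficients \<open>a\<^bsub>\<mu>\<nu>\<^esub>\<close> of \<open>L\<close> be indeterminates with \<open>p\<^sub>n[a\<^bsub>\<mu>\<nu>\<^esub>]\<close> of weight \<open>n |\<mu>|\<close>, and let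
  \<open>\<omega>\<close> be this weight minus the degree in \<open>X\<close>. Then \<open>F\<close> is determined by its part \<open>K\<close> with \<open>\<omega> = 0\<close> and by
  \<open>E F = \<Sum>\<^sub>k k\<^sup>2 p\<^sub>k[S] x\<^sub>k y\<^sub>k F\<close>, where \<open>E\<close> multiplies by \<open>\<omega>\<close>. For \<open>F = Exp[V]\<close> this follows from
  \<open>E V = \<Sum>\<^sub>n p\<^sub>n[S] Q\<^sub>n(V)\<close> with
  \<open>Q\<^sub>n(V) = \<Sum> \<phi>(g) k\<^sup>2 p\<^sub>g[x\<^sub>k y\<^sub>k V] + \<Sum> n\<^sup>2/(g h) p\<^sub>g[x\<^sub>k V] p\<^sub>h[y\<^sub>l V]\<close>,
  summed over \<open>g k = n\<close>, respectively over \<open>g k = h l = n\<close> with \<open>g\<close>, \<open>h\<close> coprime. This is a recursion in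
  \<open>\<omega>\<close> for \<open>V\<close>, starting from \<open>L/S\<close>. As \<open>S p\<^sub>n[S]\<close> is divisible by \<open>p\<^sub>g[S]\<close> if \<open>g\<close> divides \<open>n\<close>, and by
  \<open>p\<^sub>g[S] p\<^sub>h[S]\<close> if \<open>g\<close> and \<open>h\<close> are coprime divisors of \<open>n\<close>, the recursion keeps the coefficients of \<open>S V\<close> in
  \<open>\<Lambda>\<close>. The trace class condition makes the evaluation of the \<open>a\<^bsub>\<mu>\<nu>\<^esub>\<close> a continuous homomorphism, which sends
  \<open>Exp[V]\<close> at \<open>X = Y = 0\<close> to the trace.\<close>


section \<open>Unordered sums in a complete filtered ring\<close>

text \<open>Where the equation comes from: with \<open>p_k[S]\<close> replaced by
  \<open>t^k p_k[S]\<close>, F becomes a path that starts at K and satisfies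
  \<open>t dF/dt = \<Sum> k^2 t^k p_k[S] x_k y_k F\<close>; one factor k is the Hall norm of
  \<open>p_k\<close>, the other the exponent of t. As K has \<open>\<omega> = 0\<close> and
  \<open>x_k\<close> raises \<open>\<omega>\<close> by k, \<open>t d/dt\<close> is E. The
  coefficients of the given L carry no such grading, hence the indeterminates. The obstacle is
  denominators. Since F = exp(W) with W the sum of the \<open>p_d[V]/d\<close>, the equation for W
  contains \<open>p_j[S] p_g[x_k V] p_h[y_l V]\<close> for all divisors g, h of j. With V of
  denominator S this brings in \<open>p_g[S] p_h[S]\<close>, which condition (iii) controls for
  coprime g, h only. But E W is the sum of the \<open>p_d[E V]\<close>, and a pair with gcd d is
  \<open>p_d\<close> of a coprime pair. Moebius inversion therefore leaves in E V just the coprime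
  pairs, and it turns the weights of the linear terms into totients. \<open>Q\<close> is this
  inverse in closed form; the proof verifies it by summing over d.\<close>

definition fsummable :: "('i \<Rightarrow> 'a::complete_lambda_ring) \<Rightarrow> 'i set \<Rightarrow> bool" where
  "fsummable f A \<longleftrightarrow> (\<forall>k. finite {i\<in>A. f i \<notin> filt k})"

text \<open>These are the maps that may be taken inside \<open>fsum\<close>
  (\<open>fsum_map\<close>); compatibility with rational scalars follows by
  \<open>additive_scaleQ\<close>.\<close>

definition continuous_additive ::
  "('a::complete_lambda_ring \<Rightarrow> 'b::complete_lambda_ring) \<Rightarrow> bool" where
  "continuous_additive h \<longleftrightarrow>
     (\<forall>x y. h (x + y) = h x + h y) \<and> (\<forall>k. \<exists>m. \<forall>x\<in>filt m. h x \<in> filt k)"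

lemma filt_minus_commute: "x - y \<in> filt k \<Longrightarrow> y - x \<in> (filt k :: 'a::complete_lambda_ring set)"
  using filt_uminus[of "x - y" k] by simp

lemma filt_trans:
  "x - y \<in> filt k \<Longrightarrow> y - z \<in> filt k \<Longrightarrow> x - z \<in> (filt k :: 'a::complete_lambda_ring set)"
  using filt_add[of "x - y" k "y - z"] by simp

lemma filt_ideal: "x \<in> filt k \<Longrightarrow> x * y \<in> (filt k :: 'a::complete_lambda_ring set)"
  using filt_mult[of x k y 0] by (simp add: filt_0)

lemma filt_ideal': "x \<in> filt k \<Longrightarrow> y * x \<in> (filt k :: 'a::complete_lambda_ring set)"
  using filt_ideal[of x k y] by (simp add: mult.commute)

lemma eq_if_filt: "(\<And>k. x - y \<in> filt k) \<Longrightarrow> x = (y :: 'a::complete_lambda_ring)"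
  using filt_separated[of "x - y"] by simp

lemma scaleQ_zero_left: "0 *\<^sub>Q x = (0::'a::rat_algebra)"
  using scaleQ_add_left[of 0 0 x] by simp

lemma scaleQ_minus_left: "(- c) *\<^sub>Q x = - (c *\<^sub>Q (x::'a::rat_algebra))"
  using scaleQ_add_left[of c "- c" x] by (simp add: scaleQ_zero_left minus_unique)

lemma scaleQ_mult_right: "x * (c *\<^sub>Q y) = c *\<^sub>Q (x * (y::'a::rat_algebra))"
  using scaleQ_mult_left[of c y x] by (simp add: mult.commute)

lemma scaleQ_sum_left: "sum c A *\<^sub>Q (x::'a::rat_algebra) = (\<Sum>i\<in>A. c i *\<^sub>Q x)"
  by (induction A rule: infinite_finite_induct) (simp_all add: scaleQ_zero_left scaleQ_add_left)

lemma scaleQ_conv_mult: "c *\<^sub>Q x = (c *\<^sub>Q 1) * (x::'a::rat_algebra)"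
  by (simp add: scaleQ_mult_left)

lemma filt_scaleQ: "x \<in> filt k \<Longrightarrow> c *\<^sub>Q x \<in> (filt k :: 'a::complete_lambda_ring set)"
  by (subst scaleQ_conv_mult) (rule filt_ideal')

lemma additive_zero: "(\<And>x y. h (x + y) = h x + h y) \<Longrightarrow> h (0::'a::ab_group_add) = (0::'b::ab_group_add)"
  by (metis add_cancel_right_right add.right_neutral)

lemma additive_diff:
  assumes "\<And>x y. h (x + y) = h x + h (y::'a::ab_group_add)"
  shows "h (x - y) = h x - (h y::'b::ab_group_add)"
  using assms[of "x - y" y] by (simp add: algebra_simps)

lemma additive_sum:
  assumes "\<And>x y. h (x + y) = h x + h (y::'a::ab_group_add)"
  shows "h (sum f A) = (\<Sum>i\<in>A. (h (f i)::'b::ab_group_add))"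
  by (induction A rule: infinite_finite_induct) (simp_all add: assms additive_zero[OF assms])

lemma additive_scaleQ:
  assumes add: "\<And>x y. h (x + y) = h x + h (y::'a::rat_algebra)"
  shows "h (c *\<^sub>Q x) = c *\<^sub>Q (h x::'b::rat_algebra)"
proof -
  have nat: "h (of_nat n *\<^sub>Q y) = of_nat n *\<^sub>Q h y" for n y
    by (induction n) (simp_all add: scaleQ_zero_left scaleQ_add_left scaleQ_one add additive_zero[OF add])
  have neg: "h (- y) = - h y" for y
    using add[of y "- y"] by (simp add: additive_zero[OF add] minus_unique)
  have int: "h (of_int n *\<^sub>Q y) = of_int n *\<^sub>Q h y" for n y
  proof (cases n rule: int_cases2)
    case (nonpos m)
    show ?thesis unfolding nonpos of_int_minus of_int_of_nat_eq scaleQ_minus_left nat neg ..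
  qed (simp add: nat)
  obtain a b where ab: "b > 0" "c = of_int a / of_int b"
    by (metis quotient_of_div quotient_of_denom_pos' surjective_pairing)
  have "of_int b *\<^sub>Q h (c *\<^sub>Q x) = of_int a *\<^sub>Q h x"
    using ab by (simp add: int[symmetric] scaleQ_scaleQ)
  then have "(1 / of_int b) *\<^sub>Q of_int b *\<^sub>Q h (c *\<^sub>Q x) = (1 / of_int b) *\<^sub>Q of_int a *\<^sub>Q h x"
    by simp
  then show ?thesis using ab by (simp add: scaleQ_scaleQ scaleQ_one)
qed

lemma adams_scaleQ: "n \<ge> 1 \<Longrightarrow> adams n (c *\<^sub>Q x) = c *\<^sub>Q adams n (x::'a::complete_lambda_ring)"
  by (rule additive_scaleQ) (rule adams_add)

section \<open>Existence, uniqueness and finite approximation of unordered sums\<close>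

lemma fsummableD: "fsummable f A \<Longrightarrow> finite {i\<in>A. f i \<notin> filt k}"
  by (simp add: fsummable_def)

lemma fsummable_approx:
  assumes "fsummable f A"
  obtains B where "finite B" "B \<subseteq> A" "\<And>i. i \<in> A - B \<Longrightarrow> f i \<in> filt k"
  using that[of "{i\<in>A. f i \<notin> filt k}"] fsummableD[OF assms] by blast

lemma sum_minus_sum_in_filt:
  assumes "finite Y" "B \<subseteq> Y" "\<And>i. i \<in> Y - B \<Longrightarrow> f i \<in> filt k"
  shows "sum f Y - sum f B \<in> (filt k :: 'a::complete_lambda_ring set)"
proof -
  have "sum f Y = sum f (Y - B) + sum f B"
    using assms(2,1) by (rule sum.subset_diff)
  moreover have "sum f (Y - B) \<in> filt k"
    using assms(3) by (rule filt_sum)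
  ultimately show ?thesis by simp
qed

lemma has_fsum_iff:
  "has_fsum f A s \<longleftrightarrow>
   (\<forall>k. \<exists>X. finite X \<and> X \<subseteq> A \<and> (\<forall>Y. finite Y \<and> X \<subseteq> Y \<and> Y \<subseteq> A \<longrightarrow> sum f Y - s \<in> filt k))"
  by (simp add: has_fsum_def eventually_finite_subsets_at_top)

lemma has_fsumE:
  assumes "has_fsum f A s"
  obtains X where "finite X" "X \<subseteq> A"
    "\<And>Y. finite Y \<Longrightarrow> X \<subseteq> Y \<Longrightarrow> Y \<subseteq> A \<Longrightarrow> sum f Y - s \<in> filt k"
proof -
  obtain X where "finite X \<and> X \<subseteq> A \<and> (\<forall>Y. finite Y \<and> X \<subseteq> Y \<and> Y \<subseteq> A \<longrightarrow> sum f Y - s \<in> filt k)"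
    using assms[unfolded has_fsum_iff, THEN spec, of k] ..
  then show thesis by (intro that[of X]) simp_all
qed

lemma has_fsum_unique:
  assumes "has_fsum f A s" "has_fsum f A t"
  shows "s = (t::'a::complete_lambda_ring)"
proof (rule eq_if_filt)
  fix k
  obtain X where X: "finite X" "X \<subseteq> A"
      "\<And>Y. finite Y \<Longrightarrow> X \<subseteq> Y \<Longrightarrow> Y \<subseteq> A \<Longrightarrow> sum f Y - s \<in> filt k"
    using has_fsumE[OF assms(1), of k] by metis
  obtain Z where Z: "finite Z" "Z \<subseteq> A"
      "\<And>Y. finite Y \<Longrightarrow> Z \<subseteq> Y \<Longrightarrow> Y \<subseteq> A \<Longrightarrow> sum f Y - t \<in> filt k"
    using has_fsumE[OF assms(2), of k] by metis
  have "sum f (X \<union> Z) - s \<in> filt k" by (rule X(3)) (use X Z in auto)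
  moreover have "sum f (X \<union> Z) - t \<in> filt k" by (rule Z(3)) (use X Z in auto)
  ultimately show "s - t \<in> filt k" by (rule filt_trans[OF filt_minus_commute])
qed

lemma fsum_eqI: "has_fsum f A s \<Longrightarrow> fsum f A = (s::'a::complete_lambda_ring)"
  unfolding fsum_def by (rule the_equality) (auto intro: has_fsum_unique)

text \<open>Completeness enters here. Every \<open>filt k\<close> is a subgroup, so it suffices that
  the terms tend to zero: the partial sums over the increasing finite sets \<open>B n\<close> of
  terms outside \<open>filt n\<close> form a Cauchy sequence.\<close>

lemma fsummable_has_fsum:
  assumes "fsummable f A"
  shows "has_fsum f A (fsum f A :: 'a::complete_lambda_ring)"
proof -
  define B where "B n = {i\<in>A. f i \<notin> filt n}" for n
  have fin: "finite (B n)" for n using assms by (simp add: B_def fsummable_def)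
  have mono: "B n \<subseteq> B m" if "n \<le> m" for n m
    using filt_antimono[OF that, where ?'a = 'a] by (auto simp: B_def)
  have step: "sum f (B m) - sum f (B n) \<in> filt n" if "n \<le> m" for n m
    by (rule sum_minus_sum_in_filt) (use fin mono[OF that] in \<open>auto simp: B_def\<close>)
  have "\<exists>x. \<forall>k. \<exists>N. \<forall>n\<ge>N. sum f (B n) - x \<in> filt k"
  proof (rule filt_complete)
    fix k
    have "sum f (B m) - sum f (B n) \<in> filt k" if "m \<ge> k" "n \<ge> k" for m n
      by (rule filt_trans[OF step[OF that(1)] filt_minus_commute[OF step[OF that(2)]]])
    then show "\<exists>N. \<forall>m\<ge>N. \<forall>n\<ge>N. sum f (B m) - sum f (B n) \<in> filt k" by blast
  qed
  then obtain x where x: "\<And>k. \<exists>N. \<forall>n\<ge>N. sum f (B n) - x \<in> filt k" by blast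
  have "has_fsum f A x"
    unfolding has_fsum_iff
  proof
    fix k
    obtain N where N: "\<And>n. n \<ge> N \<Longrightarrow> sum f (B n) - x \<in> filt k" using x[of k] by blast
    \<comment> \<open>\<open>N\<close> puts the partial sum over \<open>B n\<close> near the limit
      \<open>x\<close>, \<open>k\<close> puts all terms outside \<open>B n\<close> into
      \<open>filt k\<close>.\<close>
    define n where "n = max N k"
    have "sum f Y - x \<in> filt k" if "finite Y" "B n \<subseteq> Y" "Y \<subseteq> A" for Y
    proof (rule filt_trans)
      show "sum f (B n) - x \<in> filt k" by (rule N) (simp add: n_def)
      have "sum f Y - sum f (B n) \<in> filt n"
        by (rule sum_minus_sum_in_filt) (use that in \<open>auto simp: B_def\<close>)
      moreover have "filt n \<subseteq> (filt k :: 'a set)" by (rule filt_antimono) (simp add: n_def)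
      ultimately show "sum f Y - sum f (B n) \<in> filt k" by blast
    qed
    then show "\<exists>X. finite X \<and> X \<subseteq> A \<and> (\<forall>Y. finite Y \<and> X \<subseteq> Y \<and> Y \<subseteq> A \<longrightarrow> sum f Y - x \<in> filt k)"
      using fin by (intro exI[of _ "B n"]) (auto simp: B_def)
  qed
  then show ?thesis using fsum_eqI by metis
qed

text \<open>This and \<open>fsum_eqI'\<close> reduce identities between infinite sums to finite sums
  modulo each \<open>filt k\<close>.\<close>

lemma fsum_approx:
  assumes "fsummable f A" "finite B" "B \<subseteq> A" "\<And>i. i \<in> A - B \<Longrightarrow> f i \<in> filt k"
  shows "fsum f A - sum f B \<in> (filt k :: 'a::complete_lambda_ring set)"
proof -
  obtain X where X: "finite X" "X \<subseteq> A"
      "\<And>Y. finite Y \<Longrightarrow> X \<subseteq> Y \<Longrightarrow> Y \<subseteq> A \<Longrightarrow> sum f Y - fsum f A \<in> filt k"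
    using has_fsumE[OF fsummable_has_fsum[OF assms(1)], of k] by metis
  have "sum f (X \<union> B) - fsum f A \<in> filt k" by (rule X(3)) (use X assms in auto)
  moreover have "sum f (X \<union> B) - sum f B \<in> filt k"
    by (rule sum_minus_sum_in_filt) (use X assms in auto)
  ultimately show ?thesis by (rule filt_trans[OF filt_minus_commute])
qed

lemma fsum_eqI':
  assumes "fsummable f A"
    and "\<And>k. \<exists>B. finite B \<and> B \<subseteq> A \<and> (\<forall>i\<in>A - B. f i \<in> filt k) \<and> sum f B - s \<in> filt k"
  shows "fsum f A = (s :: 'a::complete_lambda_ring)"
proof (rule eq_if_filt)
  fix k
  obtain B where "finite B" "B \<subseteq> A" "\<forall>i\<in>A - B. f i \<in> filt k" "sum f B - s \<in> filt k"
    using assms(2)[of k] by blast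
  then show "fsum f A - s \<in> filt k" by (intro filt_trans[OF fsum_approx[OF assms(1)]]) simp_all
qed

lemma fsummable_cong: "(\<And>i. i \<in> A \<Longrightarrow> f i = g i) \<Longrightarrow> fsummable f A \<longleftrightarrow> fsummable g A"
  unfolding fsummable_def by (simp cong: conj_cong)

lemma fsum_cong:
  assumes "\<And>i. i \<in> A \<Longrightarrow> f i = g i"
  shows "fsum f A = (fsum g A :: 'a::complete_lambda_ring)"
proof -
  have "has_fsum f A s = has_fsum g A s" for s
  proof -
    have "sum f Y = sum g Y" if "Y \<subseteq> A" for Y using assms that by (intro sum.cong) auto
    then show ?thesis unfolding has_fsum_iff by (simp cong: conj_cong imp_cong)
  qed
  then show ?thesis by (simp add: fsum_def)
qed

lemma fsummable_finite: "finite A \<Longrightarrow> fsummable f A"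
  by (simp add: fsummable_def)

lemma fsum_finite: "finite A \<Longrightarrow> fsum f A = (sum f A :: 'a::complete_lambda_ring)"
  by (rule fsum_eqI') (auto simp: fsummable_finite intro!: exI[of _ A] filt_zero)

lemma fsummable_subset: "fsummable f A \<Longrightarrow> B \<subseteq> A \<Longrightarrow> fsummable f B"
  unfolding fsummable_def by (auto intro: rev_finite_subset)

lemma fsummable_mono_neutral:
  assumes "fsummable f A" "\<And>i. i \<in> B - A \<Longrightarrow> f i = 0"
  shows "fsummable f B"
  unfolding fsummable_def
proof
  fix k
  show "finite {i\<in>B. f i \<notin> filt k}"
    by (rule finite_subset[OF _ fsummableD[OF assms(1), of k]]) (use assms(2) filt_zero in fastforce)
qed

lemma fsum_mono_neutral:
  assumes "fsummable f A" "B \<subseteq> A" "\<And>i. i \<in> A - B \<Longrightarrow> f i = 0"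
  shows "fsum f A = (fsum f B :: 'a::complete_lambda_ring)"
proof (rule fsum_eqI'[OF assms(1)])
  fix k
  have sB: "fsummable f B" using assms(1,2) by (rule fsummable_subset)
  obtain C where C: "finite C" "C \<subseteq> B" "\<And>i. i \<in> B - C \<Longrightarrow> f i \<in> filt k"
    using fsummable_approx[OF sB] by metis
  have "f i \<in> filt k" if "i \<in> A - C" for i
    using that C assms(3) filt_zero by (cases "i \<in> B") fastforce+
  moreover have "sum f C - fsum f B \<in> filt k"
    by (rule filt_minus_commute, rule fsum_approx[OF sB]) (use C in auto)
  ultimately show "\<exists>C. finite C \<and> C \<subseteq> A \<and> (\<forall>i\<in>A - C. f i \<in> filt k) \<and> sum f C - fsum f B \<in> filt k"
    using C assms(2) by (intro exI[of _ C]) auto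
qed

lemma fsum_eq_sum:
  assumes "finite B" "B \<subseteq> A" "\<And>i. i \<in> A - B \<Longrightarrow> f i = 0"
  shows "fsum f A = (sum f B :: 'a::complete_lambda_ring)"
proof -
  have "fsummable f A" by (rule fsummable_mono_neutral[OF fsummable_finite[OF assms(1)] assms(3)])
  then show ?thesis using fsum_mono_neutral[of f A B] assms by (simp add: fsum_finite)
qed

lemma fsum_in_filt:
  assumes "fsummable f A" "\<And>i. i \<in> A \<Longrightarrow> f i \<in> filt k"
  shows "fsum f A \<in> (filt k :: 'a::complete_lambda_ring set)"
  using fsum_approx[OF assms(1), of "{}" k] assms(2) by simp

lemma fsummable_add:
  assumes "fsummable f A" "fsummable g A"
  shows "fsummable (\<lambda>i. f i + g i :: 'a::complete_lambda_ring) A"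
  unfolding fsummable_def
proof
  fix k
  show "finite {i\<in>A. f i + g i \<notin> filt k}"
    by (rule finite_subset[OF _ finite_UnI[OF assms[THEN fsummableD, of k]]]) (use filt_add in blast)
qed

lemma fsum_add:
  assumes "fsummable f A" "fsummable g A"
  shows "fsum (\<lambda>i. f i + g i) A = fsum f A + (fsum g A :: 'a::complete_lambda_ring)"
proof (rule fsum_eqI'[OF fsummable_add[OF assms]])
  fix k
  define B where "B = {i\<in>A. f i \<notin> filt k} \<union> {i\<in>A. g i \<notin> filt k}"
  have B: "finite B" "B \<subseteq> A" "\<And>i. i \<in> A - B \<Longrightarrow> f i \<in> filt k" "\<And>i. i \<in> A - B \<Longrightarrow> g i \<in> filt k"
    unfolding B_def using assms[THEN fsummableD, of k] by simp_all
  have *: "fsum f A - sum f B \<in> filt k" "fsum g A - sum g B \<in> filt k"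
    by (rule fsum_approx[OF _ B(1,2)]; use B assms in simp)+
  have "(sum f B - fsum f A) + (sum g B - fsum g A) \<in> filt k"
    by (rule filt_add[OF *[THEN filt_minus_commute]])
  then have "(\<Sum>i\<in>B. f i + g i) - (fsum f A + fsum g A) \<in> filt k"
    by (simp add: sum.distrib algebra_simps)
  then show "\<exists>B. finite B \<and> B \<subseteq> A \<and> (\<forall>i\<in>A - B. f i + g i \<in> filt k) \<and>
      (\<Sum>i\<in>B. f i + g i) - (fsum f A + fsum g A) \<in> filt k"
    using B by (intro exI[of _ B]) (auto intro: filt_add)
qed

lemma fsummable_map:
  assumes "continuous_additive h" "fsummable f A"
  shows "fsummable (\<lambda>i. h (f i)) A"
  unfolding fsummable_def
proof
  fix k
  obtain m where "\<And>x. x \<in> filt m \<Longrightarrow> h x \<in> filt k"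
    using assms(1) unfolding continuous_additive_def by blast
  then show "finite {i\<in>A. h (f i) \<notin> filt k}"
    by (intro finite_subset[OF _ fsummableD[OF assms(2), of m]]) blast
qed

lemma fsum_map:
  assumes "continuous_additive h" "fsummable f A"
  shows "h (fsum f A) = fsum (\<lambda>i. h (f i)) A"
proof (rule fsum_eqI'[OF fsummable_map[OF assms], symmetric])
  fix k
  obtain m where m: "\<And>x. x \<in> filt m \<Longrightarrow> h x \<in> filt k"
    using assms(1) unfolding continuous_additive_def by blast
  have add: "\<And>x y. h (x + y) = h x + h y" using assms(1) unfolding continuous_additive_def by blast
  obtain B where B: "finite B" "B \<subseteq> A" "\<And>i. i \<in> A - B \<Longrightarrow> f i \<in> filt m"
    using fsummable_approx[OF assms(2)] by metis
  have "h (fsum f A - sum f B) \<in> filt k"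
    by (intro m fsum_approx[OF assms(2)]) (use B in auto)
  then have "(\<Sum>i\<in>B. h (f i)) - h (fsum f A) \<in> filt k"
    using filt_minus_commute by (simp add: additive_diff[OF add] additive_sum[OF add])
  then show "\<exists>B. finite B \<and> B \<subseteq> A \<and> (\<forall>i\<in>A - B. h (f i) \<in> filt k) \<and>
      (\<Sum>i\<in>B. h (f i)) - h (fsum f A) \<in> filt k"
    using B m by (intro exI[of _ B]) auto
qed

lemma continuous_additive_mult_left: "continuous_additive (\<lambda>x::'a::complete_lambda_ring. y * x)"
  unfolding continuous_additive_def using filt_ideal' by (auto simp: distrib_left)

lemma continuous_additive_mult_right: "continuous_additive (\<lambda>x::'a::complete_lambda_ring. x * y)"
  unfolding continuous_additive_def using filt_ideal by (auto simp: distrib_right)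

lemma continuous_additive_adams: "n \<ge> 1 \<Longrightarrow> continuous_additive (adams n :: 'a::complete_lambda_ring \<Rightarrow> 'a)"
  unfolding continuous_additive_def using adams_continuous adams_add by blast

section \<open>Reindexing, iterated sums and products of sums\<close>

lemma fsummable_reindex:
  assumes "inj_on h A" "fsummable f (h ` A)"
  shows "fsummable (\<lambda>i. f (h i)) A"
  unfolding fsummable_def
proof
  fix k
  have "finite (h -` {i \<in> h ` A. f i \<notin> filt k} \<inter> A)"
    using finite_vimage_IntI[OF fsummableD[OF assms(2)] assms(1)] .
  then show "finite {i\<in>A. f (h i) \<notin> filt k}"
    by (rule rev_finite_subset) auto
qed

lemma fsum_reindex:
  assumes "inj_on h A" "fsummable (\<lambda>i. f (h i)) A"
  shows "fsummable f (h ` A)" "fsum f (h ` A) = (fsum (\<lambda>i. f (h i)) A :: 'a::complete_lambda_ring)"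
proof -
  show s: "fsummable f (h ` A)"
    unfolding fsummable_def
  proof
    fix k
    show "finite {i\<in>h ` A. f i \<notin> filt k}"
      by (rule finite_subset[OF _ finite_imageI[OF fsummableD[OF assms(2), of k], of h]]) auto
  qed
  show "fsum f (h ` A) = (fsum (\<lambda>i. f (h i)) A)"
  proof (rule fsum_eqI'[OF s])
    fix k
    obtain B where B: "finite B" "B \<subseteq> A" "\<And>i. i \<in> A - B \<Longrightarrow> f (h i) \<in> filt k"
      using fsummable_approx[OF assms(2)] by metis
    have "(\<Sum>i\<in>B. f (h i)) - fsum (\<lambda>i. f (h i)) A \<in> filt k"
      by (rule filt_minus_commute, rule fsum_approx[OF assms(2)]) (use B in auto)
    moreover have "(\<Sum>i\<in>B. f (h i)) = sum f (h ` B)"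
      using inj_on_subset[OF assms(1) B(2)] by (simp add: sum.reindex)
    ultimately show "\<exists>B. finite B \<and> B \<subseteq> h ` A \<and> (\<forall>i\<in>h ` A - B. f i \<in> filt k) \<and>
        sum f B - fsum (\<lambda>i. f (h i)) A \<in> filt k"
      using B by (intro exI[of _ "h ` B"]) auto
  qed
qed

lemma fsum_bij_betw:
  assumes "bij_betw h A B" "fsummable f B"
  shows "fsum f B = (fsum (\<lambda>i. f (h i)) A :: 'a::complete_lambda_ring)"
proof -
  have "inj_on h A" "B = h ` A" using assms(1) by (auto simp: bij_betw_def)
  then show ?thesis using fsum_reindex(2)[of h A f] fsummable_reindex[of h A f] assms(2) by simp
qed

lemma fsummable_Sigma_inner:
  assumes "fsummable f (Sigma A B)" "a \<in> A"
  shows "fsummable (\<lambda>b. f (a, b)) (B a)"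
proof (rule fsummable_reindex[of "Pair a" "B a" f])
  show "fsummable f (Pair a ` B a)"
    using assms(2) by (intro fsummable_subset[OF assms(1)]) auto
qed (simp add: inj_on_def)

lemma fsummable_Sigma_outer:
  assumes "fsummable f (Sigma A B)"
  shows "fsummable (\<lambda>a. fsum (\<lambda>b. f (a, b)) (B a)) A"
  unfolding fsummable_def
proof
  fix k
  have "fsum (\<lambda>b. f (a, b)) (B a) \<in> filt k"
    if "a \<in> A" "a \<notin> fst ` {x\<in>Sigma A B. f x \<notin> filt k}" for a
    using that by (intro fsum_in_filt[OF fsummable_Sigma_inner[OF assms]]) (auto simp: image_iff)
  then show "finite {a\<in>A. fsum (\<lambda>b. f (a, b)) (B a) \<notin> filt k}"
    by (intro finite_subset[OF _ finite_imageI[OF fsummableD[OF assms, of k], of fst]]) blast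
qed

text \<open>Modulo \<open>filt k\<close> both sides equal the sum over the finite set
  \<open>C\<close> of terms outside \<open>filt k\<close>: the fibres of \<open>C\<close> serve the
  inner sums, its projection serves the outer one.\<close>

lemma fsum_Sigma:
  assumes "fsummable f (Sigma A B)"
  shows "fsum f (Sigma A B) = (fsum (\<lambda>a. fsum (\<lambda>b. f (a, b)) (B a)) A :: 'a::complete_lambda_ring)"
proof (rule eq_if_filt)
  fix k
  define C where "C = {x\<in>Sigma A B. f x \<notin> filt k}"
  have C: "finite C" "C \<subseteq> Sigma A B" "\<And>i. i \<in> Sigma A B - C \<Longrightarrow> f i \<in> filt k"
    using assms by (auto simp: C_def fsummable_def)
  have *: "finite (fst ` C)" "fst ` C \<subseteq> A" using C by auto
  have fin: "finite {b. (a, b) \<in> C}" for a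
    by (rule finite_subset[OF _ finite_imageI[OF C(1), of snd]]) force
  have out: "fsum (\<lambda>a. fsum (\<lambda>b. f (a, b)) (B a)) A - (\<Sum>a\<in>fst ` C. fsum (\<lambda>b. f (a, b)) (B a)) \<in> filt k"
  proof (rule fsum_approx[OF fsummable_Sigma_outer[OF assms] *])
    fix a assume a: "a \<in> A - fst ` C"
    have "f (a, i) \<in> filt k" if "i \<in> B a" for i
      using a that by (intro C(3)) (force simp: image_iff)
    then show "fsum (\<lambda>b. f (a, b)) (B a) \<in> filt k"
      using a by (intro fsum_in_filt[OF fsummable_Sigma_inner[OF assms]]) simp_all
  qed
  have "(\<Sum>a\<in>fst ` C. fsum (\<lambda>b. f (a, b)) (B a)) - (\<Sum>a\<in>fst ` C. \<Sum>b\<in>{b. (a, b) \<in> C}. f (a, b)) \<in> filt k"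
    unfolding sum_subtractf[symmetric]
  proof (rule filt_sum)
    fix a assume a: "a \<in> fst ` C"
    show "fsum (\<lambda>b. f (a, b)) (B a) - (\<Sum>b\<in>{b. (a, b) \<in> C}. f (a, b)) \<in> filt k"
      using a C fin by (intro fsum_approx[OF fsummable_Sigma_inner[OF assms]]) auto
  qed
  moreover have "(\<Sum>a\<in>fst ` C. \<Sum>b\<in>{b. (a, b) \<in> C}. f (a, b)) = sum f C"
  proof -
    have "(\<Sum>a\<in>fst ` C. \<Sum>b\<in>{b. (a, b) \<in> C}. f (a, b)) = (\<Sum>(a,b)\<in>Sigma (fst ` C) (\<lambda>a. {b. (a, b) \<in> C}). f (a, b))"
      using C(1) fin by (subst sum.Sigma) auto
    also have "Sigma (fst ` C) (\<lambda>a. {b. (a, b) \<in> C}) = C" by force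
    finally show ?thesis by simp
  qed
  ultimately have "fsum (\<lambda>a. fsum (\<lambda>b. f (a, b)) (B a)) A - sum f C \<in> filt k"
    using filt_trans[OF out] by simp
  moreover have "fsum f (Sigma A B) - sum f C \<in> filt k" by (rule fsum_approx[OF assms]) (use C in auto)
  ultimately show "fsum f (Sigma A B) - fsum (\<lambda>a. fsum (\<lambda>b. f (a, b)) (B a)) A \<in> filt k"
    using filt_trans[OF _ filt_minus_commute] by simp
qed

lemma fsum_swap:
  assumes "fsummable (\<lambda>(a, b). f a b) (A \<times> B)"
  shows "fsum (\<lambda>a. fsum (f a) B) A = (fsum (\<lambda>b. fsum (\<lambda>a. f a b) A) B :: 'a::complete_lambda_ring)"
proof -
  have bij: "bij_betw prod.swap (B \<times> A) (A \<times> B)"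
    by (auto simp: bij_betw_def inj_on_def image_iff)
  have s: "fsummable (\<lambda>i. (\<lambda>(a, b). f a b) (prod.swap i)) (B \<times> A)"
    using assms bij by (intro fsummable_reindex[of prod.swap _ "\<lambda>(a, b). f a b"]) (simp_all add: bij_betw_def)
  have "fsum (\<lambda>a. fsum (f a) B) A = fsum (\<lambda>(a, b). f a b) (A \<times> B)"
    by (subst fsum_Sigma[OF assms]) simp
  also have "\<dots> = fsum (\<lambda>i. (\<lambda>(a, b). f a b) (prod.swap i)) (B \<times> A)"
    by (rule fsum_bij_betw[OF bij assms])
  also have "\<dots> = fsum (\<lambda>b. fsum (\<lambda>a. f a b) A) B"
    by (subst fsum_Sigma[OF s]) simp
  finally show ?thesis .
qed

lemma fsum_slice:
  fixes f :: "'x \<times> 'm \<Rightarrow> 'b::complete_lambda_ring"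
  assumes s: "fsummable f UNIV" and z: "\<And>x. snd x \<noteq> j \<Longrightarrow> f x = 0"
  shows "fsum f UNIV = fsum (\<lambda>M. f (M, j)) UNIV"
proof -
  have "fsum f UNIV = fsum f (range (\<lambda>M. (M, j)))"
    by (rule fsum_mono_neutral[OF s]) (auto intro!: z)
  also have "\<dots> = fsum (\<lambda>M. f (M, j)) UNIV"
    by (rule fsum_bij_betw[OF _ fsummable_subset[OF s]]) (auto simp: bij_betw_def inj_on_def)
  finally show ?thesis .
qed

text \<open>A product lies in the ideal \<open>filt k\<close> as soon as one factor does, so the
  exceptional pairs lie in a product of two finite sets.\<close>

lemma fsummable_mult:
  assumes "fsummable f A" "fsummable g B"
  shows "fsummable (\<lambda>(a, b). f a * g b :: 'a::complete_lambda_ring) (A \<times> B)"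
  unfolding fsummable_def
proof
  fix k
  show "finite {x \<in> A \<times> B. (case x of (a, b) \<Rightarrow> f a * g b) \<notin> filt k}"
    by (rule finite_subset[OF _ finite_cartesian_product[OF assms[THEN fsummableD, of k]]])
      (auto intro: filt_ideal filt_ideal')
qed

lemma fsum_mult:
  assumes "fsummable f A" "fsummable g B"
  shows "fsum f A * fsum g B = (fsum (\<lambda>(a, b). f a * g b) (A \<times> B) :: 'a::complete_lambda_ring)"
proof -
  have "fsum f A * fsum g B = fsum (\<lambda>a. f a * fsum g B) A"
    by (rule fsum_map[OF continuous_additive_mult_right assms(1)])
  also have "\<dots> = fsum (\<lambda>a. fsum (\<lambda>b. f a * g b) B) A"
    by (simp only: fsum_map[OF continuous_additive_mult_left assms(2)])
  also have "\<dots> = fsum (\<lambda>(a, b). f a * g b) (A \<times> B)"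
    by (simp add: fsum_Sigma[OF fsummable_mult[OF assms]])
  finally show ?thesis .
qed


section \<open>Series: coefficients, order, derivations\<close>

lemma coeff_smult [simp]: "coeff (smult c F) m = c * coeff F m"
  by (simp add: smult_def)

lemma coeff_map_coeff [simp]: "coeff (map_coeff h F) m = h (coeff F m)"
  by (simp add: map_coeff_def)

lemma smult_mult: "smult c F * G = smult c (F * (G::('m::graded_index, 'a::rat_algebra) series))"
  by (rule series_eqI) (simp add: coeff_mult sum_distrib_left case_prod_unfold mult.assoc)

lemma smult_smult: "smult c (smult d F) = smult (c * d :: 'a::rat_algebra) F"
  by (rule series_eqI) (simp add: mult.assoc)

lemma adams_smult:
  assumes "n \<ge> 1"
  shows "adams n (smult c F) = smult (adams n c) (adams n (F::('m::graded_index, 'a::complete_lambda_ring) series))"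
  by (rule adams_eqI) (use assms in \<open>auto simp: coeff_adams_dilate coeff_adams_notin adams_mult\<close>)

lemma continuous_additive_smult:
  "continuous_additive (smult c :: ('m::graded_index, 'a::complete_lambda_ring) series \<Rightarrow> _)"
  unfolding continuous_additive_def
proof (intro conjI allI)
  fix F G :: "('m, 'a) series" and k
  show "smult c (F + G) = smult c F + smult c G"
    by (rule series_eqI) (simp add: coeff_add distrib_left)
  show "\<exists>m. \<forall>F\<in>filt m. smult c F \<in> (filt k :: ('m, 'a) series set)"
    by (intro exI[of _ k]) (auto simp: filt_series_def intro: filt_ideal')
qed

lemma continuous_additive_coeff:
  "continuous_additive (\<lambda>F::('m::graded_index, 'a::complete_lambda_ring) series. coeff F x)"
  unfolding continuous_additive_def
proof (intro conjI allI)
  fix k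
  have "coeff F x \<in> filt k" if "F \<in> filt (k + deg x)" for F :: "('m, 'a) series"
  proof -
    have "coeff F x \<in> filt (k + deg x - deg x)" using that unfolding filt_series_def by blast
    then show ?thesis by simp
  qed
  then show "\<exists>m. \<forall>F\<in>filt m. coeff F x \<in> (filt k :: 'a set)"
    by (intro exI[of _ "k + deg x"]) simp
qed (simp add: coeff_add)

lemma coeff_fsum:
  fixes f :: "'i \<Rightarrow> ('m::graded_index, 'a::complete_lambda_ring) series"
  shows "fsummable f A \<Longrightarrow> coeff (fsum f A) x = fsum (\<lambda>i. coeff (f i) x) A"
  by (rule fsum_map[OF continuous_additive_coeff])

text \<open>Stronger than membership in \<open>filt n\<close>, which also admits low-degree
  coefficients deep in the filtration of the base ring. The point is \<open>order_ge_adams\<close>: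
  \<open>adams g\<close> multiplies the order by \<open>g\<close>, whereas continuity of
  \<open>adams g\<close> gives no rate for \<open>filt\<close>.\<close>

definition order_ge :: "nat \<Rightarrow> ('m::graded_index, 'a::zero) series \<Rightarrow> bool" where
  "order_ge n F \<longleftrightarrow> (\<forall>x. coeff F x \<noteq> 0 \<longrightarrow> n \<le> deg x)"

lemma order_geI: "(\<And>x. coeff F x \<noteq> 0 \<Longrightarrow> n \<le> deg x) \<Longrightarrow> order_ge n F"
  by (simp add: order_ge_def)

lemma order_geD: "order_ge n F \<Longrightarrow> coeff F x \<noteq> 0 \<Longrightarrow> n \<le> deg x"
  by (simp add: order_ge_def)

lemma order_ge_le: "order_ge n F \<Longrightarrow> m \<le> n \<Longrightarrow> order_ge m F"
  by (force simp: order_ge_def)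

lemma order_ge_filt:
  fixes F :: "('m::graded_index, 'a::complete_lambda_ring) series"
  assumes "order_ge n F" shows "F \<in> filt n"
  unfolding filt_series_def
proof clarify
  fix x
  show "coeff F x \<in> filt (n - deg x)"
    using order_geD[OF assms, of x] by (cases "coeff F x = 0") (simp_all add: filt_zero filt_0)
qed

lemma order_ge_smult: "order_ge n F \<Longrightarrow> order_ge n (smult c (F :: (_, 'a::rat_algebra) series))"
  by (rule order_geI, erule order_geD) auto

lemma order_ge_scaleQ: "order_ge n F \<Longrightarrow> order_ge n (q *\<^sub>Q (F :: (_, 'a::rat_algebra) series))"
  by (rule order_geI, erule order_geD) (auto simp: coeff_scaleQ scaleQ_zero_right)

lemma coeff_mult_nonzero:
  fixes F G :: "('m::graded_index, 'a::rat_algebra) series"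
  assumes "coeff (F * G) x \<noteq> 0"
  obtains a b where "a + b = x" "coeff F a \<noteq> 0" "coeff G b \<noteq> 0"
proof -
  obtain p where "p \<in> {(a, b). a + b = x}" "(case p of (a, b) \<Rightarrow> coeff F a * coeff G b) \<noteq> 0"
    using assms unfolding coeff_mult by (metis (mono_tags, lifting) sum.neutral)
  then show thesis using that[of "fst p" "snd p"]
    by (cases "coeff F (fst p) = 0"; cases "coeff G (snd p) = 0") (auto simp: case_prod_unfold)
qed

lemma coeff_adams_nonzero:
  fixes F :: "('m::graded_index, 'a::complete_lambda_ring) series"
  assumes "coeff (adams n F) x \<noteq> 0" "n \<ge> 1"
  obtains y where "x = dilate n y" "coeff F y \<noteq> 0"
proof (cases "x \<in> range (dilate n)")
  case True
  then obtain y where y: "x = dilate n y" by blast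
  then have "coeff F y \<noteq> 0" using assms by (auto simp: coeff_adams_dilate adams_zero)
  with y show thesis by (rule that)
qed (use assms in \<open>simp add: coeff_adams_notin\<close>)

lemma order_ge_mult:
  fixes F G :: "('m::graded_index, 'a::rat_algebra) series"
  assumes "order_ge m F" "order_ge n G"
  shows "order_ge (m + n) (F * G)"
proof (rule order_geI)
  fix x assume "coeff (F * G) x \<noteq> 0"
  then obtain a b where "a + b = x" "coeff F a \<noteq> 0" "coeff G b \<noteq> 0" by (rule coeff_mult_nonzero)
  then show "m + n \<le> deg x" using order_geD[OF assms(1)] order_geD[OF assms(2)]
    by (auto simp: deg_add intro!: add_mono)
qed

lemma order_ge_0 [simp]: "order_ge 0 F"
  by (simp add: order_ge_def)

lemma order_ge_power: "order_ge 1 F \<Longrightarrow> order_ge n ((F :: (_, 'a::rat_algebra) series) ^ n)"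
proof (induction n)
  case (Suc n)
  then show ?case using order_ge_mult[of 1 F n "F ^ n"] by simp
qed simp

lemma order_ge_adams:
  fixes F :: "('m::graded_index, 'a::complete_lambda_ring) series"
  assumes "order_ge n F" "g \<ge> 1"
  shows "order_ge (g * n) (adams g F)"
proof (rule order_geI)
  fix x assume "coeff (adams g F) x \<noteq> 0"
  then obtain y where "x = dilate g y" "coeff F y \<noteq> 0"
    using assms(2) by (rule coeff_adams_nonzero)
  then show "g * n \<le> deg x" using order_geD[OF assms(1)] by (simp add: deg_dilate)
qed

lemma order_ge_fsum:
  fixes f :: "'i \<Rightarrow> ('m::graded_index, 'a::complete_lambda_ring) series"
  assumes "fsummable f A" "\<And>i. i \<in> A \<Longrightarrow> order_ge n (f i)"
  shows "order_ge n (fsum f A)"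
proof (rule order_geI, rule ccontr)
  fix x assume x: "coeff (fsum f A) x \<noteq> 0" "\<not> n \<le> deg x"
  have "coeff (f i) x = 0" if "i \<in> A" for i using order_geD[OF assms(2)[OF that], of x] x(2) by blast
  then have "fsum (\<lambda>i. coeff (f i) x) A = sum (\<lambda>i. coeff (f i) x) {}"
    by (intro fsum_eq_sum) auto
  then show False using x(1) by (simp add: coeff_fsum[OF assms(1)])
qed

section \<open>Derivations: chain rule for \<open>fexp\<close>, partial derivatives, Euler
  operators\<close>

definition derivation ::
  "('a::complete_lambda_ring \<Rightarrow> 'a) \<Rightarrow> bool" where
  "derivation D \<longleftrightarrow> continuous_additive D \<and> (\<forall>F G. D (F * G) = D F * G + F * D G)"

lemma derivation_continuous: "derivation D \<Longrightarrow> continuous_additive D"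
  by (simp add: derivation_def)

lemma continuous_additive_add: "continuous_additive h \<Longrightarrow> h (x + y) = h x + h y"
  by (simp add: continuous_additive_def)

lemma continuous_additive_scaleQ_apply: "continuous_additive h \<Longrightarrow> h (c *\<^sub>Q x) = c *\<^sub>Q h x"
  by (intro additive_scaleQ continuous_additive_add)

lemma derivation_mult: "derivation D \<Longrightarrow> D (F * G) = D F * G + F * D G"
  by (simp add: derivation_def)

lemma derivation_one: "derivation D \<Longrightarrow> D 1 = 0"
  using derivation_mult[of D 1 1] by simp

lemma derivation_power:
  assumes "derivation D"
  shows "D (F ^ Suc n) = of_nat (Suc n) *\<^sub>Q (F ^ n * D F)"
proof (induction n)
  case (Suc n)
  have "D (F ^ Suc (Suc n)) = D F * F ^ Suc n + F * D (F ^ Suc n)"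
    using derivation_mult[OF assms, of F "F ^ Suc n"] by simp
  also have "\<dots> = 1 *\<^sub>Q (F ^ Suc n * D F) + of_nat (Suc n) *\<^sub>Q (F ^ Suc n * D F)"
    by (simp only: Suc.IH scaleQ_mult_right scaleQ_one) (simp add: ac_simps)
  also have "\<dots> = of_nat (Suc (Suc n)) *\<^sub>Q (F ^ Suc n * D F)"
    by (simp only: scaleQ_add_left[symmetric] of_nat_Suc)
  finally show ?case .
qed (simp add: scaleQ_one)

text \<open>Termwise differentiation, legitimate by continuity of \<open>D\<close>. Since
  \<open>D\<close> kills the term of index 0, the shift by \<open>Suc\<close> recovers the
  exponential series.\<close>

lemma derivation_fexp:
  assumes D: "derivation D" and W: "fsummable (\<lambda>n. (1 / fact n) *\<^sub>Q W ^ n) UNIV"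
  shows "D (fexp W) = fexp W * D W"
proof -
  note cD = derivation_continuous[OF D]
  define f where "f n = D ((1 / fact n) *\<^sub>Q W ^ n)" for n
  have f_Suc: "f (Suc n) = (1 / fact n) *\<^sub>Q W ^ n * D W" for n
  proof -
    have "f (Suc n) = (1 / fact (Suc n)) *\<^sub>Q of_nat (Suc n) *\<^sub>Q (W ^ n * D W)"
      by (simp only: f_def continuous_additive_scaleQ_apply[OF cD] derivation_power[OF D])
    also have "\<dots> = (1 / fact n) *\<^sub>Q (W ^ n * D W)"
      unfolding scaleQ_scaleQ by (rule arg_cong[of _ _ "\<lambda>c. c *\<^sub>Q (W ^ n * D W)"]) (simp add: fact_Suc del: of_nat_Suc)
    finally show ?thesis by (simp add: scaleQ_mult_left)
  qed
  have f_0: "f 0 = 0" by (simp add: f_def derivation_one[OF D] scaleQ_one)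
  have sf: "fsummable f UNIV" unfolding f_def by (rule fsummable_map[OF cD W])
  have "D (fexp W) = fsum f UNIV" unfolding fexp_def f_def by (rule fsum_map[OF cD W])
  also have "\<dots> = fsum f (range Suc)"
  proof (rule fsum_mono_neutral[OF sf])
    fix i :: nat assume "i \<in> UNIV - range Suc"
    then show "f i = 0" using f_0 by (cases i) auto
  qed simp
  also have "\<dots> = fsum (\<lambda>n. f (Suc n)) UNIV"
    by (rule fsum_bij_betw) (auto simp: bij_betw_def intro: fsummable_subset[OF sf])
  also have "\<dots> = fsum (\<lambda>n. (1 / fact n) *\<^sub>Q W ^ n * D W) UNIV" by (simp only: f_Suc)
  also have "\<dots> = fexp W * D W" unfolding fexp_def by (rule fsum_map[OF continuous_additive_mult_right W, symmetric])
  finally show ?thesis .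
qed

text \<open>The derivative by the variable with monomial \<open>v\<close>, where \<open>c x\<close>
  is the exponent of that variable in \<open>x\<close>. The abstract monomial index lets it serve
  for \<open>p_k[X]\<close> and \<open>p_k[Y]\<close> alike.\<close>

definition pderiv :: "('m::graded_index \<Rightarrow> nat) \<Rightarrow> 'm \<Rightarrow> ('m, 'a::rat_algebra) series \<Rightarrow> ('m, 'a) series" where
  "pderiv c v F = Series (\<lambda>x. of_nat (c x + 1) *\<^sub>Q coeff F (x + v))"

lemma coeff_pderiv: "coeff (pderiv c v F) x = of_nat (c x + 1) *\<^sub>Q coeff F (x + v)"
  by (simp add: pderiv_def)

text \<open>Differentiating one factor weights the splittings of \<open>x + v\<close> by the
  exponent in that factor; splittings whose first part lacks \<open>v\<close> have weight 0. The
  Leibniz rule then amounts to \<open>c a + c b = c x + 1\<close>.\<close>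

lemma coeff_mult_pderiv:
  fixes F G :: "('m::graded_index, 'a::rat_algebra) series"
  assumes c_v: "c v = 1" and c_add: "\<And>x y. c (x + y) = c x + c y"
    and c_pos: "\<And>x. c x \<noteq> 0 \<Longrightarrow> \<exists>y. x = y + v"
  shows "coeff (pderiv c v F * G) x = (\<Sum>(a, b) | a + b = x + v. of_nat (c a) *\<^sub>Q (coeff F a * coeff G b))"
proof -
  let ?h = "\<lambda>(a, b). (a + v, b)"
  let ?g = "\<lambda>(a, b). of_nat (c a) *\<^sub>Q (coeff F a * coeff G b)"
  have inj: "inj_on ?h {(a, b). a + b = x}" by (auto simp: inj_on_def)
  have "sum ?g {(a, b). a + b = x + v} = sum ?g (?h ` {(a, b). a + b = x})"
  proof (rule sum.mono_neutral_right)
    show "?h ` {(a, b). a + b = x} \<subseteq> {(a, b). a + b = x + v}" by (auto simp: ac_simps)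
    show "\<forall>i\<in>{(a, b). a + b = x + v} - ?h ` {(a, b). a + b = x}. ?g i = 0"
    proof clarify
      fix a b assume ab: "a + b = x + v" "(a, b) \<notin> ?h ` {(a, b). a + b = x}"
      show "of_nat (c a) *\<^sub>Q (coeff F a * coeff G b) = 0"
      proof (cases "c a = 0")
        case False
        then obtain y where y: "a = y + v" using c_pos by blast
        then have "y + b + v = x + v" using ab(1) by (simp add: ac_simps)
        then have "y + b = x" by (simp only: add_right_cancel)
        then have "(a, b) \<in> ?h ` {(a, b). a + b = x}" using y by force
        then show ?thesis using ab(2) by blast
      qed (simp add: scaleQ_zero_left)
    qed
  qed (rule finite_splits)
  also have "\<dots> = coeff (pderiv c v F * G) x"
    unfolding sum.reindex[OF inj] coeff_mult
    by (intro sum.cong refl) (auto simp: coeff_pderiv c_v c_add scaleQ_mult_left)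
  finally show ?thesis by simp
qed

lemma derivation_pderiv:
  fixes c :: "'m::graded_index \<Rightarrow> nat"
  assumes c_v: "c v = 1" and c_add: "\<And>x y. c (x + y) = c x + c y"
    and c_pos: "\<And>x. c x \<noteq> 0 \<Longrightarrow> \<exists>y. x = y + v"
  shows "derivation (pderiv c v :: ('m, 'a::complete_lambda_ring) series \<Rightarrow> _)"
  unfolding derivation_def continuous_additive_def
proof (intro conjI allI)
  fix F G :: "('m, 'a) series" and k
  show "pderiv c v (F + G) = pderiv c v F + pderiv c v G"
    by (rule series_eqI) (simp add: coeff_pderiv coeff_add scaleQ_add_right)
  show "\<exists>m. \<forall>F\<in>filt m. pderiv c v F \<in> (filt k :: ('m, 'a) series set)"
  proof (intro exI[of _ "k + deg v"] ballI)
    fix F :: "('m, 'a) series" assume F: "F \<in> filt (k + deg v)"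
    have "coeff F (x + v) \<in> filt (k - deg x)" for x
    proof -
      have "coeff F (x + v) \<in> filt (k + deg v - deg (x + v))" using F unfolding filt_series_def by blast
      then show ?thesis by (simp add: deg_add)
    qed
    then show "pderiv c v F \<in> filt k" by (simp add: filt_series_def coeff_pderiv filt_scaleQ)
  qed
  show "pderiv c v (F * G) = pderiv c v F * G + F * pderiv c v G"
  proof (rule series_eqI)
    fix x
    have "(\<Sum>(a, b) | a + b = x + v. of_nat (c b) *\<^sub>Q (coeff F a * coeff G b)) =
      (\<Sum>(a, b) | a + b = x + v. of_nat (c a) *\<^sub>Q (coeff G a * coeff F b))"
      by (rule sum.reindex_bij_witness[of _ prod.swap prod.swap]) (auto simp: ac_simps)
    also have "\<dots> = coeff (F * pderiv c v G) x"
      by (simp add: coeff_mult_pderiv[OF assms] mult.commute[of F])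
    finally have 1: "coeff (F * pderiv c v G) x =
      (\<Sum>(a, b) | a + b = x + v. of_nat (c b) *\<^sub>Q (coeff F a * coeff G b))" ..
    have "coeff (pderiv c v (F * G)) x =
      (\<Sum>(a, b) | a + b = x + v. of_nat (c x + 1) *\<^sub>Q (coeff F a * coeff G b))"
      by (simp add: coeff_pderiv coeff_mult scaleQ_sum_right case_prod_unfold)
    also have "\<dots> = (\<Sum>(a, b) | a + b = x + v. of_nat (c a) *\<^sub>Q (coeff F a * coeff G b)
        + of_nat (c b) *\<^sub>Q (coeff F a * coeff G b))"
    proof (intro sum.cong refl, clarify)
      fix a b assume "a + b = x + v"
      then have "c a + c b = c x + 1" using c_add[of a b] c_add[of x v] c_v by simp
      then have "(of_nat (c x + 1) :: rat) = of_nat (c a) + of_nat (c b)" by (metis of_nat_add)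
      then show "of_nat (c x + 1) *\<^sub>Q (coeff F a * coeff G b) =
        of_nat (c a) *\<^sub>Q (coeff F a * coeff G b) + of_nat (c b) *\<^sub>Q (coeff F a * coeff G b)"
        by (simp only: scaleQ_add_left)
    qed
    also have "\<dots> = coeff (pderiv c v F * G + F * pderiv c v G) x"
      by (simp add: coeff_add 1 coeff_mult_pderiv[OF assms] sum.distrib case_prod_unfold)
    finally show "coeff (pderiv c v (F * G)) x = coeff (pderiv c v F * G + F * pderiv c v G) x" .
  qed
qed

text \<open>Integer weights, because the grading \<open>\<omega>\<close> of the heat flow is
  negative on \<open>p_k[X]\<close>.\<close>

definition euler :: "('m::graded_index \<Rightarrow> int) \<Rightarrow> ('m, 'a::rat_algebra) series \<Rightarrow> ('m, 'a) series" where
  "euler r F = Series (\<lambda>x. of_int (r x) *\<^sub>Q coeff F x)"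

lemma coeff_euler: "coeff (euler r F) x = of_int (r x) *\<^sub>Q coeff F x"
  by (simp add: euler_def)

lemma derivation_euler:
  fixes r :: "'m::graded_index \<Rightarrow> int"
  assumes r_add: "\<And>x y. r (x + y) = r x + r y"
  shows "derivation (euler r :: ('m, 'a::complete_lambda_ring) series \<Rightarrow> _)"
  unfolding derivation_def continuous_additive_def
proof (intro conjI allI)
  fix F G :: "('m, 'a) series" and k
  show "euler r (F + G) = euler r F + euler r G"
    by (rule series_eqI) (simp add: coeff_euler coeff_add scaleQ_add_right)
  show "\<exists>m. \<forall>F\<in>filt m. euler r F \<in> (filt k :: ('m, 'a) series set)"
    by (intro exI[of _ k]) (simp add: filt_series_def coeff_euler filt_scaleQ)
  show "euler r (F * G) = euler r F * G + F * euler r G"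
  proof (rule series_eqI)
    fix x
    have "coeff (euler r (F * G)) x = (\<Sum>(a, b) | a + b = x. of_int (r x) *\<^sub>Q (coeff F a * coeff G b))"
      by (simp add: coeff_euler coeff_mult scaleQ_sum_right case_prod_unfold)
    also have "\<dots> = (\<Sum>(a, b) | a + b = x. coeff (euler r F) a * coeff G b + coeff F a * coeff (euler r G) b)"
      by (intro sum.cong refl)
        (auto simp: r_add coeff_euler scaleQ_add_left scaleQ_mult_left scaleQ_mult_right)
    also have "\<dots> = coeff (euler r F * G + F * euler r G) x"
      by (simp add: coeff_add coeff_mult sum.distrib case_prod_unfold)
    finally show "coeff (euler r (F * G)) x = coeff (euler r F * G + F * euler r G) x" .
  qed
qed

text \<open>The factor \<open>n\<close> cancels the \<open>1 / n\<close> in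
  \<open>adams_log\<close>, so that E applied to the sum of the \<open>p_n[V] / n\<close> is the sum
  of the \<open>p_n[E V]\<close>.\<close>

lemma adams_euler:
  fixes F :: "('m::graded_index, 'a::complete_lambda_ring) series"
  assumes "n \<ge> 1" "\<And>x. r (dilate n x) = int n * r x"
  shows "euler r (adams n F) = of_nat n *\<^sub>Q adams n (euler r F)"
proof (rule series_eqI)
  fix x
  show "coeff (euler r (adams n F)) x = coeff (of_nat n *\<^sub>Q adams n (euler r F)) x"
  proof (cases "x \<in> range (dilate n)")
    case True
    then obtain y where "x = dilate n y" by blast
    then show ?thesis using assms
      by (simp add: coeff_euler coeff_scaleQ coeff_adams_dilate adams_scaleQ scaleQ_scaleQ)
  qed (simp add: coeff_euler coeff_scaleQ coeff_adams_notin scaleQ_zero_right)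
qed


section \<open>Plethystic exponentials and homomorphisms of lambda-rings\<close>

definition adams_log :: "'a::complete_lambda_ring \<Rightarrow> 'a" where
  "adams_log G = fsum (\<lambda>k. (1 / of_nat k) *\<^sub>Q adams k G) {1..}"

text \<open>\<open>fsum\<close> is a definite description, unspecified unless the sum converges, so
  statements about \<open>Exp\<close> have to carry the summability of its two series.\<close>

definition Exp_converges :: "'a::complete_lambda_ring \<Rightarrow> bool" where
  "Exp_converges G \<longleftrightarrow> fsummable (\<lambda>k. (1 / of_nat k) *\<^sub>Q adams k G) {1..} \<and>
     fsummable (\<lambda>n. (1 / fact n) *\<^sub>Q adams_log G ^ n) UNIV"

lemma Exp_eq_fexp: "Exp G = fexp (adams_log G)"
  by (simp add: Exp_def adams_log_def)

text \<open>Relations between two rings that are compatible with all operations entering \<open>Exp\<close>. They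
  treat homomorphisms and passage to leading terms uniformly.\<close>

definition lambda_relation ::
  "('a::complete_lambda_ring \<Rightarrow> 'b::complete_lambda_ring \<Rightarrow> bool) \<Rightarrow> bool" where
  "lambda_relation R \<longleftrightarrow> R 1 1 \<and> (\<forall>x y x' y'. R x y \<longrightarrow> R x' y' \<longrightarrow> R (x * x') (y * y')) \<and>
     (\<forall>c x y. R x y \<longrightarrow> R (c *\<^sub>Q x) (c *\<^sub>Q y)) \<and> (\<forall>n\<ge>1. \<forall>x y. R x y \<longrightarrow> R (adams n x) (adams n y)) \<and>
     (\<forall>f g (A::nat set). (\<forall>i\<in>A. R (f i) (g i)) \<longrightarrow> fsummable f A \<longrightarrow> fsummable g A \<longrightarrow> R (fsum f A) (fsum g A))"

lemma lambda_relation_adams_log: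
  assumes R: "lambda_relation R" and "R x y" "Exp_converges x" "Exp_converges y"
  shows "R (adams_log x) (adams_log y)"
proof -
  have 1: "R (fsum f A) (fsum g A)"
    if "\<And>i. i \<in> A \<Longrightarrow> R (f i) (g i)" "fsummable f A" "fsummable g A" for f g and A :: "nat set"
    using R that unfolding lambda_relation_def by simp
  show ?thesis
    unfolding adams_log_def
    by (rule 1) (use R assms(2-) in \<open>auto simp: lambda_relation_def Exp_converges_def\<close>)
qed

lemma lambda_relation_Exp:
  assumes R: "lambda_relation R" and "R x y" "Exp_converges x" "Exp_converges y"
  shows "R (Exp x) (Exp y)"
proof -
  have 1: "R (fsum f A) (fsum g A)"
    if "\<And>i. i \<in> A \<Longrightarrow> R (f i) (g i)" "fsummable f A" "fsummable g A" for f g and A :: "nat set"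
    using R that unfolding lambda_relation_def by simp
  have pow: "R (adams_log x ^ n) (adams_log y ^ n)" for n
    using lambda_relation_adams_log[OF assms] R
    by (induction n) (auto simp: lambda_relation_def)
  show ?thesis
    unfolding Exp_eq_fexp fexp_def
    by (rule 1) (use R pow assms(3-) in \<open>auto simp: lambda_relation_def Exp_converges_def\<close>)
qed

definition lambda_hom :: "('a::complete_lambda_ring \<Rightarrow> 'b::complete_lambda_ring) \<Rightarrow> bool" where
  "lambda_hom h \<longleftrightarrow> continuous_additive h \<and> h 1 = 1 \<and> (\<forall>x y. h (x * y) = h x * h y) \<and>
     (\<forall>n\<ge>1. \<forall>x. h (adams n x) = adams n (h x))"

lemma lambda_hom_continuous: "lambda_hom h \<Longrightarrow> continuous_additive h"
  and lambda_hom_one: "lambda_hom h \<Longrightarrow> h 1 = 1"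
  and lambda_hom_mult: "lambda_hom h \<Longrightarrow> h (x * y) = h x * h y"
  and lambda_hom_adams: "lambda_hom h \<Longrightarrow> n \<ge> 1 \<Longrightarrow> h (adams n x) = adams n (h x)"
  by (simp_all add: lambda_hom_def)

lemma lambda_hom_scaleQ: "lambda_hom h \<Longrightarrow> h (c *\<^sub>Q x) = c *\<^sub>Q h x"
  by (rule continuous_additive_scaleQ_apply[OF lambda_hom_continuous])

lemma lambda_hom_power: "lambda_hom h \<Longrightarrow> h (x ^ n) = h x ^ n"
  by (induction n) (simp_all add: lambda_hom_one lambda_hom_mult)

lemma lambda_relation_hom:
  assumes "lambda_hom h"
  shows "lambda_relation (\<lambda>x y. y = h x)"
  unfolding lambda_relation_def
  using assms by (auto simp: lambda_hom_one lambda_hom_mult lambda_hom_scaleQ lambda_hom_adams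
      fsum_map[OF lambda_hom_continuous] intro!: fsum_cong)

text \<open>Convergence of both series for \<open>h x\<close> is inherited from \<open>x\<close>,
  their terms being images under a continuous map. This covers values in
  \<open>\<Lambda>\<^sub>S\<close>, where no order is available.\<close>

lemma Exp_hom:
  assumes h: "lambda_hom h" and x: "Exp_converges x"
  shows "Exp (h x) = h (Exp x)"
proof -
  note c = lambda_hom_continuous[OF h]
  have s: "fsummable (\<lambda>k. (1 / of_nat k) *\<^sub>Q adams k x) {1..}"
    "fsummable (\<lambda>n. (1 / fact n) *\<^sub>Q adams_log x ^ n) UNIV"
    using x by (auto simp: Exp_converges_def)
  have e: "(1 / of_nat k) *\<^sub>Q adams k (h x) = h ((1 / of_nat k) *\<^sub>Q adams k x)" if "k \<in> {1..}" for k
    using that by (simp add: lambda_hom_scaleQ[OF h] lambda_hom_adams[OF h])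
  have log: "adams_log (h x) = h (adams_log x)"
    unfolding adams_log_def fsum_map[OF c s(1)] by (rule fsum_cong) (rule e)
  have "fsummable (\<lambda>k. (1 / of_nat k) *\<^sub>Q adams k (h x)) {1..}"
    using fsummable_map[OF c s(1)] by (simp only: fsummable_cong[OF e])
  moreover have "fsummable (\<lambda>n. (1 / fact n) *\<^sub>Q adams_log (h x) ^ n) UNIV"
    using fsummable_map[OF c s(2)] by (simp add: log lambda_hom_scaleQ[OF h] lambda_hom_power[OF h])
  ultimately have "Exp_converges (h x)" by (simp add: Exp_converges_def)
  then show ?thesis using lambda_relation_Exp[OF lambda_relation_hom[OF h] refl x] by simp
qed

lemma fsummable_filt:
  fixes f :: "nat \<Rightarrow> 'a::complete_lambda_ring"
  assumes "\<And>n. n \<in> A \<Longrightarrow> f n \<in> filt n"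
  shows "fsummable f (A :: nat set)"
  unfolding fsummable_def
proof
  fix k
  have "n < k" if "n \<in> A" "f n \<notin> filt k" for n
  proof (rule ccontr)
    assume "\<not> n < k"
    then have "filt n \<subseteq> (filt k :: 'a set)" by (intro filt_antimono) simp
    from subsetD[OF this assms[OF that(1)]] that(2) show False by contradiction
  qed
  then have "{n\<in>A. f n \<notin> filt k} \<subseteq> {..<k}" by blast
  then show "finite {n\<in>A. f n \<notin> filt k}" by (rule finite_subset) simp
qed

lemma fsummable_adams_log:
  fixes V :: "('m::graded_index, 'a::complete_lambda_ring) series"
  assumes "order_ge 1 V"
  shows "fsummable (\<lambda>k. (1 / of_nat k) *\<^sub>Q adams k V) {1..}"
  using order_ge_adams[OF assms]
  by (intro fsummable_filt order_ge_filt order_ge_scaleQ) simp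

text \<open>With positive order, \<open>p_k[V]\<close> has order at least \<open>k\<close>, and the
  \<open>n\<close>-th power of \<open>adams_log V\<close> has order at least
  \<open>n\<close>.\<close>

lemma Exp_converges_series:
  fixes V :: "('m::graded_index, 'a::complete_lambda_ring) series"
  assumes "order_ge 1 V"
  shows "Exp_converges V"
proof -
  have "order_ge 1 (adams k V)" if "k \<in> {1..}" for k
    using order_ge_adams[OF assms, of k] that by (auto elim: order_ge_le)
  then have "order_ge 1 (adams_log V)"
    unfolding adams_log_def
    by (intro order_ge_fsum fsummable_adams_log[OF assms] order_ge_scaleQ)
  then have "fsummable (\<lambda>n. (1 / fact n) *\<^sub>Q adams_log V ^ n) UNIV"
    by (intro fsummable_filt order_ge_filt order_ge_scaleQ order_ge_power)
  then show ?thesis using fsummable_adams_log[OF assms] by (simp add: Exp_converges_def)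
qed


section \<open>Monomials in the power sums of infinitely many elements\<close>

text \<open>The variables of a polynomial ring on which \<open>p_n\<close> acts by
  \<open>act n\<close>. Multisets of them are the monomials, and positive weights with finite fibres
  leave finitely many monomials of each degree, as \<open>graded_index\<close> demands.\<close>

class weighted_set =
  fixes weight :: "'a \<Rightarrow> nat" and act :: "nat \<Rightarrow> 'a \<Rightarrow> 'a"
  assumes weight_pos: "weight x > 0"
    and finite_weight: "finite {x. weight x = d}"
    and weight_act: "n \<ge> 1 \<Longrightarrow> weight (act n x) = n * weight x"
    and act_1: "act 1 x = x"
    and act_act: "m \<ge> 1 \<Longrightarrow> n \<ge> 1 \<Longrightarrow> act m (act n x) = act (m * n) x"
    and inj_act: "n \<ge> 1 \<Longrightarrow> inj (act n)"

instantiation multiset :: (weighted_set) graded_index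
begin

definition "deg M = sum_mset (image_mset weight M)"
definition "dilate n M = (if n = 0 then {#} else image_mset (act n) M)"

lemma deg_multiset_add: "deg (M + N) = deg M + deg (N :: 'a multiset)"
  by (simp add: deg_multiset_def)

lemma weight_le_deg: "x \<in># M \<Longrightarrow> weight x \<le> deg (M :: 'a multiset)"
  unfolding deg_multiset_def by (rule set_mset_le_sum_mset) simp

lemma size_le_deg: "size M \<le> deg (M :: 'a multiset)"
proof -
  have "0 \<notin># image_mset weight M" using weight_pos by (auto simp: image_iff)
  then show ?thesis using size_le_sum_mset[of "image_mset weight M"] by (simp add: deg_multiset_def)
qed

instance
proof
  fix M N P :: "'a multiset" and d m n :: nat
  show "deg (M + N) = deg M + deg N" by (rule deg_multiset_add)
  show "deg (dilate n M) = n * deg M"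
  proof (cases "n = 0")
    case False
    then show ?thesis
      by (induction M) (simp_all add: dilate_multiset_def deg_multiset_def weight_act distrib_left)
  qed (simp add: dilate_multiset_def deg_multiset_def)
  have "act 1 = (\<lambda>x :: 'a. x)" by (rule ext) (rule act_1)
  then show "dilate 1 M = M" by (simp add: dilate_multiset_def)
  show "m \<ge> 1 \<Longrightarrow> n \<ge> 1 \<Longrightarrow> dilate m (dilate n M) = dilate (m * n) M"
    by (simp add: dilate_multiset_def multiset.map_comp o_def act_act)
  show "dilate n (M + N) = dilate n M + dilate n N" by (simp add: dilate_multiset_def)
  show "inj (dilate n :: 'a multiset \<Rightarrow> _)" if n: "n \<ge> 1"
    using multiset.inj_map[OF inj_act[OF n]] n by (simp add: dilate_multiset_def[abs_def])
  show "\<exists>M' N'. M = dilate n M' \<and> N = dilate n N'" if n: "n \<ge> 1" and eq: "M + N = dilate n P"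
  proof -
    have "image_mset (act n) P = M + N" using eq n by (simp add: dilate_multiset_def)
    then obtain M' N' where "P = M' + N'" "M = image_mset (act n) M'" "N = image_mset (act n) N'"
      by (rule image_mset_eq_plusD[THEN exE]) blast
    then show ?thesis using n by (auto simp: dilate_multiset_def)
  qed
  show "finite {M :: 'a multiset. deg M = d}"
  proof (rule finite_subset)
    show "{M :: 'a multiset. deg M = d} \<subseteq> mset ` {xs. set xs \<subseteq> {x. weight x \<le> d} \<and> length xs \<le> d}"
    proof
      fix M :: "'a multiset" assume M: "M \<in> {M. deg M = d}"
      obtain xs where xs: "M = mset xs" by (metis ex_mset)
      have "set xs \<subseteq> {x. weight x \<le> d}" using weight_le_deg[of _ M] M xs by auto
      moreover have "length xs \<le> d" using size_le_deg[of M] M xs by simp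
      ultimately show "M \<in> mset ` {xs. set xs \<subseteq> {x. weight x \<le> d} \<and> length xs \<le> d}" using xs by blast
    qed
    have "{x :: 'a. weight x \<le> d} = (\<Union>e\<le>d. {x. weight x = e})" by auto
    then have "finite {x :: 'a. weight x \<le> d}" by (simp add: finite_weight)
    then show "finite (mset ` {xs. set xs \<subseteq> {x :: 'a. weight x \<le> d} \<and> length xs \<le> d})"
      by (simp add: finite_lists_length_le)
  qed
qed

end

text \<open>\<open>Power_Var i j\<close> stands for \<open>p\<^sub>n\<close> applied to the \<open>i\<close>-th element, where \<open>n = j + 1\<close>.\<close>

datatype 'i power_var = Power_Var (index: 'i) (pred_power: nat)

definition exponent :: "'i power_var \<Rightarrow> nat" where
  "exponent v = Suc (pred_power v)"

instantiation power_var :: (graded_index) weighted_set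
begin

text \<open>\<open>Suc\<close> keeps the weight positive for an index of degree 0, such as that of
  the constant term of \<open>L\<close>, and so bounds the exponent by the weight.\<close>

definition "weight v = exponent v * Suc (deg (index v))"
definition "act n v = Power_Var (index v) (n * exponent v - 1)"

lemma index_act [simp]: "index (act n v) = index v"
  by (simp add: act_power_var_def)

lemma exponent_act [simp]: "n \<ge> 1 \<Longrightarrow> exponent (act n v) = n * exponent v"
  by (simp add: act_power_var_def exponent_def)

lemma power_var_eqI: "index v = index w \<Longrightarrow> exponent v = exponent w \<Longrightarrow> v = w"
  by (simp add: exponent_def power_var.expand)

instance
proof
  fix v w :: "'a power_var" and d m n :: nat
  show "weight v > 0" by (simp add: weight_power_var_def exponent_def)
  show "n \<ge> 1 \<Longrightarrow> weight (act n v) = n * weight v" by (simp add: weight_power_var_def distrib_left)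
  show "act 1 v = v" by (rule power_var_eqI) simp_all
  show "m \<ge> 1 \<Longrightarrow> n \<ge> 1 \<Longrightarrow> act m (act n v) = act (m * n) v" by (rule power_var_eqI) simp_all
  show "inj (act n :: 'a power_var \<Rightarrow> _)" if "n \<ge> 1"
  proof (rule injI)
    fix v w :: "'a power_var" assume "act n v = act n w"
    then have "index (act n v) = index (act n w)" "exponent (act n v) = exponent (act n w)" by simp_all
    then show "v = w" using that by (intro power_var_eqI) simp_all
  qed
  have "{v :: 'a power_var. weight v = d} \<subseteq> (\<lambda>(i, j). Power_Var i j) ` ({i. deg i \<le> d} \<times> {..d})"
  proof
    fix v :: "'a power_var" assume "v \<in> {v. weight v = d}"
    then have d: "d = Suc (pred_power v) * Suc (deg (index v))"
      by (simp add: weight_power_var_def exponent_def)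
    then have "deg (index v) \<le> d" "pred_power v \<le> d" by simp_all
    then show "v \<in> (\<lambda>(i, j). Power_Var i j) ` ({i. deg i \<le> d} \<times> {..d})"
      by (intro image_eqI[of _ _ "(index v, pred_power v)"]) simp_all
  qed
  then show "finite {v :: 'a power_var. weight v = d}"
    by (rule finite_subset) (simp add: finite_deg_le)
qed

end

lemma exponent_pos: "exponent v \<ge> 1"
  by (simp add: exponent_def)

definition power_monomial :: "('i \<Rightarrow> 'a::complete_lambda_ring) \<Rightarrow> 'i power_var multiset \<Rightarrow> 'a" where
  "power_monomial a M = (\<Prod>v\<in>#M. adams (exponent v) (a (index v)))"

lemma power_monomial_zero: "power_monomial a {#} = 1"
  by (simp add: power_monomial_def)

lemma power_monomial_add: "power_monomial a (M + N) = power_monomial a M * power_monomial a N"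
  by (simp add: power_monomial_def)

lemma adams_power_monomial:
  "n \<ge> 1 \<Longrightarrow> adams n (power_monomial a M) = power_monomial a (dilate n M)"
  by (induction M) (simp_all add: power_monomial_def dilate_multiset_def adams_one adams_mult adams_adams[OF _ exponent_pos])

lemma lambda_hom_power_monomial:
  "lambda_hom h \<Longrightarrow> h (power_monomial a M) = power_monomial (\<lambda>i. h (a i)) M"
  by (induction M) (simp_all add: power_monomial_def lambda_hom_one lambda_hom_mult lambda_hom_adams[OF _ exponent_pos])

text \<open>Here well-behavedness becomes convergence for arbitrary coefficients. Grouping the
  factors of a monomial by index gives one \<open>padams \<nu> (a i)\<close> for each index
  \<open>i\<close> that occurs. If the monomial avoids the ideal \<open>filt k\<close>, so does each
  group, which leaves finitely many indices and bounds each \<open>\<nu>\<close>.\<close>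

lemma finite_power_monomial_notin_filt:
  fixes a :: "'i::graded_index \<Rightarrow> 'a::complete_lambda_ring"
  assumes e: "bij e" and wb: "well_behaved (\<lambda>j. a (e j))"
  shows "finite {M. power_monomial a M \<notin> filt k}"
proof -
  obtain i0 where i0: "\<And>j \<nu>. \<nu> \<noteq> 0 \<Longrightarrow> j > i0 \<or> deg \<nu> > i0 \<Longrightarrow> padams \<nu> (a (e j)) \<in> filt k"
    using wb unfolding well_behaved_def by metis
  define I where "I = e ` {..i0}"
  define V where "V = (\<lambda>(i, j). Power_Var i j) ` (I \<times> {..i0})"
  \<comment> \<open>An upper bound for all exceptional monomials: every possible variable, with the
    multiplicity \<open>i0\<close> that bounds the number of parts of \<open>\<nu>\<close>.\<close>
  define B where "B = (\<Sum>v\<in>V. replicate_mset i0 v)"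
  have finV: "finite V" by (simp add: V_def I_def)
  have "deg M \<le> deg B" if M: "power_monomial a M \<notin> filt k" for M
  proof -
    have "M \<subseteq># B"
      unfolding subseteq_mset_def
    proof
      fix v
      show "count M v \<le> count B v"
      proof (cases "v \<in># M")
        case True
        define P where "P = filter_mset (\<lambda>w. index w = index v) M"
        define \<nu> where "\<nu> = Partition (image_mset exponent P)"
        have parts: "parts \<nu> = image_mset exponent P"
          unfolding \<nu>_def by (rule Partition_inverse) (auto simp: exponent_def)
        have "v \<in># P" using True by (simp add: P_def)
        then have pv: "exponent v \<in># parts \<nu>" by (simp add: parts)
        then have "\<nu> \<noteq> 0" by (auto simp: parts_zero)
        have "image_mset (\<lambda>w. adams (exponent w) (a (index w))) P = image_mset (\<lambda>w. adams (exponent w) (a (index v))) P"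
          by (rule image_mset_cong) (simp add: P_def)
        then have "padams \<nu> (a (index v)) = power_monomial a P"
          by (simp add: padams_def power_monomial_def parts multiset.map_comp o_def)
        moreover have "M = P + filter_mset (\<lambda>w. index w \<noteq> index v) M"
          unfolding P_def by (rule multiset_partition)
        ultimately have "power_monomial a M =
            padams \<nu> (a (index v)) * power_monomial a (filter_mset (\<lambda>w. index w \<noteq> index v) M)"
          using power_monomial_add by metis
        then have notin: "padams \<nu> (a (index v)) \<notin> filt k" using M filt_ideal by metis
        obtain j where j: "index v = e j" using e by (metis bij_pointE)
        have "\<not> (j > i0 \<or> deg \<nu> > i0)" using i0[OF \<open>\<nu> \<noteq> 0\<close>, of j] notin j by auto
        then have ji: "j \<le> i0" and dn: "deg \<nu> \<le> i0" by auto
        have "exponent v \<le> deg \<nu>" unfolding deg_partition_def by (rule set_mset_le_sum_mset[OF pv])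
        then have "pred_power v \<le> i0" using dn by (simp add: exponent_def)
        moreover have "index v \<in> I" using ji j by (simp add: I_def)
        ultimately have vV: "v \<in> V"
          unfolding V_def by (intro image_eqI[of _ _ "(index v, pred_power v)"]) simp_all
        have "count M v = count P v" by (simp add: P_def)
        also have "\<dots> \<le> size P" by (rule count_le_size)
        also have "\<dots> = size (parts \<nu>)" by (simp add: parts)
        also have "\<dots> \<le> deg \<nu>" unfolding deg_partition_def by (rule size_le_sum_mset[OF parts_pos])
        also have "\<dots> \<le> i0" by (rule dn)
        also have "\<dots> = count B v"
          using finV vV by (simp add: B_def count_sum)
        finally show ?thesis .
      qed (simp add: not_in_iff)
    qed
    then have "B = M + (B - M)" by simp
    then have "deg B = deg M + deg (B - M)" using deg_add by metis
    then show ?thesis by simp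
  qed
  then have "{M. power_monomial a M \<notin> filt k} \<subseteq> {M. deg M \<le> deg B}" by blast
  then show ?thesis by (rule finite_subset) (rule finite_deg_le)
qed


section \<open>Evaluation of series\<close>

text \<open>Substitution of \<open>e x\<close> for the monomial \<open>x\<close>, with
  \<open>\<phi>\<close> on coefficients. By \<open>e_filt\<close> it is defined on all series,
  however their coefficients behave.\<close>

locale evaluation =
  fixes \<phi> :: "'b::complete_lambda_ring \<Rightarrow> 'c::complete_lambda_ring"
    and e :: "'x::graded_index \<Rightarrow> 'c"
  assumes hom: "lambda_hom \<phi>"
    and e_zero: "e 0 = 1"
    and e_add: "e (x + y) = e x * e y"
    and e_adams: "n \<ge> 1 \<Longrightarrow> adams n (e x) = e (dilate n x)"
    and e_filt: "finite {x. e x \<notin> filt k}"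
begin

definition ev :: "('x, 'b) series \<Rightarrow> 'c" where
  "ev F = fsum (\<lambda>x. \<phi> (coeff F x) * e x) UNIV"

lemma fsummable_ev: "fsummable (\<lambda>x. c x * e x) A"
  unfolding fsummable_def
proof
  fix k
  have "{x \<in> A. c x * e x \<notin> filt k} \<subseteq> {x. e x \<notin> filt k}" using filt_ideal'[of _ k] by blast
  then show "finite {x \<in> A. c x * e x \<notin> filt k}" by (rule finite_subset) (rule e_filt)
qed

lemma phi_zero: "\<phi> 0 = 0"
  by (rule additive_zero[OF continuous_additive_add[OF lambda_hom_continuous[OF hom]]])

lemma phi_sum: "\<phi> (sum f A) = (\<Sum>i\<in>A. \<phi> (f i))"
  by (rule additive_sum[OF continuous_additive_add[OF lambda_hom_continuous[OF hom]]])

lemma ev_add: "ev (F + G) = ev F + ev G"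
proof -
  have "ev (F + G) = fsum (\<lambda>x. \<phi> (coeff F x) * e x + \<phi> (coeff G x) * e x) UNIV"
    by (simp add: ev_def coeff_add continuous_additive_add[OF lambda_hom_continuous[OF hom]] distrib_right)
  then show ?thesis by (simp add: fsum_add fsummable_ev ev_def)
qed

lemma ev_one: "ev 1 = 1"
proof -
  have "ev 1 = (\<Sum>x\<in>{0}. \<phi> (coeff 1 x) * e x)"
    unfolding ev_def by (rule fsum_eq_sum) (auto simp: coeff_one phi_zero)
  then show ?thesis by (simp add: coeff_one lambda_hom_one[OF hom] e_zero)
qed

lemma ev_mult: "ev (F * G) = ev F * ev G"
proof -
  define t where "t = (\<lambda>(a, b). (\<phi> (coeff F a) * e a) * (\<phi> (coeff G b) * e b))"
  let ?S = "Sigma UNIV (\<lambda>z :: 'x. {(a, b). a + b = z})"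
  have bij: "bij_betw snd ?S (UNIV \<times> UNIV)"
    by (auto simp: bij_betw_def inj_on_def image_iff)
  have st: "fsummable t (UNIV \<times> UNIV)"
    unfolding t_def by (rule fsummable_mult[OF fsummable_ev fsummable_ev])
  have st': "fsummable (\<lambda>i. t (snd i)) ?S"
    by (rule fsummable_reindex[of snd ?S t]) (use bij st in \<open>simp_all add: bij_betw_def\<close>)
  have "ev (F * G) = fsum (\<lambda>z. fsum t {(a, b). a + b = z}) UNIV"
    unfolding ev_def
  proof (rule fsum_cong)
    fix z
    have "\<phi> (coeff (F * G) z) * e z = (\<Sum>(a, b) | a + b = z. (\<phi> (coeff F a) * \<phi> (coeff G b)) * e z)"
      by (simp add: coeff_mult phi_sum sum_distrib_right case_prod_unfold lambda_hom_mult[OF hom])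
    also have "\<dots> = sum t {(a, b). a + b = z}"
      by (intro sum.cong refl) (auto simp: t_def e_add ac_simps)
    finally show "\<phi> (coeff (F * G) z) * e z = fsum t {(a, b). a + b = z}"
      by (simp add: fsum_finite finite_splits)
  qed
  also have "\<dots> = fsum (\<lambda>i. t (snd i)) ?S" by (simp add: fsum_Sigma[OF st'])
  also have "\<dots> = fsum t (UNIV \<times> UNIV)" by (rule fsum_bij_betw[OF bij st, symmetric])
  also have "\<dots> = ev F * ev G" unfolding t_def ev_def by (rule fsum_mult[OF fsummable_ev fsummable_ev, symmetric])
  finally show ?thesis .
qed

lemma ev_adams:
  assumes n: "n \<ge> 1"
  shows "ev (adams n F) = adams n (ev F)"
proof -
  define f where "f x = \<phi> (coeff (adams n F) x) * e x" for x
  have inj: "inj (dilate n :: 'x \<Rightarrow> 'x)" by (rule inj_dilate[OF n])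
  have sf: "fsummable f A" for A unfolding f_def by (rule fsummable_ev)
  have "ev (adams n F) = fsum f UNIV" by (simp add: ev_def f_def[abs_def])
  also have "\<dots> = fsum f (range (dilate n))"
    by (rule fsum_mono_neutral[OF sf]) (simp_all add: f_def coeff_adams_notin phi_zero)
  also have "\<dots> = fsum (\<lambda>x. f (dilate n x)) UNIV"
    by (rule fsum_bij_betw[OF _ sf]) (simp add: bij_betw_def inj)
  also have "\<dots> = fsum (\<lambda>x. adams n (\<phi> (coeff F x) * e x)) UNIV"
    by (rule fsum_cong) (simp add: f_def coeff_adams_dilate[OF n] lambda_hom_adams[OF hom n] adams_mult[OF n] e_adams[OF n])
  also have "\<dots> = adams n (ev F)"
    unfolding ev_def by (rule fsum_map[OF continuous_additive_adams[OF n] fsummable_ev, symmetric])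
  finally show ?thesis .
qed

text \<open>Outside finitely many monomials \<open>e x\<close> already lies in
  \<open>filt k\<close>. For the remaining ones the degree is at most \<open>N\<close>, and
  membership in \<open>filt (m + N)\<close> forces the coefficient into
  \<open>filt m\<close>.\<close>

lemma ev_continuous: "\<exists>m. \<forall>F\<in>filt m. ev F \<in> filt k"
proof -
  obtain m where m: "\<And>x. x \<in> filt m \<Longrightarrow> \<phi> x \<in> filt k"
    using lambda_hom_continuous[OF hom] unfolding continuous_additive_def by blast
  define N where "N = Max (insert 0 (deg ` {x. e x \<notin> filt k}))"
  have N: "deg x \<le> N" if "e x \<notin> filt k" for x
    unfolding N_def using that e_filt[of k] by (intro Max_ge) auto
  have "ev F \<in> filt k" if F: "F \<in> filt (m + N)" for F
    unfolding ev_def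
  proof (rule fsum_in_filt[OF fsummable_ev])
    fix x
    show "\<phi> (coeff F x) * e x \<in> filt k"
    proof (cases "e x \<in> filt k")
      case False
      have "coeff F x \<in> filt (m + N - deg x)" using F unfolding filt_series_def by blast
      moreover have "filt (m + N - deg x) \<subseteq> (filt m :: 'b set)"
        by (rule filt_antimono) (use N[OF False] in simp)
      ultimately have "coeff F x \<in> filt m" by blast
      from filt_ideal[OF m[OF this]] show ?thesis .
    qed (rule filt_ideal')
  qed
  then show ?thesis by blast
qed

lemma ev_hom: "lambda_hom ev"
  unfolding lambda_hom_def continuous_additive_def
  by (simp add: ev_add ev_one ev_mult ev_adams ev_continuous)

lemma ev_order_ge: "\<exists>N. \<forall>F. order_ge (Suc N) F \<longrightarrow> ev F \<in> filt k"
proof -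
  define N where "N = Max (insert 0 (deg ` {x. e x \<notin> filt k}))"
  have N: "deg x \<le> N" if "e x \<notin> filt k" for x
    unfolding N_def using that e_filt[of k] by (intro Max_ge) auto
  have "ev F \<in> filt k" if F: "order_ge (Suc N) F" for F
    unfolding ev_def
  proof (rule fsum_in_filt[OF fsummable_ev])
    fix x
    show "\<phi> (coeff F x) * e x \<in> filt k"
    proof (cases "e x \<in> filt k")
      case False
      then have "coeff F x = 0" using order_geD[OF F, of x] N[OF False] by fastforce
      then show ?thesis by (simp add: phi_zero filt_zero)
    qed (rule filt_ideal')
  qed
  then show ?thesis by blast
qed

text \<open>\<open>padams \<nu>\<close> of the value is the value of a series of order at least the
  degree of \<open>\<nu>\<close>, and values of series of high order are small. This provides the
  well-behaved \<open>L\<close> that \<open>admissible_elem\<close> asks for.\<close>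

lemma well_behaved_ev:
  assumes F: "order_ge 1 F"
  shows "well_behaved_elem (ev F)"
  unfolding well_behaved_elem_def well_behaved_def
proof
  fix k
  have hom_padams: "(\<Prod>n\<in>#M. adams n (ev F)) = ev (\<Prod>n\<in>#M. adams n F)" if "0 \<notin># M" for M
    using that by (induction M) (simp_all add: ev_one ev_mult ev_adams)
  have ord: "order_ge (sum_mset M) (\<Prod>n\<in>#M. adams n F)" if "0 \<notin># M" for M
    using that
  proof (induction M)
    case (add n M)
    then have "order_ge n (adams n F)" using order_ge_adams[OF F, of n] by simp
    then show ?case using add by (simp add: order_ge_mult)
  qed simp
  obtain N where N: "\<And>G. order_ge (Suc N) G \<Longrightarrow> ev G \<in> filt k" using ev_order_ge by blast
  have "padams \<nu> (if i = 0 then ev F else 0) \<in> filt k" if "\<nu> \<noteq> 0" "i > N \<or> deg \<nu> > N" for i \<nu>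
  proof (cases "i = 0")
    case True
    then have "order_ge (Suc N) (\<Prod>n\<in>#parts \<nu>. adams n F)"
      using that(2) order_ge_le[OF ord[OF parts_pos[of \<nu>]], of "Suc N"] by (simp add: deg_partition_def)
    then show ?thesis using True N by (simp add: padams_def hom_padams[OF parts_pos])
  next
    case False
    have "parts \<nu> \<noteq> {#}" using that(1) by (metis parts_inject parts_zero)
    then obtain n where n: "n \<in># parts \<nu>" by blast
    then have "n \<ge> 1" using parts_pos[of \<nu>] by (cases n) auto
    then have "padams \<nu> 0 = (0 :: 'c)"
      using n unfolding padams_def by (auto dest!: multi_member_split simp: adams_zero)
    then show ?thesis using False by (simp add: filt_zero)
  qed
  then show "\<exists>i0. \<forall>i \<nu>. \<nu> \<noteq> 0 \<and> (i0 < i \<or> i0 < deg \<nu>) \<longrightarrow>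
      padams \<nu> (if i = 0 then ev F else 0) \<in> filt k" by blast
qed

end

section \<open>Three evaluations: of the indeterminates alone, with the other variables kept, and
  with the other variables set to zero\<close>

lemma lambda_hom_id: "lambda_hom (\<lambda>x. x)"
  by (auto simp: lambda_hom_def continuous_additive_def)

lemma evaluation_power_monomial:
  fixes a :: "'i::graded_index \<Rightarrow> 'a::complete_lambda_ring"
  assumes "\<And>k. finite {M. power_monomial a M \<notin> filt k}"
  shows "evaluation (\<lambda>x. x) (power_monomial a)"
  by standard (simp_all add: lambda_hom_id power_monomial_zero power_monomial_add adams_power_monomial assms)

lemma basis_add: "basis i * basis j = (basis (i + j) :: ('m::graded_index, 'a::rat_algebra) series)"
proof (rule series_eqI)
  fix m
  have "coeff (basis i * basis j :: ('m, 'a) series) m =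
      (\<Sum>p\<in>{(a, b). a + b = m}. if p = (i, j) then 1 else 0)"
    unfolding coeff_mult by (intro sum.cong refl) (auto simp: basis_def split: if_splits)
  also have "\<dots> = coeff (basis (i + j)) m"
    by (auto simp: finite_splits basis_def)
  finally show "coeff (basis i * basis j :: ('m, 'a) series) m = coeff (basis (i + j)) m" .
qed

lemma adams_basis:
  assumes "n \<ge> 1"
  shows "adams n (basis i) = (basis (dilate n i) :: ('m::graded_index, 'a::complete_lambda_ring) series)"
proof (rule adams_eqI[OF assms])
  fix m :: 'm
  have "inj (dilate n :: 'm \<Rightarrow> 'm)" by (rule inj_dilate[OF assms])
  then have "dilate n m = dilate n i \<longleftrightarrow> m = i" by (rule inj_eq)
  then show "coeff (basis (dilate n i)) (dilate n m) = adams n (coeff (basis i) m :: 'a)"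
    using assms by (simp add: basis_def adams_one adams_zero)
qed (auto simp: basis_def)

lemma basis_zero: "basis 0 = 1"
  by (simp add: basis_def one_series_def)

lemma smult_basis_mult:
  "smult c (basis i) * smult d (basis j) = smult (c * d) (basis (i + j) :: ('m::graded_index, 'a::rat_algebra) series)"
proof -
  have "smult c (basis i) * smult d (basis j) = smult c (smult d (basis j) * (basis i :: ('m, 'a) series))"
    by (simp add: smult_mult mult.commute)
  then show ?thesis by (simp add: smult_mult smult_smult basis_add add.commute)
qed

text \<open>Partial evaluation: variables of the first kind receive values, those of the second kind
  are kept, so the target is again a ring of series.\<close>

lemma evaluation_basis:
  fixes e :: "'x::graded_index \<Rightarrow> 'b::complete_lambda_ring"
  assumes "evaluation (\<lambda>x. x) e"
  shows "evaluation (\<lambda>c. smult c 1) (\<lambda>(x, i). smult (e x) (basis i :: ('m::graded_index, 'b) series))"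
proof -
  interpret evaluation "\<lambda>x. x" e by fact
  show ?thesis
  proof
    show "lambda_hom (\<lambda>c. smult c (1 :: ('m, 'b) series))"
      unfolding lambda_hom_def continuous_additive_def
    proof (intro conjI allI impI)
      fix c d :: 'b and k n :: nat
      show "smult (c + d) 1 = smult c 1 + smult d (1 :: ('m, 'b) series)"
        by (rule series_eqI) (simp add: coeff_add distrib_right)
      show "smult 1 1 = (1 :: ('m, 'b) series)" by (rule series_eqI) simp
      show "smult (c * d) 1 = smult c 1 * smult d (1 :: ('m, 'b) series)"
        by (simp add: smult_mult smult_smult)
      show "smult (adams n c) 1 = adams n (smult c (1 :: ('m, 'b) series))" if "1 \<le> n"
        using that by (simp add: adams_smult adams_one)
      have "smult c (1 :: ('m, 'b) series) \<in> filt k" if "c \<in> filt k" for c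
        unfolding filt_series_def
      proof clarify
        fix x :: 'm
        have "filt k \<subseteq> (filt (k - deg x) :: 'b set)" by (rule filt_antimono) simp
        then show "coeff (smult c 1) x \<in> filt (k - deg x)" using that by (auto intro!: filt_ideal)
      qed
      then show "\<exists>m. \<forall>c\<in>filt m. smult c (1 :: ('m, 'b) series) \<in> filt k" by blast
    qed
    fix x y :: "'x \<times> 'm" and n k :: nat
    show "(case 0 of (x, i) \<Rightarrow> smult (e x) (basis i :: ('m, 'b) series)) = 1"
      by (rule series_eqI) (simp add: zero_prod_def e_zero basis_zero)
    show "(case x + y of (x, i) \<Rightarrow> smult (e x) (basis i :: ('m, 'b) series)) =
        (case x of (x, i) \<Rightarrow> smult (e x) (basis i)) * (case y of (x, i) \<Rightarrow> smult (e x) (basis i))"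
      by (simp add: case_prod_unfold e_add smult_basis_mult)
    show "adams n (case x of (x, i) \<Rightarrow> smult (e x) (basis i :: ('m, 'b) series)) =
        (case dilate n x of (x, i) \<Rightarrow> smult (e x) (basis i))" if "n \<ge> 1"
      using that by (simp add: case_prod_unfold dilate_prod_def adams_smult adams_basis e_adams)
    have in_filt: "smult c (basis i :: ('m, 'b) series) \<in> filt k" if "c \<in> filt k \<or> k \<le> deg i" for c i
      unfolding filt_series_def
    proof clarify
      fix j :: 'm
      have "filt k \<subseteq> (filt (k - deg j) :: 'b set)" by (rule filt_antimono) simp
      then show "coeff (smult c (basis i)) j \<in> filt (k - deg j)"
        using that by (auto simp: basis_def filt_zero filt_0)
    qed
    have "{x. (case x of (x, i) \<Rightarrow> smult (e x) (basis i :: ('m, 'b) series)) \<notin> filt k} \<subseteq>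
        {x. e x \<notin> filt k} \<times> {i. deg i \<le> k}"
    proof
      fix p :: "'x \<times> 'm"
      assume p: "p \<in> {x. (case x of (x, i) \<Rightarrow> smult (e x) (basis i :: ('m, 'b) series)) \<notin> filt k}"
      obtain x i where xi: "p = (x, i)" by (cases p)
      have "\<not> (e x \<in> filt k \<or> k \<le> deg i)" using in_filt[of "e x" i] p xi by auto
      then show "p \<in> {x. e x \<notin> filt k} \<times> {i. deg i \<le> k}" using xi by simp
    qed
    then show "finite {x. (case x of (x, i) \<Rightarrow> smult (e x) (basis i :: ('m, 'b) series)) \<notin> filt k}"
      by (rule finite_subset) (simp add: e_filt finite_deg_le)
  qed
qed

text \<open>Values for the first variables, zero for the second. The hypothesis \<open>zero\<close>
  says that a product of monomials is 1 only if its factors are, which makes the substitution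
  multiplicative.\<close>

lemma evaluation_constant_term:
  fixes e :: "'x::graded_index \<Rightarrow> 'b::complete_lambda_ring"
  assumes "evaluation (\<lambda>x. x) e"
    and zero: "\<And>i j :: 'm::graded_index. i + j = 0 \<Longrightarrow> i = 0"
  shows "evaluation (\<lambda>x. x) (\<lambda>(x, i :: 'm). if i = 0 then e x else 0)"
proof -
  interpret evaluation "\<lambda>x. x" e by fact
  have zero2: "i + j = 0 \<longleftrightarrow> i = 0 \<and> j = 0" for i j :: 'm
    using zero[of i j] zero[of j i] by (auto simp: add.commute)
  show ?thesis
  proof
    fix x y :: "'x \<times> 'm" and n k :: nat
    show "(case 0 of (x, i :: 'm) \<Rightarrow> if i = 0 then e x else 0) = 1"
      by (simp add: zero_prod_def e_zero)
    show "(case x + y of (x, i :: 'm) \<Rightarrow> if i = 0 then e x else 0) =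
        (case x of (x, i) \<Rightarrow> if i = 0 then e x else 0) * (case y of (x, i) \<Rightarrow> if i = 0 then e x else 0)"
      by (auto simp: case_prod_unfold e_add zero2)
    show "adams n (case x of (x, i :: 'm) \<Rightarrow> if i = 0 then e x else 0) =
        (case dilate n x of (x, i) \<Rightarrow> if i = 0 then e x else 0)" if n: "n \<ge> 1"
    proof -
      have "dilate n i = 0 \<longleftrightarrow> i = 0" for i :: 'm
        using inj_dilate[OF n] dilate_zero[of n] by (metis injD)
      then show ?thesis using n by (simp add: case_prod_unfold dilate_prod_def e_adams adams_zero)
    qed
    have "{x. (case x of (x, i :: 'm) \<Rightarrow> if i = 0 then e x else 0) \<notin> filt k} \<subseteq> {x. e x \<notin> filt k} \<times> {0}"
      by (auto simp: filt_zero split: if_splits)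
    then show "finite {x. (case x of (x, i :: 'm) \<Rightarrow> if i = 0 then e x else 0) \<notin> filt k}"
      by (rule finite_subset) (simp add: e_filt)
  qed (rule lambda_hom_id)
qed


section \<open>The heat flow of the trace\<close>

definition factorizations :: "nat \<Rightarrow> (nat \<times> nat) set" where
  "factorizations j = {(n, k). n * k = j}"

lemma finite_factorizations: "j \<ge> 1 \<Longrightarrow> finite (factorizations j)"
  by (rule finite_subset[of _ "{..j} \<times> {..j}"]) (auto simp: factorizations_def)

lemma factorizations_pos: "(n, k) \<in> factorizations j \<Longrightarrow> j \<ge> 1 \<Longrightarrow> n \<ge> 1 \<and> k \<ge> 1"
  by (auto simp: factorizations_def Suc_le_eq)

lemma sum_totient_factorizations:
  assumes "n \<ge> 1"
  shows "(\<Sum>(d, g)\<in>factorizations n. totient g) = n"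
proof -
  have "(\<Sum>(d, g)\<in>factorizations n. totient g) = (\<Sum>g | g dvd n. totient g)"
    by (rule sum.reindex_bij_witness[of _ "\<lambda>g. (n div g, g)" snd])
      (use assms in \<open>auto simp: factorizations_def\<close>)
  then show ?thesis by (simp add: totient_divisor_sum)
qed

text \<open>Collect the terms by the product of \<open>d\<close> and \<open>g\<close>, called
  \<open>n\<close> on the right: \<open>k\<close> is then fixed, and the totients of the divisors of
  \<open>n\<close> add up to \<open>n\<close>. The weight becomes \<open>n * k\<^sup>2\<close>,
  which is \<open>j\<^sup>2 / n\<close>.\<close>

lemma sum_adams_totient:
  fixes A :: "nat \<Rightarrow> 'a::complete_lambda_ring"
  assumes j: "j \<ge> 1"
  shows "(\<Sum>(d, n)\<in>factorizations j. adams d (\<Sum>(g, k)\<in>factorizations n. of_nat (totient g * k\<^sup>2) *\<^sub>Q adams g (A k))) =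
    (\<Sum>(n, k)\<in>factorizations j. (of_nat (j\<^sup>2) / of_nat n) *\<^sub>Q adams n (A k))"
proof -
  let ?f = "\<lambda>((d, n), (g, k)). of_nat (totient g * k\<^sup>2) *\<^sub>Q adams (d * g) (A k)"
  let ?h = "\<lambda>((n, k), (d, g)). of_nat (totient g * k\<^sup>2) *\<^sub>Q adams n (A k)"
  have "(\<Sum>(d, n)\<in>factorizations j. adams d (\<Sum>(g, k)\<in>factorizations n. of_nat (totient g * k\<^sup>2) *\<^sub>Q adams g (A k))) =
      (\<Sum>x\<in>factorizations j. \<Sum>y\<in>factorizations (snd x). ?f (x, y))"
  proof (intro sum.cong refl)
    fix x assume x: "x \<in> factorizations j"
    obtain d n where dn: "x = (d, n)" "d \<ge> 1" "n \<ge> 1"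
      using factorizations_pos[OF _ j] x by (cases x) blast
    have "(\<Sum>(g, k)\<in>factorizations n. adams d (of_nat (totient g * k\<^sup>2) *\<^sub>Q adams g (A k))) =
        (\<Sum>y\<in>factorizations n. ?f (x, y))"
    proof (intro sum.cong refl)
      fix y assume y: "y \<in> factorizations n"
      obtain g k where "y = (g, k)" "g \<ge> 1" "k \<ge> 1"
        using factorizations_pos[OF _ dn(3)] y by (cases y) blast
      then show "(case y of (g, k) \<Rightarrow> adams d (of_nat (totient g * k\<^sup>2) *\<^sub>Q adams g (A k))) = ?f (x, y)"
        using dn by (simp add: adams_scaleQ adams_adams)
    qed
    then show "(case x of (d, n) \<Rightarrow> adams d (\<Sum>(g, k)\<in>factorizations n. of_nat (totient g * k\<^sup>2) *\<^sub>Q adams g (A k))) =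
        (\<Sum>y\<in>factorizations (snd x). ?f (x, y))"
      using dn by (simp add: adams_sum case_prod_unfold)
  qed
  also have "\<dots> = (\<Sum>(x, y)\<in>Sigma (factorizations j) (\<lambda>x. factorizations (snd x)). ?f (x, y))"
    using factorizations_pos[OF _ j]
    by (intro sum.Sigma) (auto intro!: finite_factorizations[OF j] finite_factorizations)
  also have "\<dots> = (\<Sum>(x, y)\<in>Sigma (factorizations j) (\<lambda>x. factorizations (fst x)). ?h (x, y))"
    by (rule sum.reindex_bij_witness[of _ "\<lambda>((n, k), (d, g)). ((d, g * k), (g, k))" "\<lambda>((d, n), (g, k)). ((d * g, k), (d, g))"])
      (auto simp: factorizations_def)
  also have "\<dots> = (\<Sum>x\<in>factorizations j. \<Sum>y\<in>factorizations (fst x). ?h (x, y))"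
    using factorizations_pos[OF _ j]
    by (intro sum.Sigma[symmetric]) (auto intro!: finite_factorizations[OF j] finite_factorizations)
  also have "\<dots> = (\<Sum>(n, k)\<in>factorizations j. (of_nat (j\<^sup>2) / of_nat n) *\<^sub>Q adams n (A k))"
  proof (rule sum.cong[OF refl], goal_cases)
    case (1 x)
    obtain n k where nk: "x = (n, k)" by (cases x)
    have n: "n \<ge> 1" and jnk: "j = n * k" using factorizations_pos[of n k j] 1 nk j by (auto simp: factorizations_def)
    have "(\<Sum>y\<in>factorizations (fst (n, k)). ?h ((n, k), y)) =
        (of_nat (\<Sum>(d, g)\<in>factorizations n. totient g) * of_nat (k\<^sup>2)) *\<^sub>Q adams n (A k)"
      by (simp add: scaleQ_sum_left[symmetric] case_prod_unfold sum_distrib_right)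
    also have "\<dots> = (of_nat (j\<^sup>2) / of_nat n) *\<^sub>Q adams n (A k)"
      unfolding sum_totient_factorizations[OF n] jnk using n by (simp add: power2_eq_square ac_simps)
    finally show ?case by (simp add: nk)
  qed
  finally show ?thesis .
qed

text \<open>A pair of divisors of \<open>j\<close> is \<open>d\<close> times a coprime pair for
  exactly one \<open>d\<close>, its gcd. So coprime pairs summed over all \<open>d\<close> become
  all pairs, that is, a product of two sums. The weights match since
  \<open>n\<^sup>2 / (g * h) = j\<^sup>2 / ((d * g) * (d * h))\<close> for
  \<open>d * n = j\<close>.\<close>

lemma sum_adams_coprime:
  fixes B C :: "nat \<Rightarrow> 'a::complete_lambda_ring"
  assumes j: "j \<ge> 1"
  shows "(\<Sum>(d, n)\<in>factorizations j. adams d (\<Sum>((g, k), (h, l)) | (g, k) \<in> factorizations n \<and> (h, l) \<in> factorizations n \<and> coprime g h.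
      (of_nat (n\<^sup>2) / of_nat (g * h)) *\<^sub>Q (adams g (B k) * adams h (C l)))) =
    of_nat (j\<^sup>2) *\<^sub>Q ((\<Sum>(g, k)\<in>factorizations j. (1 / of_nat g) *\<^sub>Q adams g (B k)) *
      (\<Sum>(h, l)\<in>factorizations j. (1 / of_nat h) *\<^sub>Q adams h (C l)))"
proof -
  let ?I = "\<lambda>n. {((g, k), (h, l)). (g, k) \<in> factorizations n \<and> (h, l) \<in> factorizations n \<and> coprime g h}"
  let ?f = "\<lambda>((d, n), ((g, k), (h, l))). (of_nat (n\<^sup>2) / of_nat (g * h)) *\<^sub>Q (adams (d * g) (B k) * adams (d * h) (C l))"
  let ?h = "\<lambda>((g, k), (h, l)). (of_nat (j\<^sup>2) / of_nat (g * h)) *\<^sub>Q (adams g (B k) * adams h (C l))"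
  define bw :: "(nat \<times> nat) \<times> (nat \<times> nat) \<Rightarrow> (nat \<times> nat) \<times> ((nat \<times> nat) \<times> (nat \<times> nat))"
    where "bw = (\<lambda>((g, k), (h, l)). ((gcd g h, j div gcd g h), ((g div gcd g h, k), (h div gcd g h, l))))"
  define fw :: "(nat \<times> nat) \<times> ((nat \<times> nat) \<times> (nat \<times> nat)) \<Rightarrow> (nat \<times> nat) \<times> (nat \<times> nat)"
    where "fw = (\<lambda>((d, n), ((g, k), (h, l))). ((d * g, k), (d * h, l)))"
  have finI: "finite (?I n)" if "n \<ge> 1" for n
    by (rule finite_subset[of _ "factorizations n \<times> factorizations n"])
      (use finite_factorizations[OF that] in auto)
  have "(\<Sum>(d, n)\<in>factorizations j. adams d (\<Sum>((g, k), (h, l))\<in>?I n.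
      (of_nat (n\<^sup>2) / of_nat (g * h)) *\<^sub>Q (adams g (B k) * adams h (C l)))) =
      (\<Sum>x\<in>factorizations j. \<Sum>y\<in>?I (snd x). ?f (x, y))"
  proof (rule sum.cong[OF refl], goal_cases)
    case (1 x)
    obtain d n where dn: "x = (d, n)" "d \<ge> 1" "n \<ge> 1"
      using factorizations_pos[OF _ j] 1 by (cases x) blast
    have "(\<Sum>((g, k), (h, l))\<in>?I n. adams d ((of_nat (n\<^sup>2) / of_nat (g * h)) *\<^sub>Q (adams g (B k) * adams h (C l)))) =
        (\<Sum>y\<in>?I n. ?f (x, y))"
    proof (rule sum.cong[OF refl], goal_cases)
      case (1 y)
      then obtain g k h l where y: "y = ((g, k), (h, l))" "(g, k) \<in> factorizations n" "(h, l) \<in> factorizations n"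
        by auto
      then have "g \<ge> 1" "h \<ge> 1" using factorizations_pos[OF _ dn(3)] by blast+
      then show ?case
        using dn y by (simp add: adams_scaleQ adams_mult adams_adams)
    qed
    then show ?case
      using dn by (simp add: adams_sum case_prod_unfold)
  qed
  also have "\<dots> = (\<Sum>(x, y)\<in>Sigma (factorizations j) (\<lambda>x. ?I (snd x)). ?f (x, y))"
    by (intro sum.Sigma finite_factorizations[OF j] ballI finI)
      (use factorizations_pos[OF _ j] in \<open>auto simp: mem_Times_iff\<close>)
  also have "\<dots> = sum ?h (factorizations j \<times> factorizations j)"
  proof (rule sum.reindex_bij_witness[of _ bw fw])
    fix a assume "a \<in> Sigma (factorizations j) (\<lambda>x. ?I (snd x))"
    then obtain d n g k h l where a: "a = ((d, n), ((g, k), (h, l)))" and dn: "(d, n) \<in> factorizations j"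
      and gk: "(g, k) \<in> factorizations n" and hl: "(h, l) \<in> factorizations n" and co: "coprime g h"
      by (auto simp: mem_Times_iff)
    have eqs: "d * n = j" "g * k = n" "h * l = n" using dn gk hl by (auto simp: factorizations_def)
    have pos: "d \<ge> 1" "n \<ge> 1" using factorizations_pos[OF dn j] by auto
    have pos2: "g \<ge> 1" "h \<ge> 1" using factorizations_pos[OF gk pos(2)] factorizations_pos[OF hl pos(2)] by auto
    have gcd: "gcd (d * g) (d * h) = d" using co by (simp add: gcd_mult_distrib_nat[symmetric])
    show "bw (fw a) = a"
      using pos eqs by (auto simp: a gcd bw_def fw_def)
    show "fw a \<in> factorizations j \<times> factorizations j"
      using eqs by (simp add: a fw_def factorizations_def mult.assoc)
    have "of_nat (n\<^sup>2) / of_nat (g * h) = (of_nat (j\<^sup>2) / of_nat (d * g * (d * h)) :: rat)"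
      unfolding eqs(1)[symmetric] using pos pos2 by (simp add: power2_eq_square)
    then show "?h (fw a) = (case a of (x, y) \<Rightarrow> ?f (x, y))"
      by (simp add: a fw_def)
  next
    fix b assume "b \<in> factorizations j \<times> factorizations j"
    then obtain g k h l where b: "b = ((g, k), (h, l))" and gk: "g * k = j" and hl: "h * l = j"
      by (auto simp: factorizations_def)
    have "g * k \<noteq> 0" "h * l \<noteq> 0" using gk hl j by simp_all
    then have pos: "g \<noteq> 0" "h \<noteq> 0" by auto
    let ?d = "gcd g h"
    have d: "?d \<noteq> 0" "?d * (g div ?d) = g" "?d * (h div ?d) = h" using pos by auto
    show "fw (bw b) = b"
      using d by (simp add: b fw_def bw_def)
    have "?d * (j div ?d) = j" using gk by auto
    moreover have "g div ?d * k = j div ?d" "h div ?d * l = j div ?d"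
      using gk hl by (metis div_mult_swap gcd_dvd1 mult.commute, metis div_mult_swap gcd_dvd2 mult.commute)
    moreover have "coprime (g div ?d) (h div ?d)" using pos by (intro div_gcd_coprime) simp
    ultimately show "bw b \<in> Sigma (factorizations j) (\<lambda>x. ?I (snd x))"
      by (simp add: b bw_def factorizations_def)
  qed
  also have "\<dots> = (\<Sum>x\<in>factorizations j. \<Sum>y\<in>factorizations j. ?h (x, y))"
    by (simp add: sum.cartesian_product case_prod_unfold)
  also have "\<dots> = of_nat (j\<^sup>2) *\<^sub>Q ((\<Sum>(g, k)\<in>factorizations j. (1 / of_nat g) *\<^sub>Q adams g (B k)) *
      (\<Sum>(h, l)\<in>factorizations j. (1 / of_nat h) *\<^sub>Q adams h (C l)))"
    by (simp add: sum_product scaleQ_sum_right case_prod_unfold scaleQ_mult_left scaleQ_mult_right scaleQ_scaleQ ac_simps)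
  finally show ?thesis .
qed

text \<open>Variables \<open>q\<^sub>1, q\<^sub>2, \<dots>\<close> on which \<open>p\<^sub>n\<close> acts like on the power sums of one alphabet; \<open>v k\<close> is the
  monomial \<open>q\<^sub>k\<close> and \<open>c k\<close> the exponent of \<open>q\<^sub>k\<close>.\<close>

locale dilated_variables =
  fixes c :: "nat \<Rightarrow> 'x::graded_index \<Rightarrow> nat" and v :: "nat \<Rightarrow> 'x"
  assumes c_v: "k \<ge> 1 \<Longrightarrow> c k (v k) = 1"
    and c_add: "c k (x + y) = c k x + c k y"
    and c_pos: "k \<ge> 1 \<Longrightarrow> c k x \<noteq> 0 \<Longrightarrow> \<exists>y. x = y + v k"
    and c_dilate: "g \<ge> 1 \<Longrightarrow> c (g * k) (dilate g x) = c k x"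
    and v_dilate: "g \<ge> 1 \<Longrightarrow> k \<ge> 1 \<Longrightarrow> dilate g (v k) = v (g * k)"
    and v_split: "g \<ge> 1 \<Longrightarrow> k \<ge> 1 \<Longrightarrow> v k = dilate g y \<Longrightarrow> g dvd k"
begin

abbreviation D :: "nat \<Rightarrow> ('x, 'a::complete_lambda_ring) series \<Rightarrow> ('x, 'a) series" where
  "D k \<equiv> pderiv (c k) (v k)"

lemma derivation_D: "k \<ge> 1 \<Longrightarrow> derivation (D k)"
  by (rule derivation_pderiv[OF c_v c_add c_pos])

lemmas continuous_D = derivation_continuous[OF derivation_D]

text \<open>No factor appears, unlike in \<open>adams_euler\<close>: \<open>p_g\<close> renames
  \<open>q_k\<close> to \<open>q_{g k}\<close>, and the derivative is taken by the new
  variable.\<close>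

lemma D_adams_dvd:
  assumes "g \<ge> 1" "k \<ge> 1"
  shows "D (g * k) (adams g F) = adams g (D k F)"
proof (rule adams_eqI[symmetric, OF assms(1)])
  fix x :: 'x
  have "dilate g x + v (g * k) = dilate g (x + v k)" using assms by (simp add: dilate_add v_dilate)
  then show "coeff (D (g * k) (adams g F)) (dilate g x) = adams g (coeff (D k F) x)"
    using assms by (simp add: coeff_pderiv c_dilate coeff_adams_dilate adams_scaleQ)
next
  fix x :: 'x assume x: "x \<notin> range (dilate g)"
  have "x + v (g * k) \<notin> range (dilate g)"
  proof
    assume "x + v (g * k) \<in> range (dilate g)"
    then obtain z where "x + v (g * k) = dilate g z" by blast
    then obtain x' where "x = dilate g x'" using dilate_split[OF assms(1)] by blast
    then show False using x by blast
  qed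
  then show "coeff (D (g * k) (adams g F)) x = 0"
    by (simp add: coeff_pderiv coeff_adams_notin scaleQ_zero_right)
qed

lemma D_adams_not_dvd:
  assumes "g \<ge> 1" "k \<ge> 1" "\<not> g dvd k"
  shows "D k (adams g F) = 0"
proof (rule series_eqI)
  fix x :: 'x
  have "x + v k \<notin> range (dilate g)"
  proof
    assume "x + v k \<in> range (dilate g)"
    then obtain z where "x + v k = dilate g z" by blast
    then obtain y where "v k = dilate g y" using dilate_split[OF assms(1)] by blast
    then show False using v_split assms by blast
  qed
  then show "coeff (D k (adams g F)) x = coeff 0 x"
    by (simp add: coeff_pderiv coeff_adams_notin scaleQ_zero_right coeff_zero)
qed

text \<open>Only the variables \<open>q_{n k}\<close> occur in \<open>p_n[V]\<close>, so the terms
  with \<open>n\<close> not dividing \<open>j\<close> drop out and the sum is finite.\<close>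

lemma D_adams_log:
  assumes V: "order_ge 1 V" and j: "j \<ge> 1"
  shows "D j (adams_log V) = (\<Sum>(n, k)\<in>factorizations j. (1 / of_nat n) *\<^sub>Q adams n (D k V))"
proof -
  note s = fsummable_adams_log[OF V]
  have "D j (adams_log V) = fsum (\<lambda>n. D j ((1 / of_nat n) *\<^sub>Q adams n V)) {1..}"
    unfolding adams_log_def by (rule fsum_map[OF continuous_D[OF j] s])
  also have "\<dots> = (\<Sum>n\<in>fst ` factorizations j. D j ((1 / of_nat n) *\<^sub>Q adams n V))"
  proof (rule fsum_eq_sum)
    show "finite (fst ` factorizations j)" using finite_factorizations[OF j] by simp
    show "fst ` factorizations j \<subseteq> {1..}" using factorizations_pos[OF _ j] by auto
    fix n assume n: "n \<in> {1..} - fst ` factorizations j"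
    have "\<not> n dvd j"
    proof
      assume "n dvd j"
      then obtain k where "(n, k) \<in> factorizations j" by (auto simp: factorizations_def dvd_def)
      then show False using n by force
    qed
    then show "D j ((1 / of_nat n) *\<^sub>Q adams n V) = 0"
      using n j by (simp add: continuous_additive_scaleQ_apply[OF continuous_D] D_adams_not_dvd scaleQ_zero_right)
  qed
  also have "\<dots> = (\<Sum>(n, k)\<in>factorizations j. (1 / of_nat n) *\<^sub>Q adams n (D k V))"
  proof (rule sum.reindex_cong[of fst])
    show "inj_on fst (factorizations j)" using j by (auto simp: inj_on_def factorizations_def)
  next
    fix x assume x: "x \<in> factorizations j"
    then obtain n k where nk: "x = (n, k)" "j = n * k" "n \<ge> 1" "k \<ge> 1"
      using factorizations_pos[OF _ j] by (cases x) (auto simp: factorizations_def)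
    then show "D j ((1 / of_nat (fst x)) *\<^sub>Q adams (fst x) V) = (case x of (n, k) \<Rightarrow> (1 / of_nat n) *\<^sub>Q adams n (D k V))"
      using j by (simp add: continuous_additive_scaleQ_apply[OF continuous_D] D_adams_dvd)
  qed simp
  finally show ?thesis .
qed

end

text \<open>\<open>s k\<close> is \<open>p\<^sub>k[S]\<close>, and \<open>L\<close> is the logarithm of the initial value, hence \<open>L/S\<close> in the
  application.\<close>

locale flow = X: dilated_variables cx vx + Y: dilated_variables cy vy
  for cx cy :: "nat \<Rightarrow> 'x::graded_index \<Rightarrow> nat" and vx vy :: "nat \<Rightarrow> 'x" +
  fixes \<omega> :: "'x \<Rightarrow> int"
    and s :: "nat \<Rightarrow> 'b::complete_lambda_ring"
    and L :: "('x, 'b) series"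
  assumes \<omega>_add: "\<omega> (x + y) = \<omega> x + \<omega> y"
    and \<omega>_dilate: "n \<ge> 1 \<Longrightarrow> \<omega> (dilate n x) = int n * \<omega> x"
    and \<omega>_le_deg: "\<omega> x \<le> int (deg x)"
    and \<omega>_vx: "\<omega> (vx k) = - int k"
    and \<omega>_vy: "\<omega> (vy k) = 0"
    and adams_s: "g \<ge> 1 \<Longrightarrow> k \<ge> 1 \<Longrightarrow> adams g (s k) = s (g * k)"
    and L_\<omega>: "coeff L x \<noteq> 0 \<Longrightarrow> \<omega> x = 0"
    and L_order: "order_ge 1 L"
begin

definition supp_ge :: "int \<Rightarrow> ('x, 'b) series \<Rightarrow> bool" where
  "supp_ge p F \<longleftrightarrow> (\<forall>x. \<omega> x < p \<longrightarrow> coeff F x = 0)"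

text \<open>Congruence modulo the filtration \<open>supp_ge\<close>
  (\<open>supp_ge_iff_agree\<close>). The recursion gains precision in \<open>\<omega>\<close>,
  which is not the degree.\<close>

definition agree :: "int \<Rightarrow> ('x, 'b) series \<Rightarrow> ('x, 'b) series \<Rightarrow> bool" where
  "agree n F G \<longleftrightarrow> (\<forall>x. \<omega> x < n \<longrightarrow> coeff F x = coeff G x)"

lemma supp_geD: "supp_ge p F \<Longrightarrow> \<omega> x < p \<Longrightarrow> coeff F x = 0"
  by (simp add: supp_ge_def)

lemma agreeD: "agree n F G \<Longrightarrow> \<omega> x < n \<Longrightarrow> coeff F x = coeff G x"
  by (simp add: agree_def)

lemma supp_ge_iff_agree: "supp_ge p F \<longleftrightarrow> agree p F 0"
  by (simp add: supp_ge_def agree_def coeff_zero)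

lemma agree_mono: "agree n F G \<Longrightarrow> m \<le> n \<Longrightarrow> agree m F G"
  by (simp add: agree_def)

lemma agree_if_supp_ge: "supp_ge n F \<Longrightarrow> supp_ge n G \<Longrightarrow> agree n F G"
  by (simp add: supp_ge_def agree_def)

lemma agree_add: "agree n F G \<Longrightarrow> agree n F' G' \<Longrightarrow> agree n (F + F') (G + G')"
  by (simp add: agree_def coeff_add)

lemma agree_sum: "(\<And>i. i \<in> A \<Longrightarrow> agree n (f i) (g i)) \<Longrightarrow> agree n (sum f A) (sum g A)"
  by (induction A rule: infinite_finite_induct) (auto intro: agree_add simp: agree_def[of n 0])

lemma agree_scaleQ: "agree n F G \<Longrightarrow> agree n (c *\<^sub>Q F) (c *\<^sub>Q G)"
  by (simp add: agree_def coeff_scaleQ)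

lemma agree_adams:
  assumes "agree n F G" "g \<ge> 1"
  shows "agree (int g * n) (adams g F) (adams g G)"
  unfolding agree_def
proof (intro allI impI)
  fix x assume x: "\<omega> x < int g * n"
  show "coeff (adams g F) x = coeff (adams g G) x"
  proof (cases "x \<in> range (dilate g)")
    case True
    then obtain y where y: "x = dilate g y" by blast
    then have "\<omega> y < n" using x assms(2) by (simp add: \<omega>_dilate)
    then show ?thesis using assms by (simp add: y coeff_adams_dilate agreeD)
  qed (simp add: coeff_adams_notin)
qed

lemma agree_XD: "agree n F G \<Longrightarrow> agree (n + int k) (X.D k F) (X.D k G)"
  by (simp add: agree_def coeff_pderiv \<omega>_add \<omega>_vx)

lemma agree_YD: "agree n F G \<Longrightarrow> agree n (Y.D k F) (Y.D k G)"
  by (simp add: agree_def coeff_pderiv \<omega>_add \<omega>_vy)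

text \<open>Error estimate for products: an error in the first factor, starting at \<open>a\<close>,
  meets terms with \<open>\<omega>\<close> at least \<open>q\<close>; an error in the second,
  starting at \<open>b\<close>, meets terms with \<open>\<omega>\<close> at least
  \<open>p\<close>.\<close>

lemma agree_mult:
  assumes F: "agree a F F'" "supp_ge p F" "supp_ge p F'"
    and G: "agree b G G'" "supp_ge q G" "supp_ge q G'"
    and n: "n \<le> a + q" "n \<le> b + p"
  shows "agree n (F * G) (F' * G')"
  unfolding agree_def
proof (intro allI impI)
  fix x assume x: "\<omega> x < n"
  have "coeff F u * coeff G w = coeff F' u * coeff G' w" if "u + w = x" for u w
  proof -
    have sum: "\<omega> u + \<omega> w < n" using x that by (auto simp: \<omega>_add)
    consider "\<omega> u < p" | "\<omega> w < q" | "\<omega> u < a" "\<omega> w < b"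
      using sum n by linarith
    then show ?thesis
    proof cases
      case 1
      then show ?thesis using supp_geD[OF F(2)] supp_geD[OF F(3)] by simp
    next
      case 2
      then show ?thesis using supp_geD[OF G(2)] supp_geD[OF G(3)] by simp
    next
      case 3
      then show ?thesis using agreeD[OF F(1)] agreeD[OF G(1)] by simp
    qed
  qed
  then show "coeff (F * G) x = coeff (F' * G') x"
    unfolding coeff_mult by (intro sum.cong refl) auto
qed

lemma supp_ge_add: "supp_ge n F \<Longrightarrow> supp_ge n G \<Longrightarrow> supp_ge n (F + G)"
  by (simp add: supp_ge_def coeff_add)

lemma supp_ge_sum: "(\<And>i. i \<in> A \<Longrightarrow> supp_ge n (f i)) \<Longrightarrow> supp_ge n (sum f A)"
  by (induction A rule: infinite_finite_induct) (auto intro: supp_ge_add simp: supp_ge_def[of n 0] coeff_zero)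

lemma supp_ge_scaleQ: "supp_ge n F \<Longrightarrow> supp_ge n (c *\<^sub>Q F)"
  by (simp add: supp_ge_def coeff_scaleQ scaleQ_zero_right)

lemma supp_ge_adams: "supp_ge n F \<Longrightarrow> g \<ge> 1 \<Longrightarrow> supp_ge (int g * n) (adams g F)"
  using agree_adams[of n F 0 g] by (simp add: supp_ge_iff_agree adams_zero)

lemma supp_ge_XD: "supp_ge n F \<Longrightarrow> supp_ge (n + int k) (X.D k F)"
  by (simp add: supp_ge_def coeff_pderiv \<omega>_add \<omega>_vx scaleQ_zero_right)

lemma supp_ge_YD: "supp_ge n F \<Longrightarrow> supp_ge n (Y.D k F)"
  by (simp add: supp_ge_def coeff_pderiv \<omega>_add \<omega>_vy scaleQ_zero_right)

lemma supp_ge_mult: "supp_ge p F \<Longrightarrow> supp_ge q G \<Longrightarrow> supp_ge (p + q) (F * G)"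
  using agree_mult[of p F 0 p q G 0 q "p + q"] by (simp add: supp_ge_iff_agree) (simp add: agree_def)

text \<open>Convergence of the sums over \<open>n\<close> is measured by degree; here
  \<open>\<omega>_le_deg\<close> turns growth of \<open>\<omega>\<close> into growth of the
  order.\<close>

lemma supp_ge_order_ge: "supp_ge (int n) F \<Longrightarrow> order_ge n F"
proof (rule order_geI)
  fix x assume "supp_ge (int n) F" "coeff F x \<noteq> 0"
  then have "int n \<le> \<omega> x" using supp_geD[of "int n" F x] by force
  then show "n \<le> deg x" using \<omega>_le_deg[of x] by simp
qed

text \<open>Applying \<open>\<Sum>\<^sub>d p\<^sub>d\<close> to \<open>\<Sum>\<^sub>n p\<^sub>n[S] Q\<^sub>n(V)\<close> must give the logarithmic heat equation for \<open>\<Sum>\<^sub>d p\<^sub>d[V]/d\<close>.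
  The totient appears as \<open>\<Sum> \<phi>(g) = n\<close> over the divisors \<open>g\<close> of \<open>n\<close>, and the outer \<open>p\<^sub>d\<close> restores the
  greatest common divisor of the two indices.\<close>

definition Q :: "('x, 'b) series \<Rightarrow> nat \<Rightarrow> ('x, 'b) series" where
  "Q V n = (\<Sum>(g, k)\<in>factorizations n. of_nat (totient g * k\<^sup>2) *\<^sub>Q adams g (X.D k (Y.D k V))) +
     (\<Sum>((g, k), (h, l)) | (g, k) \<in> factorizations n \<and> (h, l) \<in> factorizations n \<and> coprime g h.
        (of_nat (n\<^sup>2) / of_nat (g * h)) *\<^sub>Q (adams g (X.D k V) * adams h (Y.D l V)))"

text \<open>\<open>x_k\<close> raises \<open>\<omega>\<close> by \<open>k\<close>,
  \<open>y_l\<close> leaves it unchanged, \<open>p_g\<close> multiplies it by \<open>g\<close>, and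
  \<open>g * k = n\<close>.\<close>

lemma supp_ge_Q:
  assumes V: "supp_ge 0 V" and n: "n \<ge> 1"
  shows "supp_ge (int n) (Q V n)"
proof -
  have 1: "supp_ge (int n) (adams g (X.D k F))" if "(g, k) \<in> factorizations n" "supp_ge 0 F" for g k F
  proof -
    have "supp_ge (int g * (0 + int k)) (adams g (X.D k F))"
      using factorizations_pos[OF that(1) n] by (intro supp_ge_adams supp_ge_XD that(2)) simp
    moreover have "int g * int k = int n" using that(1) by (auto simp: factorizations_def)
    ultimately show ?thesis by simp
  qed
  have 2: "supp_ge (int n) (adams g (X.D k V) * adams h (Y.D l V))"
    if "(g, k) \<in> factorizations n" "(h, l) \<in> factorizations n" for g k h l
  proof -
    have "supp_ge (int h * 0) (adams h (Y.D l V))"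
      using factorizations_pos[OF that(2) n] by (intro supp_ge_adams supp_ge_YD V) simp
    then show ?thesis using supp_ge_mult[OF 1[OF that(1) V]] by fastforce
  qed
  show ?thesis
    unfolding Q_def
    by (intro supp_ge_add supp_ge_sum) (auto intro!: supp_ge_scaleQ 1 2 supp_ge_YD V)
qed

text \<open>The contraction behind the recursion: every term contains an X-derivative, which
  improves the precision by at least 1. In the products the factor \<open>p_h[y_l V]\<close> is
  known only below \<open>m\<close>, but it meets a factor supported in
  \<open>\<omega> \<ge> n \<ge> 1\<close>.\<close>

lemma agree_Q:
  assumes V: "supp_ge 0 V" "supp_ge 0 V'" and agr: "agree m V V'" and m: "m \<ge> 0" and n: "n \<ge> 1"
  shows "agree (m + 1) (Q V n) (Q V' n)"
proof -
  have le: "m + 1 \<le> int g * (m + int k)" if "g \<ge> 1" "k \<ge> 1" for g k :: nat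
  proof -
    have "1 * (m + 1) \<le> int g * (m + int k)" using that m by (intro mult_mono) simp_all
    then show ?thesis by simp
  qed
  have 1: "agree (m + 1) (adams g (X.D k F)) (adams g (X.D k G))"
    if "(g, k) \<in> factorizations n" "agree m F G" for g k F G
    using factorizations_pos[OF that(1) n] by (intro agree_mono[OF agree_adams[OF agree_XD[OF that(2)]]] le) simp_all
  have 2: "agree (m + 1) (adams g (X.D k V) * adams h (Y.D l V)) (adams g (X.D k V') * adams h (Y.D l V'))"
    if gk: "(g, k) \<in> factorizations n" and hl: "(h, l) \<in> factorizations n" for g k h l
  proof (rule agree_mult[where p = "int n" and q = 0 and a = "m + 1" and b = m])
    have gk': "g \<ge> 1" "k \<ge> 1" "int g * int k = int n" and hl': "h \<ge> 1"
      using factorizations_pos[OF gk n] factorizations_pos[OF hl n] gk by (auto simp: factorizations_def)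
    show "agree (m + 1) (adams g (X.D k V)) (adams g (X.D k V'))" by (rule 1[OF gk agr])
    show "supp_ge (int n) (adams g (X.D k V))" "supp_ge (int n) (adams g (X.D k V'))"
      using supp_ge_adams[OF supp_ge_XD[OF V(1), of k] gk'(1)] supp_ge_adams[OF supp_ge_XD[OF V(2), of k] gk'(1)]
      by (simp_all add: gk'(3))
    show "supp_ge 0 (adams h (Y.D l V))" "supp_ge 0 (adams h (Y.D l V'))"
      using supp_ge_adams[OF supp_ge_YD[OF V(1), of l] hl'] supp_ge_adams[OF supp_ge_YD[OF V(2), of l] hl']
      by simp_all
    have "1 * m \<le> int h * m" using hl' m by (intro mult_right_mono) simp_all
    then show "agree m (adams h (Y.D l V)) (adams h (Y.D l V'))"
      by (intro agree_mono[OF agree_adams[OF agree_YD[OF agr] hl']]) simp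
  qed (use n in simp_all)
  show ?thesis
    unfolding Q_def
    by (intro agree_add agree_sum) (auto intro!: agree_scaleQ 1 2 agree_YD agr)
qed

text \<open>One step of the recursion: \<open>V\<close> is the fixed point, its coefficients with \<open>\<omega> = n\<close> being reached
  after \<open>n + 1\<close> steps.\<close>

definition \<Psi> :: "('x, 'b) series \<Rightarrow> ('x, 'b) series" where
  "\<Psi> V = Series (\<lambda>x. if \<omega> x = 0 then coeff L x
     else if \<omega> x > 0 then (1 / of_int (\<omega> x)) *\<^sub>Q (\<Sum>n\<in>{1..deg x}. s n * coeff (Q V n) x) else 0)"

lemma supp_ge_\<Psi>: "supp_ge 0 (\<Psi> V)"
  by (simp add: supp_ge_def \<Psi>_def)

lemma agree_\<Psi>:
  assumes "supp_ge 0 V" "supp_ge 0 V'" "agree m V V'" "m \<ge> 0"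
  shows "agree (m + 1) (\<Psi> V) (\<Psi> V')"
  unfolding agree_def
proof (intro allI impI)
  fix x assume "\<omega> x < m + 1"
  then have "coeff (Q V n) x = coeff (Q V' n) x" if "n \<in> {1..deg x}" for n
    using that by (intro agreeD[OF agree_Q[OF assms]]) simp_all
  then show "coeff (\<Psi> V) x = coeff (\<Psi> V') x" by (simp add: \<Psi>_def)
qed

section \<open>The fixed point \<open>V\<close> and its equation\<close>

definition V :: "('x, 'b) series" where
  "V = Series (\<lambda>x. coeff ((\<Psi> ^^ Suc (nat (\<omega> x))) 0) x)"

lemma supp_ge_iterate: "supp_ge 0 ((\<Psi> ^^ n) 0)"
  by (cases n) (simp_all add: supp_ge_\<Psi> supp_ge_def[of _ 0] coeff_zero)

lemma agree_iterate: "agree (int n) ((\<Psi> ^^ n) 0) ((\<Psi> ^^ (n + k)) 0)"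
proof (induction n)
  case 0
  show ?case using agree_if_supp_ge[OF supp_ge_iterate[of 0] supp_ge_iterate[of k]] by simp
next
  case (Suc n)
  then show ?case using agree_\<Psi>[OF supp_ge_iterate supp_ge_iterate Suc.IH] by (simp add: add.commute)
qed

lemma supp_ge_V: "supp_ge 0 V"
  unfolding supp_ge_def V_def using supp_geD[OF supp_ge_iterate] by (simp del: funpow.simps)

lemma agree_iterate_V: "agree (int n) ((\<Psi> ^^ n) 0) V"
  unfolding agree_def
proof (intro allI impI)
  fix x assume x: "\<omega> x < int n"
  show "coeff ((\<Psi> ^^ n) 0) x = coeff V x"
  proof (cases "\<omega> x < 0")
    case True
    then show ?thesis using supp_geD[OF supp_ge_V True] supp_geD[OF supp_ge_iterate True] by simp
  next
    case False
    define k where "k = Suc (nat (\<omega> x))"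
    have k: "k \<le> n" "\<omega> x < int k" using x False by (auto simp: k_def)
    then have "coeff ((\<Psi> ^^ k) 0) x = coeff ((\<Psi> ^^ n) 0) x"
      using agreeD[OF agree_iterate[of k "n - k"]] by simp
    then show ?thesis by (simp add: V_def k_def)
  qed
qed

lemma \<Psi>_V: "\<Psi> V = V"
proof (rule series_eqI)
  fix x
  define n where "n = Suc (nat (\<omega> x))"
  have n: "\<omega> x < int n + 1" by (simp add: n_def)
  have *: "agree (int n + 1) (\<Psi> ((\<Psi> ^^ n) 0)) (\<Psi> V)"
    by (rule agree_\<Psi>[OF supp_ge_iterate supp_ge_V agree_iterate_V]) simp
  have "agree (int n + 1) (\<Psi> ((\<Psi> ^^ n) 0)) V"
    using agree_iterate_V[of "Suc n"] by (simp add: add.commute)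
  from agreeD[OF * n] agreeD[OF this n] show "coeff (\<Psi> V) x = coeff V x" by simp
qed

lemma agree_V_L: "agree 1 V L"
  unfolding agree_def
proof (intro allI impI)
  fix x assume "\<omega> x < 1"
  then consider "\<omega> x = 0" | "\<omega> x < 0" by linarith
  then show "coeff V x = coeff L x"
  proof cases
    case 1
    then show ?thesis by (subst \<Psi>_V[symmetric]) (simp add: \<Psi>_def)
  next
    case 2
    then show ?thesis using supp_geD[OF supp_ge_V] L_\<omega>[of x] by force
  qed
qed

lemma order_ge_V: "order_ge 1 V"
proof (rule order_geI)
  fix x assume x: "coeff V x \<noteq> 0"
  then have "\<not> \<omega> x < 0" using supp_geD[OF supp_ge_V] by blast
  show "1 \<le> deg x"
  proof (cases "\<omega> x = 0")
    case True
    then have "coeff L x \<noteq> 0" using x agreeD[OF agree_V_L, of x] by simp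
    then show ?thesis by (rule order_geD[OF L_order])
  next
    case False
    then show ?thesis using \<open>\<not> \<omega> x < 0\<close> \<omega>_le_deg[of x] by linarith
  qed
qed

lemma order_ge_Q: "n \<ge> 1 \<Longrightarrow> order_ge n (Q V n)"
  by (rule supp_ge_order_ge[OF supp_ge_Q[OF supp_ge_V]])

lemma fsummable_Q: "fsummable (\<lambda>n. smult (s n) (Q V n)) {1..}"
  by (rule fsummable_filt, rule order_ge_filt, rule order_ge_smult, rule order_ge_Q) simp

text \<open>\<open>\<Psi> V = V\<close> with its finite sum completed: \<open>Q V n\<close> has
  order at least \<open>n\<close>, so the bound \<open>deg x\<close> in \<open>\<Psi>\<close> cuts
  off only zeros. For \<open>\<omega> \<le> 0\<close> both sides vanish.\<close>

lemma euler_V: "euler \<omega> V = fsum (\<lambda>n. smult (s n) (Q V n)) {1..}"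
proof (rule series_eqI)
  fix x
  have 1: "coeff (Q V n) x = 0" if "n \<ge> 1" "n > deg x" for n
    using order_geD[OF order_ge_Q[OF that(1)], of x] that(2) by force
  have "coeff (fsum (\<lambda>n. smult (s n) (Q V n)) {1..}) x = fsum (\<lambda>n. s n * coeff (Q V n) x) {1..}"
    by (subst coeff_fsum[OF fsummable_Q]) simp
  also have "\<dots> = (\<Sum>n\<in>{1..deg x}. s n * coeff (Q V n) x)"
    by (rule fsum_eq_sum) (auto simp: 1)
  also have "\<dots> = of_int (\<omega> x) *\<^sub>Q coeff V x"
  proof (cases "\<omega> x > 0")
    case True
    then have "coeff V x = (1 / of_int (\<omega> x)) *\<^sub>Q (\<Sum>n\<in>{1..deg x}. s n * coeff (Q V n) x)"
      by (subst \<Psi>_V[symmetric]) (simp add: \<Psi>_def)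
    then show ?thesis using True by (simp add: scaleQ_scaleQ scaleQ_one)
  next
    case False
    have "coeff (Q V n) x = 0" if "n \<ge> 1" for n
      by (rule supp_geD[OF supp_ge_Q[OF supp_ge_V that]]) (use False that in simp)
    moreover have "of_int (\<omega> x) *\<^sub>Q coeff V x = 0"
      using False supp_geD[OF supp_ge_V, of x] by (cases "\<omega> x = 0") (auto simp: scaleQ_zero_left scaleQ_zero_right)
    ultimately show ?thesis by simp
  qed
  finally show "coeff (euler \<omega> V) x = coeff (fsum (\<lambda>n. smult (s n) (Q V n)) {1..}) x"
    by (simp add: coeff_euler)
qed

section \<open>From \<open>V\<close> to the heat equation for \<open>Exp V\<close>\<close>

abbreviation W :: "('x, 'b) series" where
  "W \<equiv> adams_log V"

lemma XD_YD_W: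
  assumes j: "j \<ge> 1"
  shows "X.D j (Y.D j W) = (\<Sum>(n, k)\<in>factorizations j. (1 / of_nat n) *\<^sub>Q adams n (X.D k (Y.D k V)))"
proof -
  note c = X.continuous_D[OF j]
  have "X.D j (Y.D j W) = (\<Sum>x\<in>factorizations j. X.D j (case x of (n, k) \<Rightarrow> (1 / of_nat n) *\<^sub>Q adams n (Y.D k V)))"
    unfolding Y.D_adams_log[OF order_ge_V j] by (rule additive_sum) (rule continuous_additive_add[OF c])
  also have "\<dots> = (\<Sum>(n, k)\<in>factorizations j. (1 / of_nat n) *\<^sub>Q adams n (X.D k (Y.D k V)))"
  proof (rule sum.cong[OF refl], goal_cases)
    case (1 x)
    then obtain n k where nk: "x = (n, k)" "j = n * k" "n \<ge> 1" "k \<ge> 1"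
      using factorizations_pos[OF _ j] by (cases x) (auto simp: factorizations_def)
    have "X.D j ((1 / of_nat n) *\<^sub>Q adams n (Y.D k V)) = (1 / of_nat n) *\<^sub>Q X.D j (adams n (Y.D k V))"
      by (rule continuous_additive_scaleQ_apply[OF c])
    also have "X.D j (adams n (Y.D k V)) = adams n (X.D k (Y.D k V))"
      unfolding nk(2) by (rule X.D_adams_dvd[OF nk(3,4)])
    finally show ?case by (simp add: nk(1))
  qed
  finally show ?thesis .
qed

text \<open>The bracket on the right is \<open>x_j y_j exp(W)\<close> divided by
  \<open>exp(W)\<close>, the heat operator in logarithmic form.\<close>

lemma sum_adams_Q:
  assumes j: "j \<ge> 1"
  shows "(\<Sum>(d, n)\<in>factorizations j. adams d (Q V n)) =
    of_nat (j\<^sup>2) *\<^sub>Q (X.D j (Y.D j W) + X.D j W * Y.D j W)"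
proof -
  have "(\<Sum>(d, n)\<in>factorizations j. adams d (Q V n)) =
      (\<Sum>(d, n)\<in>factorizations j.
        adams d (\<Sum>(g, k)\<in>factorizations n. of_nat (totient g * k\<^sup>2) *\<^sub>Q adams g (X.D k (Y.D k V)))) +
      (\<Sum>(d, n)\<in>factorizations j.
        adams d (\<Sum>((g, k), (h, l)) | (g, k) \<in> factorizations n \<and> (h, l) \<in> factorizations n \<and> coprime g h.
          (of_nat (n\<^sup>2) / of_nat (g * h)) *\<^sub>Q (adams g (X.D k V) * adams h (Y.D l V))))"
    unfolding sum.distrib[symmetric]
  proof (rule sum.cong[OF refl], goal_cases)
    case (1 x)
    then have "fst x \<ge> 1" using factorizations_pos[of "fst x" "snd x", OF _ j] by simp
    then show ?case by (simp add: case_prod_unfold Q_def adams_add)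
  qed
  also have "\<dots> = of_nat (j\<^sup>2) *\<^sub>Q X.D j (Y.D j W) + of_nat (j\<^sup>2) *\<^sub>Q (X.D j W * Y.D j W)"
    unfolding sum_adams_totient[OF j] sum_adams_coprime[OF j] XD_YD_W[OF j]
    unfolding X.D_adams_log[OF order_ge_V j] Y.D_adams_log[OF order_ge_V j]
    by (simp add: scaleQ_sum_right case_prod_unfold scaleQ_scaleQ)
  finally show ?thesis by (simp add: scaleQ_add_right)
qed

definition heat :: "nat \<Rightarrow> ('x, 'b) series \<Rightarrow> ('x, 'b) series" where
  "heat j G = smult (s j) (of_nat (j\<^sup>2) *\<^sub>Q G)"

text \<open>\<open>E W\<close> is the sum of the \<open>p_d[E V]\<close>, a double sum over
  \<open>d\<close> and \<open>n\<close> in which \<open>p_d[p_n[S]] = p_{d n}[S]\<close>. Its terms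
  have order at least \<open>d * n\<close>, so it may be regrouped by \<open>j = d * n\<close>,
  where \<open>sum_adams_Q\<close> applies.\<close>

lemma euler_W:
  shows "fsummable (\<lambda>j. heat j (X.D j (Y.D j W) + X.D j W * Y.D j W)) {1..}"
    and "euler \<omega> W = fsum (\<lambda>j. heat j (X.D j (Y.D j W) + X.D j W * Y.D j W)) {1..}"
proof -
  define t where "t = (\<lambda>(d, n). smult (s (d * n)) (adams d (Q V n)))"
  let ?S = "Sigma {1..} factorizations"
  have t_adams: "adams d (smult (s n) (Q V n)) = t (d, n)" if "d \<ge> 1" "n \<ge> 1" for d n
    using that by (simp add: t_def adams_smult adams_s)
  have t_filt: "t (d, n) \<in> filt (d * n)" if "d \<ge> 1" "n \<ge> 1" for d n
    unfolding t_def using that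
    by (simp add: order_ge_filt order_ge_smult order_ge_adams order_ge_Q)
  have st: "fsummable t ({1..} \<times> {1..})"
    unfolding fsummable_def
  proof
    fix N
    have "x \<in> {..N} \<times> {..N}" if x: "x \<in> {1..} \<times> {1..}" "t x \<notin> filt N" for x
    proof -
      obtain d n where dn: "x = (d, n)" "d \<ge> 1" "n \<ge> 1" using x(1) by auto
      have "\<not> N \<le> d * n"
      proof
        assume "N \<le> d * n"
        then have "filt (d * n) \<subseteq> (filt N :: ('x, 'b) series set)" by (rule filt_antimono)
        from subsetD[OF this t_filt[OF dn(2,3)]] x(2) dn(1) show False by simp
      qed
      then have "d * 1 \<le> N" "1 * n \<le> N"
        using mult_le_mono[of d d 1 n] mult_le_mono[of 1 d n n] dn by linarith+
      then show ?thesis using dn by simp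
    qed
    then have "{x \<in> {1..} \<times> {1..}. t x \<notin> filt N} \<subseteq> {..N} \<times> {..N}" by blast
    then show "finite {x \<in> {1..} \<times> {1..}. t x \<notin> filt N}" by (rule finite_subset) simp
  qed
  have bij: "bij_betw snd ?S ({1..} \<times> {1..})"
    unfolding bij_betw_def
  proof
    show "inj_on snd ?S" by (auto simp: inj_on_def factorizations_def)
    show "snd ` ?S = {1..} \<times> {1..}"
    proof
      show "snd ` ?S \<subseteq> {1..} \<times> {1..}" using factorizations_pos by fastforce
      show "{1..} \<times> {1..} \<subseteq> snd ` ?S"
      proof
        fix x :: "nat \<times> nat" assume "x \<in> {1..} \<times> {1..}"
        then have "(fst x * snd x, x) \<in> ?S" by (cases x) (auto simp: factorizations_def)
        then show "x \<in> snd ` ?S" by (rule image_eqI[rotated]) simp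
      qed
    qed
  qed
  have st': "fsummable (\<lambda>i. t (snd i)) ?S"
    by (rule fsummable_reindex[of snd ?S t]) (use bij st in \<open>simp_all add: bij_betw_def\<close>)
  have inner: "fsum (\<lambda>b. t (snd (j, b))) (factorizations j) = heat j (X.D j (Y.D j W) + X.D j W * Y.D j W)"
    if "j \<in> {1..}" for j
  proof -
    have j: "j \<ge> 1" using that by simp
    have "fsum (\<lambda>b. t (snd (j, b))) (factorizations j) = (\<Sum>(d, n)\<in>factorizations j. smult (s j) (adams d (Q V n)))"
      unfolding fsum_finite[OF finite_factorizations[OF j]]
      by (rule sum.cong) (auto simp: t_def factorizations_def)
    also have "\<dots> = smult (s j) (\<Sum>(d, n)\<in>factorizations j. adams d (Q V n))"
      by (subst additive_sum[of "smult (s j)", OF continuous_additive_add[OF continuous_additive_smult]])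
        (simp add: case_prod_unfold)
    finally show ?thesis by (simp add: sum_adams_Q[OF j] heat_def)
  qed
  show "fsummable (\<lambda>j. heat j (X.D j (Y.D j W) + X.D j W * Y.D j W)) {1..}"
    using fsummable_Sigma_outer[OF st'] by (simp only: fsummable_cong[OF inner])
  have eV: "adams d (euler \<omega> V) = fsum (\<lambda>n. t (d, n)) {1..}" if d: "d \<in> {1..}" for d
  proof -
    have "adams d (euler \<omega> V) = fsum (\<lambda>n. adams d (smult (s n) (Q V n))) {1..}"
      unfolding euler_V using d by (intro fsum_map[OF continuous_additive_adams fsummable_Q]) simp
    also have "\<dots> = fsum (\<lambda>n. t (d, n)) {1..}" by (rule fsum_cong) (use d t_adams in simp)
    finally show ?thesis .
  qed
  note cE = derivation_continuous[OF derivation_euler[of \<omega>, OF \<omega>_add]]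
  have "euler \<omega> W = fsum (\<lambda>d. euler \<omega> ((1 / of_nat d) *\<^sub>Q adams d V)) {1..}"
    unfolding adams_log_def by (rule fsum_map[OF cE fsummable_adams_log[OF order_ge_V]])
  also have "\<dots> = fsum (\<lambda>d. fsum (\<lambda>n. t (d, n)) {1..}) {1..}"
  proof (rule fsum_cong)
    fix d :: nat assume d: "d \<in> {1..}"
    have "euler \<omega> ((1 / of_nat d) *\<^sub>Q adams d V) = adams d (euler \<omega> V)"
      using d by (simp add: continuous_additive_scaleQ_apply[OF cE] adams_euler \<omega>_dilate scaleQ_scaleQ scaleQ_one)
    then show "euler \<omega> ((1 / of_nat d) *\<^sub>Q adams d V) = fsum (\<lambda>n. t (d, n)) {1..}" using eV[OF d] by simp
  qed
  also have "\<dots> = fsum t ({1..} \<times> {1..})" by (rule fsum_Sigma[OF st, symmetric])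
  also have "\<dots> = fsum (\<lambda>i. t (snd i)) ?S" by (rule fsum_bij_betw[OF bij st])
  also have "\<dots> = fsum (\<lambda>j. heat j (X.D j (Y.D j W) + X.D j W * Y.D j W)) {1..}"
    unfolding fsum_Sigma[OF st'] by (rule fsum_cong) (rule inner)
  finally show "euler \<omega> W = fsum (\<lambda>j. heat j (X.D j (Y.D j W) + X.D j W * Y.D j W)) {1..}" .
qed

lemma heat_equation:
  "fsummable (\<lambda>j. heat j (X.D j (Y.D j (Exp V)))) {1..}"
  "euler \<omega> (Exp V) = fsum (\<lambda>j. heat j (X.D j (Y.D j (Exp V)))) {1..}"
proof -
  have conv: "fsummable (\<lambda>n. (1 / fact n) *\<^sub>Q W ^ n) UNIV"
    using Exp_converges_series[OF order_ge_V] by (simp add: Exp_converges_def)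
  have e: "D (Exp V) = Exp V * D W" if "derivation D" for D
    unfolding Exp_eq_fexp by (rule derivation_fexp[OF that conv])
  have h: "Exp V * heat j (X.D j (Y.D j W) + X.D j W * Y.D j W) = heat j (X.D j (Y.D j (Exp V)))"
    if "j \<in> {1..}" for j
  proof -
    have j: "j \<ge> 1" using that by simp
    note X = X.derivation_D[OF j] and Y = Y.derivation_D[OF j]
    have "X.D j (Y.D j (Exp V)) = Exp V * (X.D j (Y.D j W) + X.D j W * Y.D j W)"
      by (simp add: e[OF X] e[OF Y] derivation_mult[OF X] distrib_left ac_simps)
    then show ?thesis
      by (simp add: heat_def mult.commute[of "Exp V"] smult_mult scaleQ_mult_left)
  qed
  show "fsummable (\<lambda>j. heat j (X.D j (Y.D j (Exp V)))) {1..}"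
    using fsummable_map[OF continuous_additive_mult_left[of "Exp V"] euler_W(1)] by (simp only: fsummable_cong[OF h])
  have "euler \<omega> (Exp V) = Exp V * euler \<omega> W" by (rule e[OF derivation_euler[OF \<omega>_add]])
  also have "\<dots> = fsum (\<lambda>j. Exp V * heat j (X.D j (Y.D j W) + X.D j W * Y.D j W)) {1..}"
    unfolding euler_W(2) by (rule fsum_map[OF continuous_additive_mult_left euler_W(1)])
  also have "\<dots> = fsum (\<lambda>j. heat j (X.D j (Y.D j (Exp V)))) {1..}" by (rule fsum_cong) (rule h)
  finally show "euler \<omega> (Exp V) = fsum (\<lambda>j. heat j (X.D j (Y.D j (Exp V)))) {1..}" .
qed

text \<open>Among series supported in \<open>\<omega> \<ge> 0\<close>, equality of the parts with
  \<open>\<omega> = 0\<close> is compatible with products, \<open>p_n\<close> and sums, so it passes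
  from \<open>V\<close> and \<open>L\<close> to their exponentials.\<close>

lemma Exp_V_leading_term: "supp_ge 0 (Exp V) \<and> supp_ge 0 (Exp L) \<and> agree 1 (Exp V) (Exp L)"
proof -
  define R where "R F G \<longleftrightarrow> supp_ge 0 F \<and> supp_ge 0 G \<and> agree 1 F G" for F G
  have "lambda_relation R"
    unfolding lambda_relation_def
  proof (intro conjI allI impI)
    have "\<omega> 0 = 0" using \<omega>_add[of 0 0] by simp
    then show "R 1 1" by (auto simp: R_def supp_ge_def agree_def coeff_one)
    show "R (F * F') (G * G')" if "R F G" "R F' G'" for F G F' G'
      using that supp_ge_mult[of 0 F 0 F'] supp_ge_mult[of 0 G 0 G'] agree_mult[of 1 F G 0 1 F' G' 0 1]
      by (simp add: R_def)
    show "R (c *\<^sub>Q F) (c *\<^sub>Q G)" if "R F G" for c F G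
      using that by (simp add: R_def supp_ge_scaleQ agree_scaleQ)
    show "R (adams n F) (adams n G)" if n: "1 \<le> n" and "R F G" for n F G
      using that(2) supp_ge_adams[OF _ n, of 0 F] supp_ge_adams[OF _ n, of 0 G]
        agree_mono[OF agree_adams[OF _ n, of 1 F G], of 1] n
      by (simp add: R_def)
    show "R (fsum f A) (fsum g A)"
      if fg: "\<forall>i\<in>A. R (f i) (g i)" and s: "fsummable f A" "fsummable g A" for f g and A :: "nat set"
    proof -
      have "fsum (\<lambda>i. coeff (f i) x) A = fsum (\<lambda>i. coeff (g i) x) A" if "\<omega> x < 1" for x
        by (rule fsum_cong) (use fg that in \<open>auto simp: R_def agree_def\<close>)
      moreover have "fsum (\<lambda>i. coeff (f i) x) A = sum (\<lambda>i. coeff (f i) x) {}" if "\<omega> x < 0" for x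
        by (rule fsum_eq_sum) (use fg that in \<open>auto simp: R_def supp_ge_def\<close>)
      ultimately show ?thesis
        by (auto simp: R_def supp_ge_def agree_def coeff_fsum s)
    qed
  qed
  moreover have "supp_ge 0 L" unfolding supp_ge_def using L_\<omega> by force
  then have "R V L" by (simp add: R_def supp_ge_V agree_V_L)
  ultimately have "R (Exp V) (Exp L)"
    by (rule lambda_relation_Exp[OF _ _ Exp_converges_series[OF order_ge_V] Exp_converges_series[OF L_order]])
  then show ?thesis by (simp add: R_def)
qed

text \<open>The subring of series supported in \<open>\<omega> = 0\<close> is coded as a diagonal
  relation \<open>R\<close>, so that \<open>lambda_relation_Exp\<close> proves it closed under
  \<open>Exp\<close>.\<close>

lemma Exp_L_support:
  assumes x: "\<omega> x \<noteq> 0"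
  shows "coeff (Exp L) x = 0"
proof -
  define R where "R F G \<longleftrightarrow> F = G \<and> (\<forall>x. \<omega> x \<noteq> 0 \<longrightarrow> coeff F x = 0)" for F G :: "('x, 'b) series"
  have "lambda_relation R"
    unfolding lambda_relation_def
  proof (intro conjI allI impI)
    have "\<omega> 0 = 0" using \<omega>_add[of 0 0] by simp
    then show "R 1 1" by (auto simp: R_def coeff_one)
    show "R (F * F') (G * G')" if "R F G" "R F' G'" for F G F' G'
    proof -
      have "coeff (F * F') x = 0" if x: "\<omega> x \<noteq> 0" for x
      proof (rule ccontr)
        assume "coeff (F * F') x \<noteq> 0"
        then obtain a b where ab: "a + b = x" "coeff F a \<noteq> 0" "coeff F' b \<noteq> 0" by (rule coeff_mult_nonzero)
        then have "\<omega> a = 0" "\<omega> b = 0" using \<open>R F G\<close> \<open>R F' G'\<close> by (auto simp: R_def)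
        then show False using x ab(1) \<omega>_add[of a b] by simp
      qed
      then show ?thesis using that by (simp add: R_def)
    qed
    show "R (c *\<^sub>Q F) (c *\<^sub>Q G)" if "R F G" for c F G
      using that by (auto simp: R_def coeff_scaleQ scaleQ_zero_right)
    show "R (adams n F) (adams n G)" if n: "1 \<le> n" and FG: "R F G" for n F G
    proof -
      have "coeff (adams n F) x = 0" if x: "\<omega> x \<noteq> 0" for x
      proof (rule ccontr)
        assume "coeff (adams n F) x \<noteq> 0"
        then obtain y where y: "x = dilate n y" "coeff F y \<noteq> 0" using n by (rule coeff_adams_nonzero)
        then have "\<omega> y = 0" using FG by (auto simp: R_def)
        then show False using x y(1) \<omega>_dilate[OF n] by simp
      qed
      then show ?thesis using FG by (simp add: R_def)
    qed
    show "R (fsum f A) (fsum g A)"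
      if fg: "\<forall>i\<in>A. R (f i) (g i)" and s: "fsummable f A" "fsummable g A" for f g and A :: "nat set"
    proof -
      have "fsum f A = fsum g A" by (rule fsum_cong) (use fg in \<open>simp add: R_def\<close>)
      moreover have "fsum (\<lambda>i. coeff (f i) x) A = sum (\<lambda>i. coeff (f i) x) {}" if "\<omega> x \<noteq> 0" for x
        by (rule fsum_eq_sum) (use fg that in \<open>auto simp: R_def\<close>)
      ultimately show ?thesis by (auto simp: R_def coeff_fsum[OF s(1), symmetric])
    qed
  qed
  moreover have "R L L" using L_\<omega> by (auto simp: R_def)
  ultimately have "R (Exp L) (Exp L)"
    by (rule lambda_relation_Exp[OF _ _ Exp_converges_series[OF L_order] Exp_converges_series[OF L_order]])
  then show ?thesis using x by (simp add: R_def)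
qed

end


section \<open>Integrality of the logarithm of the flow\<close>

text \<open>\<open>I\<close> stands for the image of \<open>\<Lambda>\<close>. Divisibility is
  spelled out with a cofactor in \<open>I\<close>, since the \<open>p_n[S]\<close> are units in
  \<open>\<Lambda>\<^sub>S\<close> and plain divisibility there says nothing.\<close>

locale integral_flow = flow cx cy vx vy \<omega> s L
  for cx cy :: "nat \<Rightarrow> 'x::graded_index \<Rightarrow> nat" and vx vy and \<omega>
    and s :: "nat \<Rightarrow> 'b::complete_lambda_ring" and L +
  fixes I :: "'b set"
  assumes I_zero: "0 \<in> I"
    and I_add: "a \<in> I \<Longrightarrow> b \<in> I \<Longrightarrow> a + b \<in> I"
    and I_mult: "a \<in> I \<Longrightarrow> b \<in> I \<Longrightarrow> a * b \<in> I"
    and I_scaleQ: "a \<in> I \<Longrightarrow> c *\<^sub>Q a \<in> I"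
    and I_adams: "a \<in> I \<Longrightarrow> n \<ge> 1 \<Longrightarrow> adams n a \<in> I"
    and s_dvd: "g \<ge> 1 \<Longrightarrow> g dvd n \<Longrightarrow> n \<ge> 1 \<Longrightarrow> \<exists>i\<in>I. s 1 * s n = i * s g"
    and s_coprime_dvd: "g dvd n \<Longrightarrow> h dvd n \<Longrightarrow> coprime g h \<Longrightarrow> n \<ge> 1 \<Longrightarrow> \<exists>i\<in>I. s 1 * s n = i * (s g * s h)"
    and L_integral: "s 1 * coeff L x \<in> I"
begin

lemma I_sum: "(\<And>i. i \<in> A \<Longrightarrow> f i \<in> I) \<Longrightarrow> sum f A \<in> I"
  by (induction A rule: infinite_finite_induct) (auto simp: I_zero I_add)

text \<open>\<open>c\<close> acts as a common denominator; the truncation at \<open>m\<close> makes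
  this an induction hypothesis for the recursion in \<open>\<omega>\<close>.\<close>

definition integral :: "'b \<Rightarrow> int \<Rightarrow> ('x, 'b) series \<Rightarrow> bool" where
  "integral c m F \<longleftrightarrow> (\<forall>x. \<omega> x < m \<longrightarrow> c * coeff F x \<in> I)"

lemma integral_mono: "integral c n F \<Longrightarrow> m \<le> n \<Longrightarrow> integral c m F"
  by (simp add: integral_def)

lemma integral_add: "integral c m F \<Longrightarrow> integral c m G \<Longrightarrow> integral c m (F + G)"
  by (simp add: integral_def coeff_add distrib_left I_add)

lemma integral_sum: "(\<And>i. i \<in> A \<Longrightarrow> integral c m (f i)) \<Longrightarrow> integral c m (sum f A)"
  by (induction A rule: infinite_finite_induct)
    (auto intro: integral_add simp: integral_def[of _ _ 0] coeff_zero I_zero)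

lemma integral_scaleQ: "integral c m F \<Longrightarrow> integral c m (q *\<^sub>Q F)"
  by (simp add: integral_def coeff_scaleQ scaleQ_mult_right I_scaleQ)

lemma integral_multiple: "integral c m F \<Longrightarrow> i \<in> I \<Longrightarrow> integral (i * c) m F"
  by (simp add: integral_def mult.assoc I_mult)

lemma integral_XD: "integral c m F \<Longrightarrow> integral c (m + int k) (X.D k F)"
  by (simp add: integral_def coeff_pderiv scaleQ_mult_right I_scaleQ \<omega>_add \<omega>_vx)

lemma integral_YD: "integral c m F \<Longrightarrow> integral c m (Y.D k F)"
  by (simp add: integral_def coeff_pderiv scaleQ_mult_right I_scaleQ \<omega>_add \<omega>_vy)

lemma integral_adams:
  assumes "integral c m F" "g \<ge> 1"
  shows "integral (adams g c) (int g * m) (adams g F)"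
  unfolding integral_def
proof (intro allI impI)
  fix x assume x: "\<omega> x < int g * m"
  show "adams g c * coeff (adams g F) x \<in> I"
  proof (cases "x \<in> range (dilate g)")
    case True
    then obtain y where y: "x = dilate g y" by blast
    then have "\<omega> y < m" using x assms(2) by (simp add: \<omega>_dilate)
    then have "c * coeff F y \<in> I" using assms(1) by (simp add: integral_def)
    from I_adams[OF this assms(2)] show ?thesis
      using assms(2) by (simp add: y coeff_adams_dilate adams_mult)
  qed (simp add: coeff_adams_notin I_zero)
qed

lemma integral_mult:
  assumes F: "integral c a F" "supp_ge p F" and G: "integral d b G" "supp_ge q G"
    and n: "n \<le> a + q" "n \<le> b + p"
  shows "integral (c * d) n (F * G)"
  unfolding integral_def
proof (intro allI impI)
  fix x assume x: "\<omega> x < n"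
  have "c * d * (coeff F u * coeff G w) \<in> I" if "u + w = x" for u w
  proof -
    have sum: "\<omega> u + \<omega> w < n" using x that by (auto simp: \<omega>_add)
    consider "\<omega> u < p" | "\<omega> w < q" | "\<omega> u < a" "\<omega> w < b"
      using sum n by linarith
    then show ?thesis
    proof cases
      case 1
      then show ?thesis using supp_geD[OF F(2)] by (simp add: I_zero)
    next
      case 2
      then show ?thesis using supp_geD[OF G(2)] by (simp add: I_zero)
    next
      case 3
      then have "c * coeff F u \<in> I" "d * coeff G w \<in> I" using F(1) G(1) by (auto simp: integral_def)
      from I_mult[OF this] show ?thesis by (simp add: ac_simps)
    qed
  qed
  then show "c * d * coeff (F * G) x \<in> I"
    unfolding coeff_mult sum_distrib_left by (intro I_sum) auto
qed

text \<open>If \<open>s 1\<close> clears the denominators of \<open>V\<close>, then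
  \<open>p_g[s 1] = s g\<close> clears those of \<open>p_g[V]\<close>, and \<open>s g * s h\<close>
  those of a product. The bound rises to \<open>m + 1\<close> for the same reason as in
  \<open>agree_Q\<close>.\<close>

lemma integral_Q:
  assumes int: "integral (s 1) m V" and m: "m \<ge> 0" and n: "n \<ge> 1"
  shows "integral (s 1 * s n) (m + 1) (Q V n)"
proof -
  have le: "m + 1 \<le> int g * (m + int k)" if "g \<ge> 1" "k \<ge> 1" for g k :: nat
  proof -
    have "1 * (m + 1) \<le> int g * (m + int k)" using that m by (intro mult_mono) simp_all
    then show ?thesis by simp
  qed
  have s_adams: "adams g (s 1) = s g" if "g \<ge> 1" for g
    using adams_s[OF that, of 1] by simp
  have 1: "integral (s g) (m + 1) (adams g (X.D k F))"
    if "(g, k) \<in> factorizations n" "integral (s 1) m F" for g k F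
  proof -
    have gk: "g \<ge> 1" "k \<ge> 1" using factorizations_pos[OF that(1) n] by auto
    show ?thesis using integral_mono[OF integral_adams[OF integral_XD[OF that(2)] gk(1)] le[OF gk]]
      by (simp only: s_adams[OF gk(1)])
  qed
  have 2: "integral (s 1 * s n) (m + 1) (adams g (X.D k (Y.D k V)))" if gk: "(g, k) \<in> factorizations n" for g k
  proof -
    have "g \<ge> 1" "g dvd n" using factorizations_pos[OF gk n] gk by (auto simp: factorizations_def)
    then obtain i where "i \<in> I" "s 1 * s n = i * s g" using s_dvd n by blast
    then show ?thesis using integral_multiple[OF 1[OF gk integral_YD[OF int]], of i] by simp
  qed
  have 3: "integral (s 1 * s n) (m + 1) (adams g (X.D k V) * adams h (Y.D l V))"
    if gk: "(g, k) \<in> factorizations n" and hl: "(h, l) \<in> factorizations n" and co: "coprime g h" for g k h l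
  proof -
    have eqs: "g * k = n" "h * l = n" using gk hl by (auto simp: factorizations_def)
    have gk': "g \<ge> 1" "g dvd n" "int g * int k = int n"
      using factorizations_pos[OF gk n] eqs(1) by auto
    have hl': "h \<ge> 1" "h dvd n" using factorizations_pos[OF hl n] dvd_triv_left[of h l] eqs(2) by auto
    have "1 * m \<le> int h * m" using hl' m by (intro mult_right_mono) simp_all
    then have int': "integral (s h) m (adams h (Y.D l V))"
      using integral_mono[OF integral_adams[OF integral_YD[OF int] hl'(1)], of m]
      by (simp only: s_adams[OF hl'(1)] mult_1)
    have supp: "supp_ge (int n) (adams g (X.D k V))"
      using supp_ge_adams[OF supp_ge_XD[OF supp_ge_V, of k] gk'(1)] by (simp add: gk'(3))
    have supp': "supp_ge 0 (adams h (Y.D l V))"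
      using supp_ge_adams[OF supp_ge_YD[OF supp_ge_V, of l] hl'(1)] by simp
    have "integral (s g * s h) (m + 1) (adams g (X.D k V) * adams h (Y.D l V))"
      by (rule integral_mult[OF 1[OF gk int] supp int' supp']) (use n in simp_all)
    moreover obtain i where "i \<in> I" "s 1 * s n = i * (s g * s h)"
      using s_coprime_dvd[OF gk'(2) hl'(2) co n] by blast
    ultimately show ?thesis using integral_multiple by simp
  qed
  show ?thesis
    unfolding Q_def
    by (intro integral_add integral_sum) (auto intro!: integral_scaleQ 2 3 simp del: One_nat_def)
qed

lemma V_integral: "s 1 * coeff V x \<in> I"
proof -
  have "integral (s 1) (int m) V" for m
  proof (induction m)
    case 0
    show ?case using supp_geD[OF supp_ge_V] by (simp add: integral_def I_zero)
  next
    case (Suc m)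
    show ?case
      unfolding integral_def
    proof (intro allI impI)
      fix x assume x: "\<omega> x < int (Suc m)"
      have "s 1 * (\<Sum>n\<in>{1..deg x}. s n * coeff (Q V n) x) \<in> I"
        unfolding sum_distrib_left mult.assoc[symmetric]
        by (rule I_sum) (use integral_Q[OF Suc.IH] x in \<open>auto simp: integral_def simp del: One_nat_def\<close>)
      \<comment> \<open>The division by \<open>\<omega> x\<close> costs nothing, as \<open>I\<close>
        is closed under rational scalars.\<close>
      then have "s 1 * coeff (\<Psi> V) x \<in> I"
        by (simp add: \<Psi>_def scaleQ_mult_right L_integral I_zero I_scaleQ del: One_nat_def)
      then show "s 1 * coeff V x \<in> I" by (simp only: \<Psi>_V)
    qed
  qed
  from this[of "Suc (nat (\<omega> x))"] show ?thesis by (simp add: integral_def)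
qed

end


section \<open>Partitions and the trace functional\<close>

text \<open>0 cannot be a part. The value chosen at \<open>k = 0\<close> keeps the degree equal to
  \<open>k\<close> for every \<open>k\<close>, as \<open>\<omega>_vx\<close> in \<open>flow\<close>
  demands.\<close>

definition single_part :: "nat \<Rightarrow> partition" where
  "single_part k = (if k = 0 then 0 else Partition {#k#})"

lemma parts_single_part: "k \<ge> 1 \<Longrightarrow> parts (single_part k) = {#k#}"
  by (simp add: single_part_def Partition_inverse)

lemma deg_single_part: "deg (single_part k) = k"
proof (cases "k = 0")
  case False
  then show ?thesis by (simp add: deg_partition_def parts_single_part)
next
  case True
  then have "single_part k = 0" by (simp add: single_part_def)
  then show ?thesis using True by (simp only: deg_zero)
qed

lemma partition_eqI: "parts \<mu> = parts \<nu> \<Longrightarrow> \<mu> = \<nu>"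
  by (simp add: parts_inject)

lemma partition_add_eq_zero: "\<mu> + \<nu> = 0 \<Longrightarrow> \<mu> = (0::partition)"
  by (rule partition_eqI) (metis parts_add parts_zero union_eq_empty)

lemma partition_deg_zero: "deg \<mu> = 0 \<Longrightarrow> \<mu> = (0::partition)"
proof (rule partition_eqI)
  assume "deg \<mu> = 0"
  then have "size (parts \<mu>) \<le> 0"
    using size_le_sum_mset[OF parts_pos[of \<mu>]] by (simp only: deg_partition_def)
  then show "parts \<mu> = parts 0" by (simp add: parts_zero)
qed

lemma dilated_variables_partition: "dilated_variables (\<lambda>k \<mu>. count (parts \<mu>) k) single_part"
proof
  fix k g :: nat and \<mu> \<nu> :: partition
  show "count (parts (single_part k)) k = 1" if "k \<ge> 1" using that by (simp add: parts_single_part)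
  show "count (parts (\<mu> + \<nu>)) k = count (parts \<mu>) k + count (parts \<nu>) k" by (simp add: parts_add)
  show "\<exists>\<nu>. \<mu> = \<nu> + single_part k" if "k \<ge> 1" "count (parts \<mu>) k \<noteq> 0"
  proof (intro exI[of _ "\<mu> - single_part k"] partition_eqI)
    have "k \<in># parts \<mu>" using that(2) by (meson count_inI)
    then show "parts \<mu> = parts (\<mu> - single_part k + single_part k)"
      using that(1) by (simp add: parts_add parts_diff parts_single_part)
  qed
  show "count (parts (dilate g \<mu>)) (g * k) = count (parts \<mu>) k" if g: "g \<ge> 1"
  proof -
    have "count (image_mset ((*) g) M) (g * k) = count M k" for M
      using g by (induction M) auto
    then show ?thesis using g by (simp add: parts_dilate)
  qed
  show "dilate g (single_part k) = single_part (g * k)" if "g \<ge> 1" "k \<ge> 1"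
    using that by (intro partition_eqI) (simp add: parts_dilate parts_single_part)
  show "g dvd k" if "g \<ge> 1" "k \<ge> 1" "single_part k = dilate g \<mu>"
  proof -
    have "{#k#} = image_mset ((*) g) (parts \<mu>)"
      using arg_cong[OF that(3), of parts] that(1,2) by (simp add: parts_single_part parts_dilate)
    then have "k \<in># image_mset ((*) g) (parts \<mu>)" by (metis union_single_eq_member add_mset_add_single)
    then show ?thesis by auto
  qed
qed

section \<open>The variables of one alphabet inside a product of index sets\<close>

lemma dilated_variables_fst:
  assumes "dilated_variables c v"
  shows "dilated_variables (\<lambda>k x. c k (fst x)) (\<lambda>k. (v k, 0 :: 'y::graded_index))"
proof -
  note c_v = dilated_variables.c_v[OF assms] and c_add = dilated_variables.c_add[OF assms]
    and c_pos = dilated_variables.c_pos[OF assms] and c_dilate = dilated_variables.c_dilate[OF assms]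
    and v_dilate = dilated_variables.v_dilate[OF assms] and v_split = dilated_variables.v_split[OF assms]
  show ?thesis
  proof
    fix k g and x y :: "'a \<times> 'y"
    show "k \<ge> 1 \<Longrightarrow> c k (fst (v k, 0 :: 'y)) = 1" by (simp add: c_v)
    show "c k (fst (x + y)) = c k (fst x) + c k (fst y)" by (simp add: c_add)
    show "\<exists>y. x = y + (v k, 0)" if k: "k \<ge> 1" "c k (fst x) \<noteq> 0"
    proof -
      obtain z where "fst x = z + v k" using c_pos[OF k] by blast
      then have "x = (z, snd x) + (v k, 0)" by (simp add: prod_eq_iff)
      then show ?thesis by blast
    qed
    show "g \<ge> 1 \<Longrightarrow> c (g * k) (fst (dilate g x)) = c k (fst x)" by (simp add: dilate_prod_def c_dilate)
    show "g \<ge> 1 \<Longrightarrow> k \<ge> 1 \<Longrightarrow> dilate g (v k, 0 :: 'y) = (v (g * k), 0)"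
      by (simp add: dilate_prod_def v_dilate dilate_zero)
    show "g \<ge> 1 \<Longrightarrow> k \<ge> 1 \<Longrightarrow> (v k, 0) = dilate g y \<Longrightarrow> g dvd k"
      by (simp add: dilate_prod_def v_split)
  qed
qed

lemma dilated_variables_snd:
  assumes "dilated_variables c v"
  shows "dilated_variables (\<lambda>k x. c k (snd x)) (\<lambda>k. (0 :: 'y::graded_index, v k))"
proof -
  note c_v = dilated_variables.c_v[OF assms] and c_add = dilated_variables.c_add[OF assms]
    and c_pos = dilated_variables.c_pos[OF assms] and c_dilate = dilated_variables.c_dilate[OF assms]
    and v_dilate = dilated_variables.v_dilate[OF assms] and v_split = dilated_variables.v_split[OF assms]
  show ?thesis
  proof
    fix k g and x y :: "'y \<times> 'a"
    show "k \<ge> 1 \<Longrightarrow> c k (snd (0 :: 'y, v k)) = 1" by (simp add: c_v)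
    show "c k (snd (x + y)) = c k (snd x) + c k (snd y)" by (simp add: c_add)
    show "\<exists>y. x = y + (0, v k)" if k: "k \<ge> 1" "c k (snd x) \<noteq> 0"
    proof -
      obtain z where "snd x = z + v k" using c_pos[OF k] by blast
      then have "x = (fst x, z) + (0, v k)" by (simp add: prod_eq_iff)
      then show ?thesis by blast
    qed
    show "g \<ge> 1 \<Longrightarrow> c (g * k) (snd (dilate g x)) = c k (snd x)" by (simp add: dilate_prod_def c_dilate)
    show "g \<ge> 1 \<Longrightarrow> k \<ge> 1 \<Longrightarrow> dilate g (0 :: 'y, v k) = (0, v (g * k))"
      by (simp add: dilate_prod_def v_dilate dilate_zero)
    show "g \<ge> 1 \<Longrightarrow> k \<ge> 1 \<Longrightarrow> (0, v k) = dilate g y \<Longrightarrow> g dvd k"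
      by (simp add: dilate_prod_def v_split)
  qed
qed

section \<open>The numbers \<open>zee\<close> and the solution of the heat equation at the
  origin\<close>

lemma zee_eq_prod:
  assumes "finite A" "set_mset (parts \<nu>) \<subseteq> A"
  shows "zee \<nu> = (\<Prod>i\<in>A. i ^ count (parts \<nu>) i * fact (count (parts \<nu>) i))"
  unfolding zee_def using assms by (intro prod.mono_neutral_left) (auto simp: not_in_iff)

text \<open>Normalising by \<open>zee\<close> turns the weight
  \<open>k\<^sup>2 (m + 1)\<^sup>2\<close> of the heat operator on diagonal coefficients into
  \<open>k (m + 1)\<close>, where \<open>m\<close> is the multiplicity of \<open>k\<close> in
  \<open>\<rho>\<close>.\<close>

lemma zee_add_single_part:
  assumes k: "k \<ge> 1"
  shows "zee (\<rho> + single_part k) = zee \<rho> * (k * (count (parts \<rho>) k + 1))"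
proof -
  define A where "A = insert k (set_mset (parts \<rho>))"
  have A: "finite A" "k \<in> A" "set_mset (parts \<rho>) \<subseteq> A" "set_mset (parts (\<rho> + single_part k)) \<subseteq> A"
    using k by (auto simp: A_def parts_add parts_single_part)
  have rest: "(\<Prod>i\<in>A - {k}. i ^ count (parts (\<rho> + single_part k)) i * fact (count (parts (\<rho> + single_part k)) i)) =
      (\<Prod>i\<in>A - {k}. i ^ count (parts \<rho>) i * fact (count (parts \<rho>) i))"
    by (rule prod.cong) (use k in \<open>auto simp: parts_add parts_single_part\<close>)
  show ?thesis
    unfolding zee_eq_prod[OF A(1,3)] zee_eq_prod[OF A(1,4)] prod.remove[OF A(1,2)] rest
    using k by (simp add: parts_add parts_single_part algebra_simps)
qed

lemma padams_zero: "padams 0 S = 1"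
  by (simp add: padams_def parts_zero)

lemma padams_add: "padams (\<mu> + \<nu>) S = padams \<mu> S * padams \<nu> S"
  by (simp add: padams_def parts_add)

lemma padams_single_part: "k \<ge> 1 \<Longrightarrow> padams (single_part k) S = adams k S"
  by (simp add: padams_def parts_single_part)

lemma deg_eq_sum_count:
  assumes "deg \<tau> \<le> N"
  shows "(\<Sum>k\<in>{1..N}. k * count (parts \<tau>) k) = deg \<tau>"
proof -
  have "sum_mset M = (\<Sum>k\<in>{1..N}. k * count M k)" if "set_mset M \<subseteq> {1..N}" for M
    using that
  proof (induction M)
    case (add x M)
    have "(\<Sum>k\<in>{1..N}. k * count (add_mset x M) k) =
        (\<Sum>k\<in>{1..N}. k * count M k) + (\<Sum>k\<in>{1..N}. if k = x then x else 0)"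
      unfolding sum.distrib[symmetric] by (rule sum.cong) auto
    then show ?case using add by simp
  qed simp
  moreover have "set_mset (parts \<tau>) \<subseteq> {1..N}"
  proof
    fix x assume x: "x \<in># parts \<tau>"
    then have "x \<noteq> 0" using parts_pos[of \<tau>] by metis
    moreover have "x \<le> deg \<tau>" unfolding deg_partition_def by (rule set_mset_le_sum_mset[OF x])
    ultimately show "x \<in> {1..N}" using assms by simp
  qed
  ultimately show ?thesis by (simp add: deg_partition_def)
qed

text \<open>Vanishes unless \<open>\<rho>\<close> is contained in \<open>\<sigma>\<close>, provided that no part of \<open>\<rho>\<close> exceeds \<open>N\<close>. These are the
  coefficients of the solution of the heat equation with prescribed values on the partitions of \<open>N\<close>.\<close>

definition sub_choose :: "nat \<Rightarrow> partition \<Rightarrow> partition \<Rightarrow> nat" where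
  "sub_choose N \<sigma> \<rho> = (\<Prod>k\<in>{1..N}. count (parts \<sigma>) k choose count (parts \<rho>) k)"

lemma sub_choose_nonzero:
  assumes "sub_choose N \<sigma> \<rho> \<noteq> 0" "deg \<rho> \<le> N"
  shows "\<sigma> = \<rho> + (\<sigma> - \<rho>)"
proof -
  have "parts \<rho> \<subseteq># parts \<sigma>"
    unfolding subseteq_mset_def
  proof
    fix k
    show "count (parts \<rho>) k \<le> count (parts \<sigma>) k"
    proof (cases "k \<in># parts \<rho>")
      case True
      then have "k \<noteq> 0" using parts_pos[of \<rho>] by metis
      moreover have "k \<le> deg \<rho>" unfolding deg_partition_def by (rule set_mset_le_sum_mset[OF True])
      ultimately have "k \<in> {1..N}" using assms(2) by simp
      then have "(count (parts \<sigma>) k choose count (parts \<rho>) k) \<noteq> 0"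
        using assms(1) unfolding sub_choose_def by (metis prod_zero finite_atLeastAtMost)
      then show ?thesis by (meson binomial_eq_0 not_le)
    qed (simp add: not_in_iff)
  qed
  then show ?thesis by (intro partition_eqI) (simp add: parts_add parts_diff)
qed

lemma Suc_times_choose_Suc: "Suc r * (n choose Suc r) = (n - r) * (n choose r)"
  by (simp only: binomial_absorption binomial_absorb_comp)

lemma sub_choose_add_single_part:
  assumes k: "k \<in> {1..N}"
  shows "(count (parts \<rho>) k + 1) * sub_choose N \<sigma> (\<rho> + single_part k) =
    (count (parts \<sigma>) k - count (parts \<rho>) k) * sub_choose N \<sigma> \<rho>"
proof -
  have rest: "(\<Prod>i\<in>{1..N} - {k}. count (parts \<sigma>) i choose count (parts (\<rho> + single_part k)) i) =
      (\<Prod>i\<in>{1..N} - {k}. count (parts \<sigma>) i choose count (parts \<rho>) i)"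
    by (rule prod.cong) (use k in \<open>auto simp: parts_add parts_single_part\<close>)
  have "count (parts (\<rho> + single_part k)) k = Suc (count (parts \<rho>) k)"
    using k by (simp add: parts_add parts_single_part)
  then show ?thesis
    unfolding sub_choose_def prod.remove[OF finite_atLeastAtMost k] rest
    using Suc_times_choose_Suc[of "count (parts \<rho>) k" "count (parts \<sigma>) k"]
    by (simp only: mult.assoc[symmetric] Suc_eq_plus1)
qed

text \<open>By absorption each term is \<open>sub_choose N \<sigma> \<rho>\<close> times
  \<open>k\<close> times the multiplicity of \<open>k\<close> in \<open>\<sigma> - \<rho>\<close>,
  and these add up to the degree of \<open>\<sigma> - \<rho>\<close>. The truncated subtraction is
  exact where \<open>sub_choose\<close> is nonzero, as \<open>\<rho>\<close> is then contained in
  \<open>\<sigma>\<close>.\<close>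

lemma sum_sub_choose:
  assumes \<sigma>: "deg \<sigma> = N" and \<rho>: "deg \<rho> \<le> N"
  shows "(\<Sum>k\<in>{1..N}. k * (count (parts \<rho>) k + 1) * sub_choose N \<sigma> (\<rho> + single_part k)) =
    (N - deg \<rho>) * sub_choose N \<sigma> \<rho>"
proof -
  have "(\<Sum>k\<in>{1..N}. k * (count (parts \<rho>) k + 1) * sub_choose N \<sigma> (\<rho> + single_part k)) =
      (\<Sum>k\<in>{1..N}. k * (count (parts \<sigma>) k - count (parts \<rho>) k)) * sub_choose N \<sigma> \<rho>"
    unfolding sum_distrib_right mult.assoc
    by (rule sum.cong) (simp_all only: sub_choose_add_single_part)
  also have "\<dots> = (N - deg \<rho>) * sub_choose N \<sigma> \<rho>"
  proof (cases "sub_choose N \<sigma> \<rho> = 0")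
    case False
    define \<tau> where "\<tau> = \<sigma> - \<rho>"
    have "\<sigma> = \<rho> + \<tau>" unfolding \<tau>_def by (rule sub_choose_nonzero[OF False \<rho>])
    then have deg: "N - deg \<rho> = deg \<tau>" "deg \<tau> \<le> N" using \<sigma> deg_add[of \<rho> \<tau>] by simp_all
    have "count (parts \<sigma>) k - count (parts \<rho>) k = count (parts \<tau>) k" for k
      by (simp add: \<tau>_def parts_diff)
    then show ?thesis using deg_eq_sum_count[OF deg(2)] deg(1) by simp
  qed simp
  finally show ?thesis .
qed

text \<open>Read downwards from degree \<open>N\<close>, the recursion determines \<open>G\<close>
  from its values in degree \<open>N\<close>. By \<open>sum_sub_choose\<close> the solution has the
  weights \<open>sub_choose\<close>, and these are all 1 at \<open>\<rho> = 0\<close>.\<close>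

lemma heat_flow_at_zero:
  fixes G :: "partition \<Rightarrow> 'a::rat_algebra"
  assumes large: "\<And>\<rho>. deg \<rho> > N \<Longrightarrow> G \<rho> = 0"
    and step: "\<And>\<rho>. deg \<rho> < N \<Longrightarrow> of_nat (N - deg \<rho>) *\<^sub>Q G \<rho> =
      (\<Sum>k\<in>{1..N}. of_nat (k * (count (parts \<rho>) k + 1)) *\<^sub>Q G (\<rho> + single_part k))"
  shows "G 0 = (\<Sum>\<sigma> | deg \<sigma> = N. G \<sigma>)"
proof -
  have small: "sub_choose N \<sigma> \<rho> = (if \<rho> = \<sigma> then 1 else 0)" if "deg \<sigma> = N" "deg \<rho> = N" for \<sigma> \<rho>
  proof (cases "sub_choose N \<sigma> \<rho> = 0")
    case True
    moreover have "sub_choose N \<sigma> \<sigma> = 1" by (simp add: sub_choose_def)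
    ultimately show ?thesis by (cases "\<rho> = \<sigma>") simp_all
  next
    case False
    have eq: "\<sigma> = \<rho> + (\<sigma> - \<rho>)" by (rule sub_choose_nonzero[OF False]) (use that in simp)
    then have "deg (\<sigma> - \<rho>) = 0" using that deg_add[of \<rho> "\<sigma> - \<rho>"] by simp
    then have "\<sigma> = \<rho>" using eq partition_deg_zero[of "\<sigma> - \<rho>"] by simp
    then show ?thesis by (simp add: sub_choose_def)
  qed
  have claim: "G \<rho> = (\<Sum>\<sigma> | deg \<sigma> = N. of_nat (sub_choose N \<sigma> \<rho>) *\<^sub>Q G \<sigma>)" if "deg \<rho> \<le> N" for \<rho>
    using that
  proof (induction "N - deg \<rho>" arbitrary: \<rho> rule: less_induct)
    case less
    show ?case
    proof (cases "deg \<rho> = N")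
      case True
      have "(\<Sum>\<sigma> | deg \<sigma> = N. of_nat (sub_choose N \<sigma> \<rho>) *\<^sub>Q G \<sigma>) = (\<Sum>\<sigma> | deg \<sigma> = N. if \<rho> = \<sigma> then G \<sigma> else 0)"
        by (rule sum.cong) (simp_all add: small True scaleQ_one scaleQ_zero_left)
      then show ?thesis using True by (simp add: finite_deg)
    next
      case False
      with less.prems have lt: "deg \<rho> < N" by simp
      have "of_nat (k * (count (parts \<rho>) k + 1)) *\<^sub>Q G (\<rho> + single_part k) =
          (\<Sum>\<sigma> | deg \<sigma> = N. of_nat (k * (count (parts \<rho>) k + 1) * sub_choose N \<sigma> (\<rho> + single_part k)) *\<^sub>Q G \<sigma>)"
        if k: "k \<in> {1..N}" for k
      proof (cases "deg \<rho> + k \<le> N")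
        case True
        then have "G (\<rho> + single_part k) =
            (\<Sum>\<sigma> | deg \<sigma> = N. of_nat (sub_choose N \<sigma> (\<rho> + single_part k)) *\<^sub>Q G \<sigma>)"
          using k lt by (intro less.hyps) (simp_all add: deg_add deg_single_part)
        then show ?thesis by (simp add: scaleQ_sum_right scaleQ_scaleQ)
      next
        \<comment> \<open>Degree above \<open>N\<close>: the left side vanishes by
          \<open>large\<close>, the right side because \<open>\<sigma> - \<rho>\<close> has degree
          below \<open>k\<close> and so cannot contain the part \<open>k\<close>.\<close>
        case False
        have "(count (parts \<rho>) k + 1) * sub_choose N \<sigma> (\<rho> + single_part k) = 0" if "deg \<sigma> = N" for \<sigma>
        proof (cases "sub_choose N \<sigma> \<rho> = 0")
          case nz: False
          define \<tau> where "\<tau> = \<sigma> - \<rho>"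
          have "\<sigma> = \<rho> + \<tau>" unfolding \<tau>_def using nz less.prems by (rule sub_choose_nonzero)
          then have "deg \<tau> < k" using that False deg_add[of \<rho> \<tau>] by simp
          then have "k \<notin># parts \<tau>"
            using set_mset_le_sum_mset[of k "parts \<tau>"] by (auto simp: deg_partition_def)
          then have "count (parts \<sigma>) k - count (parts \<rho>) k = 0"
            by (simp add: \<tau>_def parts_diff not_in_iff)
          then show ?thesis unfolding sub_choose_add_single_part[OF k] by simp
        qed (simp only: sub_choose_add_single_part[OF k] mult_0_right)
        then have "sub_choose N \<sigma> (\<rho> + single_part k) = 0" if "deg \<sigma> = N" for \<sigma> using that by simp
        moreover have "G (\<rho> + single_part k) = 0"
          using False by (intro large) (simp add: deg_add deg_single_part)
        ultimately show ?thesis by (simp add: scaleQ_zero_right scaleQ_zero_left)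
      qed
      then have "of_nat (N - deg \<rho>) *\<^sub>Q G \<rho> = (\<Sum>k\<in>{1..N}. \<Sum>\<sigma> | deg \<sigma> = N.
          of_nat (k * (count (parts \<rho>) k + 1) * sub_choose N \<sigma> (\<rho> + single_part k)) *\<^sub>Q G \<sigma>)"
        unfolding step[OF lt] by (intro sum.cong refl) simp
      also have "\<dots> = (\<Sum>\<sigma> | deg \<sigma> = N. \<Sum>k\<in>{1..N}.
          of_nat (k * (count (parts \<rho>) k + 1) * sub_choose N \<sigma> (\<rho> + single_part k)) *\<^sub>Q G \<sigma>)"
        by (rule sum.swap)
      also have "\<dots> = (\<Sum>\<sigma> | deg \<sigma> = N. of_nat (N - deg \<rho>) *\<^sub>Q of_nat (sub_choose N \<sigma> \<rho>) *\<^sub>Q G \<sigma>)"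
      proof (rule sum.cong[OF refl])
        fix \<sigma> :: partition assume "\<sigma> \<in> {\<sigma>. deg \<sigma> = N}"
        then have "deg \<sigma> = N" by simp
        show "(\<Sum>k\<in>{1..N}. of_nat (k * (count (parts \<rho>) k + 1) * sub_choose N \<sigma> (\<rho> + single_part k)) *\<^sub>Q G \<sigma>) =
            of_nat (N - deg \<rho>) *\<^sub>Q of_nat (sub_choose N \<sigma> \<rho>) *\<^sub>Q G \<sigma>"
          unfolding scaleQ_sum_left[symmetric] of_nat_sum[symmetric]
            sum_sub_choose[OF \<open>deg \<sigma> = N\<close> less.prems] of_nat_mult[of "N - deg \<rho>"] scaleQ_scaleQ ..
      qed
      also have "\<dots> = of_nat (N - deg \<rho>) *\<^sub>Q (\<Sum>\<sigma> | deg \<sigma> = N. of_nat (sub_choose N \<sigma> \<rho>) *\<^sub>Q G \<sigma>)"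
        by (simp add: scaleQ_sum_right)
      finally have "(1 / of_nat (N - deg \<rho>)) *\<^sub>Q of_nat (N - deg \<rho>) *\<^sub>Q G \<rho> =
          (1 / of_nat (N - deg \<rho>)) *\<^sub>Q of_nat (N - deg \<rho>) *\<^sub>Q (\<Sum>\<sigma> | deg \<sigma> = N. of_nat (sub_choose N \<sigma> \<rho>) *\<^sub>Q G \<sigma>)"
        by simp
      moreover have "(1 / of_nat (N - deg \<rho>)) * of_nat (N - deg \<rho>) = (1 :: rat)" using lt by simp
      ultimately show ?thesis by (simp only: scaleQ_scaleQ scaleQ_one)
    qed
  qed
  have "sub_choose N \<sigma> 0 = 1" for \<sigma> by (simp add: sub_choose_def parts_zero)
  then show ?thesis using claim[of 0] by (simp add: deg_zero scaleQ_one)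
qed

lemma hall_mod_basis:
  "hall_mod S (basis \<mu>) (basis \<nu>) =
    (if \<mu> = \<nu> then of_nat (zee \<nu>) *\<^sub>Q padams \<nu> S else (0 :: 'a::complete_lambda_ring))"
proof -
  have "hall_mod S (basis \<mu>) (basis \<nu> :: (partition, 'a) series) =
      (\<Sum>\<rho>\<in>{\<nu>}. of_nat (zee \<rho>) *\<^sub>Q (coeff (pleth_scale S (basis \<mu>)) \<rho> * coeff (basis \<nu>) \<rho>))"
    unfolding hall_mod_def hall_def by (rule fsum_eq_sum) (auto simp: basis_def scaleQ_zero_right)
  then show ?thesis by (auto simp: pleth_scale_def basis_def scaleQ_zero_right)
qed

text \<open>Orthogonality of the power sums leaves only the diagonal, so summability along it
  carries over to the whole family.\<close>

lemma mod_integral_eq: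
  fixes K :: "(partition \<times> partition, 'a::complete_lambda_ring) series"
  assumes "fsummable (\<lambda>\<sigma>. of_nat (zee \<sigma>) *\<^sub>Q (padams \<sigma> S * coeff K (\<sigma>, \<sigma>))) UNIV"
  shows "mod_integral S K = fsum (\<lambda>\<sigma>. of_nat (zee \<sigma>) *\<^sub>Q (padams \<sigma> S * coeff K (\<sigma>, \<sigma>))) UNIV"
proof -
  let ?f = "\<lambda>(\<mu>, \<nu>). coeff K (\<mu>, \<nu>) * hall_mod S (basis \<mu>) (basis \<nu>)"
  let ?h = "\<lambda>\<sigma> :: partition. (\<sigma>, \<sigma>)"
  have h: "inj ?h" by (auto simp: inj_on_def)
  have eq: "?f (?h \<sigma>) = of_nat (zee \<sigma>) *\<^sub>Q (padams \<sigma> S * coeff K (\<sigma>, \<sigma>))" for \<sigma>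
    by (simp add: hall_mod_basis scaleQ_mult_right mult.commute)
  have s: "fsummable (\<lambda>\<sigma>. ?f (?h \<sigma>)) UNIV" using assms by (simp only: eq)
  have zero: "?f i = 0" if "i \<in> UNIV - range ?h" for i
    using that by (cases i) (auto simp: hall_mod_basis)
  have "mod_integral S K = fsum ?f (range ?h)"
    unfolding mod_integral_def
    by (rule fsum_mono_neutral[OF fsummable_mono_neutral[OF fsum_reindex(1)[OF h s]]]) (use zero in auto)
  also have "\<dots> = fsum (\<lambda>\<sigma>. ?f (?h \<sigma>)) UNIV" by (rule fsum_reindex(2)[OF h s])
  finally show ?thesis by (simp only: eq)
qed


section \<open>The universal kernel\<close>

type_synonym var = "(partition \<times> partition) power_var"

text \<open>The total degree in X of the terms of \<open>L\<close> from which the indeterminates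
  come, \<open>p_n\<close> multiplying it by \<open>n\<close>. It is kept apart from
  \<open>deg\<close>, which must be positive on every indeterminate.\<close>

definition X_weight :: "var multiset \<Rightarrow> nat" where
  "X_weight M = (\<Sum>v\<in>#M. exponent v * deg (fst (index v)))"

lemma X_weight_add: "X_weight (M + N) = X_weight M + X_weight N"
  by (simp add: X_weight_def)

lemma X_weight_dilate: "n \<ge> 1 \<Longrightarrow> X_weight (dilate n M) = n * X_weight M"
  by (induction M) (simp_all add: X_weight_def dilate_multiset_def distrib_left)

lemma X_weight_le_deg: "X_weight M \<le> deg M"
proof (induction M)
  case (add v M)
  have "exponent v * deg (fst (index v)) \<le> exponent v * Suc (deg (index v))"
    by (intro mult_le_mono) (simp_all add: deg_prod_def)
  then show ?case using add by (simp add: X_weight_def deg_multiset_def weight_power_var_def)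
qed (simp add: X_weight_def deg_multiset_def)

definition omega :: "var multiset \<times> (partition \<times> partition) \<Rightarrow> int" where
  "omega x = int (X_weight (fst x)) - int (deg (fst (snd x)))"

text \<open>\<open>\<Sum> c a\<^bsub>\<mu>\<nu>\<^esub> p\<^sub>\<mu>[X] p\<^sub>\<nu>[Y]\<close> with indeterminates \<open>a\<^bsub>\<mu>\<nu>\<^esub>\<close>.\<close>

definition generic_series :: "'b \<Rightarrow> (var multiset \<times> (partition \<times> partition), 'b::rat_algebra) series" where
  "generic_series c = Series (\<lambda>(M, i). if M = {#Power_Var i 0#} then c else 0)"

lemma coeff_generic_series: "coeff (generic_series c) (M, i) = (if M = {#Power_Var i 0#} then c else 0)"
  by (simp add: generic_series_def)

text \<open>\<open>small\<close> is the form in which the trace class condition is used;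
  \<open>finite_power_monomial_notin_filt\<close> supplies it.\<close>

locale trace_setup =
  fixes S :: "'a::complete_lambda_ring"
    and \<iota> :: "'a \<Rightarrow> 'b::complete_lambda_ring"
    and a :: "partition \<times> partition \<Rightarrow> 'a"
  assumes good: "good_modifier S"
    and loc: "completed_localization S \<iota>"
    and small: "\<And>k. finite {M. power_monomial a M \<notin> filt k}"
begin

lemma \<iota>_filt: "x \<in> filt k \<Longrightarrow> \<iota> x \<in> filt k"
proof -
  assume x: "x \<in> filt k"
  have "padams 0 S * x \<in> filt k" using x by (simp add: padams_zero)
  moreover have "\<iota> x \<in> filt k \<longleftrightarrow> (\<exists>\<nu>. padams \<nu> S * x \<in> filt k)"
    using loc by (simp add: completed_localization_def)
  ultimately show ?thesis by blast
qed

lemma hom_\<iota>: "lambda_hom \<iota>"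
  unfolding lambda_hom_def continuous_additive_def
proof (intro conjI allI)
  fix k
  show "\<exists>m. \<forall>x\<in>filt m. \<iota> x \<in> filt k" using \<iota>_filt by (intro exI[of _ k]) simp
qed (use loc in \<open>simp_all add: completed_localization_def\<close>)

lemma inverse_S: "\<iota> S * unit_inv (\<iota> S) = 1"
proof -
  have "\<iota> (adams 1 S) dvd 1" using loc unfolding completed_localization_def by blast
  then have "\<iota> S dvd 1" by (simp only: adams_1)
  then obtain y where y: "\<iota> S * y = 1" by (metis dvd_def)
  have "z = y" if "\<iota> S * z = 1" for z
  proof -
    have "z = z * (\<iota> S * y)" by (simp add: y)
    also have "\<dots> = (\<iota> S * z) * y" by (simp only: ac_simps)
    also have "\<dots> = y" by (simp add: that)
    finally show ?thesis .
  qed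
  with y have "(THE y. \<iota> S * y = 1) = y" by (intro the_equality)
  then show ?thesis using y by (simp add: unit_inv_def)
qed

lemma dvd_adams:
  assumes "k \<ge> 1"
  obtains c where "adams k S = S * c"
  using good assms unfolding good_modifier_def dvd_def by blast

lemma coprime_dvd_adams:
  assumes "g \<ge> 1" "h \<ge> 1" "coprime g h"
  obtains c where "S * adams (g * h) S = adams g S * adams h S * c"
  using good assms unfolding good_modifier_def dvd_def by blast

sublocale integral_flow
  "\<lambda>k x. count (parts (fst (snd x))) k" "\<lambda>k x. count (parts (snd (snd x))) k"
  "\<lambda>k. (0, (single_part k, 0))" "\<lambda>k. (0, (0, single_part k))"
  omega "\<lambda>k. adams k (\<iota> S)" "generic_series (unit_inv (\<iota> S))" "range \<iota>"
proof -
  interpret X: dilated_variables "\<lambda>k (x :: var multiset \<times> (partition \<times> partition)). count (parts (fst (snd x))) k" "\<lambda>k. (0, (single_part k, 0))"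
    by (rule dilated_variables_snd[OF dilated_variables_fst[OF dilated_variables_partition]])
  interpret Y: dilated_variables "\<lambda>k (x :: var multiset \<times> (partition \<times> partition)). count (parts (snd (snd x))) k" "\<lambda>k. (0, (0, single_part k))"
    by (rule dilated_variables_snd[OF dilated_variables_snd[OF dilated_variables_partition]])
  have \<iota>_adams: "adams n (\<iota> x) = \<iota> (adams n x)" if "n \<ge> 1" for n x
    using lambda_hom_adams[OF hom_\<iota> that] by simp
  note \<iota>_mult = lambda_hom_mult[OF hom_\<iota>]
  show "integral_flow
    (\<lambda>k x. count (parts (fst (snd x))) k) (\<lambda>k x. count (parts (snd (snd x))) k)
    (\<lambda>k. (0, (single_part k, 0))) (\<lambda>k. (0, (0, single_part k)))
    omega (\<lambda>k. adams k (\<iota> S)) (generic_series (unit_inv (\<iota> S))) (range \<iota>)"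
  proof
    fix x y :: "var multiset \<times> (partition \<times> partition)" and g h k n :: nat and b c :: 'b and q :: rat
    show "omega (x + y) = omega x + omega y"
      by (simp add: omega_def X_weight_add deg_add)
    show "omega (dilate n x) = int n * omega x" if "1 \<le> n"
      using that by (simp add: omega_def dilate_prod_def X_weight_dilate deg_dilate right_diff_distrib)
    show "omega x \<le> int (deg x)"
      using X_weight_le_deg[of "fst x"] by (simp add: omega_def deg_prod_def)
    show "omega (0, (single_part k, 0)) = - int k" "omega (0, (0, single_part k)) = 0"
      by (simp_all add: omega_def X_weight_def deg_single_part deg_zero)
    show "adams g (adams k (\<iota> S)) = adams (g * k) (\<iota> S)" if "1 \<le> g" "1 \<le> k"
      using that by (rule adams_adams)
    show "omega x = 0" if "coeff (generic_series (unit_inv (\<iota> S))) x \<noteq> 0"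
      using that by (cases x) (auto simp: coeff_generic_series omega_def X_weight_def exponent_def split: if_splits)
    show "order_ge 1 (generic_series (unit_inv (\<iota> S)))"
    proof (rule order_geI)
      fix x :: "var multiset \<times> (partition \<times> partition)"
      assume "coeff (generic_series (unit_inv (\<iota> S))) x \<noteq> 0"
      then obtain v where "fst x = {#v#}" by (cases x) (auto simp: coeff_generic_series split: if_splits)
      then show "1 \<le> deg x" using weight_pos[of v] by (simp add: deg_prod_def deg_multiset_def)
    qed
    have z: "\<iota> 0 = 0" by (rule additive_zero[OF continuous_additive_add[OF lambda_hom_continuous[OF hom_\<iota>]]])
    show "0 \<in> range \<iota>" using z by (metis rangeI)
    show "b + c \<in> range \<iota>" if "b \<in> range \<iota>" "c \<in> range \<iota>"
      using that by (auto simp: continuous_additive_add[OF lambda_hom_continuous[OF hom_\<iota>], symmetric])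
    show "b * c \<in> range \<iota>" if "b \<in> range \<iota>" "c \<in> range \<iota>"
      using that by (auto simp: \<iota>_mult[symmetric])
    show "q *\<^sub>Q b \<in> range \<iota>" if "b \<in> range \<iota>"
      using that by (auto simp: lambda_hom_scaleQ[OF hom_\<iota>, symmetric])
    show "adams n b \<in> range \<iota>" if "b \<in> range \<iota>" "1 \<le> n"
      using that by (auto simp: \<iota>_adams)
    show "\<exists>i\<in>range \<iota>. adams 1 (\<iota> S) * adams n (\<iota> S) = i * adams g (\<iota> S)"
      if g: "1 \<le> g" and "g dvd n" and n: "1 \<le> n"
    proof -
      obtain k where k: "n = g * k" using \<open>g dvd n\<close> by blast
      then have "k \<ge> 1" using n by (cases k) auto
      then obtain c where c: "adams k S = S * c" by (rule dvd_adams)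
      have "adams n S = adams g (adams k S)" using g \<open>k \<ge> 1\<close> by (simp add: k adams_adams)
      then have "S * adams n S = (S * adams g c) * adams g S"
        using g by (simp add: c adams_mult ac_simps)
      then have "\<iota> S * adams n (\<iota> S) = \<iota> (S * adams g c) * adams g (\<iota> S)"
        by (simp only: \<iota>_adams[OF g] \<iota>_adams[OF n] \<iota>_mult[symmetric])
      then show ?thesis by (simp only: adams_1) blast
    qed
    show "\<exists>i\<in>range \<iota>. adams 1 (\<iota> S) * adams n (\<iota> S) = i * (adams g (\<iota> S) * adams h (\<iota> S))"
      if gn: "g dvd n" and hn: "h dvd n" and co: "coprime g h" and n: "1 \<le> n"
    proof -
      \<comment> \<open>Condition (iii) treats \<open>n = g * h\<close>. The remaining factor
        \<open>k\<close> is absorbed by applying \<open>p_{g h}\<close> to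
        \<open>p_k[S] = S c\<close>, which shows that \<open>p_{g h}[S]\<close> divides
        \<open>p_n[S]\<close>.\<close>
      obtain k where k: "n = (g * h) * k" using divides_mult[OF gn hn co] by blast
      have g: "g \<ge> 1" and h: "h \<ge> 1" and "k \<ge> 1" using k n by (auto simp: Suc_le_eq)
      then have gh: "g * h \<ge> 1" by simp
      obtain c where c: "adams k S = S * c" using \<open>k \<ge> 1\<close> by (rule dvd_adams)
      obtain d where d: "S * adams (g * h) S = adams g S * adams h S * d"
        using g h co by (rule coprime_dvd_adams)
      have "adams n S = adams (g * h) (adams k S)" using gh \<open>k \<ge> 1\<close> by (simp only: k adams_adams)
      also have "\<dots> = adams (g * h) S * adams (g * h) c" by (simp only: c adams_mult[OF gh])
      finally have "S * adams n S = S * adams (g * h) S * adams (g * h) c" by (simp only: mult.assoc)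
      then have "S * adams n S = (d * adams (g * h) c) * (adams g S * adams h S)"
        by (simp only: d ac_simps)
      then have "\<iota> S * adams n (\<iota> S) = \<iota> (d * adams (g * h) c) * (adams g (\<iota> S) * adams h (\<iota> S))"
        by (simp only: \<iota>_adams[OF g] \<iota>_adams[OF h] \<iota>_adams[OF n] \<iota>_mult[symmetric])
      then show ?thesis by (simp only: adams_1) blast
    qed
    show "adams 1 (\<iota> S) * coeff (generic_series (unit_inv (\<iota> S))) x \<in> range \<iota>"
    proof -
      \<comment> \<open>The coefficients of the universal logarithm are 0 and
        \<open>1 / S\<close>.\<close>
      have "\<iota> S * coeff (generic_series (unit_inv (\<iota> S))) x \<in> {\<iota> 1, \<iota> 0}"
        by (cases x) (simp add: coeff_generic_series inverse_S z lambda_hom_one[OF hom_\<iota>])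
      then show ?thesis unfolding adams_1 by blast
    qed
  qed
qed

definition e :: "var multiset \<Rightarrow> 'b" where
  "e M = power_monomial (\<lambda>i. \<iota> (a i)) M"

lemma e_eq: "e M = \<iota> (power_monomial a M)"
  by (simp add: e_def lambda_hom_power_monomial[OF hom_\<iota>])

lemma evaluation_e: "evaluation (\<lambda>x. x) e"
proof -
  have "finite {M. power_monomial (\<lambda>i. \<iota> (a i)) M \<notin> filt k}" for k
  proof (rule finite_subset[OF _ small[of k]])
    show "{M. power_monomial (\<lambda>i. \<iota> (a i)) M \<notin> filt k} \<subseteq> {M. power_monomial a M \<notin> filt k}"
      using \<iota>_filt by (auto simp: lambda_hom_power_monomial[OF hom_\<iota>, symmetric])
  qed
  then have "evaluation (\<lambda>x. x) (power_monomial (\<lambda>i. \<iota> (a i)))" by (rule evaluation_power_monomial)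
  then show ?thesis by (simp add: e_def[abs_def])
qed

text \<open>\<open>A\<close> and \<open>E\<close> give the indeterminates their values in
  \<open>\<Lambda>\<close> and in \<open>\<Lambda>\<^sub>S\<close>; \<open>B\<close> does the latter
  while keeping X and Y, and yields the kernel; \<open>C\<close> also sets X = Y = 0, and yields the
  trace. \<open>A\<close> produces the final \<open>L\<close>, which must lie in
  \<open>\<Lambda>\<close>.\<close>

sublocale A: evaluation "\<lambda>x. x" "power_monomial a"
  by (rule evaluation_power_monomial[OF small])

sublocale E: evaluation "\<lambda>x. x" e
  by (rule evaluation_e)

sublocale B: evaluation "\<lambda>c. smult c 1" "\<lambda>(M, i). smult (e M) (basis i :: (partition \<times> partition, 'b) series)"
  by (rule evaluation_basis[OF evaluation_e])

sublocale C: evaluation "\<lambda>x. x" "\<lambda>(M, i :: partition \<times> partition). if i = 0 then e M else 0"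
proof (rule evaluation_constant_term[OF evaluation_e])
  fix i j :: "partition \<times> partition" assume "i + j = 0"
  then show "i = 0" using partition_add_eq_zero[of "fst i" "fst j"] partition_add_eq_zero[of "snd i" "snd j"]
    by (simp add: prod_eq_iff)
qed

lemma coeff_B_ev: "coeff (B.ev F) j = fsum (\<lambda>M. coeff F (M, j) * e M) UNIV"
proof -
  let ?f = "\<lambda>x. smult (coeff F x) 1 * (case x of (M, i) \<Rightarrow> smult (e M) (basis i :: (partition \<times> partition, 'b) series))"
  have eq: "coeff (?f (M, i)) j = (if i = j then coeff F (M, i) * e M else 0)" for M i
    by (simp add: smult_mult smult_smult) (simp add: basis_def)
  have s: "fsummable ?f UNIV" by (rule B.fsummable_ev)
  have "coeff (B.ev F) j = fsum (\<lambda>x. coeff (?f x) j) UNIV"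
    unfolding B.ev_def by (rule coeff_fsum[OF s])
  also have "\<dots> = fsum (\<lambda>M. coeff (?f (M, j)) j) UNIV"
  proof (rule fsum_slice[OF fsummable_map[OF continuous_additive_coeff s]])
    fix x :: "var multiset \<times> (partition \<times> partition)" assume "snd x \<noteq> j"
    then show "coeff (?f x) j = 0" using eq[of "fst x" "snd x"] by simp
  qed
  also have "\<dots> = fsum (\<lambda>M. coeff F (M, j) * e M) UNIV" by (simp only: eq refl if_True)
  finally show ?thesis .
qed

lemma C_ev: "C.ev F = fsum (\<lambda>M. coeff F (M, 0) * e M) UNIV"
proof -
  have "C.ev F = fsum (\<lambda>M. coeff F (M, 0) * (case (M, 0) of (M, i :: partition \<times> partition) \<Rightarrow> if i = 0 then e M else 0)) UNIV"
    unfolding C.ev_def by (rule fsum_slice[OF C.fsummable_ev]) (auto simp: case_prod_unfold)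
  then show ?thesis by simp
qed

lemma B_ev_generic: "B.ev (generic_series (unit_inv (\<iota> S))) = smult (unit_inv (\<iota> S)) (map_coeff \<iota> (Series a))"
proof (rule series_eqI)
  fix j
  have "coeff (B.ev (generic_series (unit_inv (\<iota> S)))) j =
      (\<Sum>M\<in>{{#Power_Var j 0#}}. coeff (generic_series (unit_inv (\<iota> S))) (M, j) * e M)"
    unfolding coeff_B_ev by (rule fsum_eq_sum) (auto simp: coeff_generic_series)
  also have "\<dots> = unit_inv (\<iota> S) * \<iota> (a j)"
    using adams_1[of "\<iota> (a j)"] by (simp add: coeff_generic_series e_def power_monomial_def exponent_def)
  finally show "coeff (B.ev (generic_series (unit_inv (\<iota> S)))) j =
      coeff (smult (unit_inv (\<iota> S)) (map_coeff \<iota> (Series a))) j" by simp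
qed

abbreviation K :: "(var multiset \<times> (partition \<times> partition), 'b) series" where
  "K \<equiv> Exp (generic_series (unit_inv (\<iota> S)))"

abbreviation F :: "(var multiset \<times> (partition \<times> partition), 'b) series" where
  "F \<equiv> Exp V"

lemma F_zero: "X_weight M < deg \<mu> \<Longrightarrow> coeff F (M, (\<mu>, \<nu>)) = 0"
  using Exp_V_leading_term by (intro supp_geD[of 0]) (auto simp: omega_def)

lemma K_zero: "X_weight M \<noteq> deg \<mu> \<Longrightarrow> coeff K (M, (\<mu>, \<nu>)) = 0"
  by (rule Exp_L_support) (simp add: omega_def)

lemma F_eq_K: "X_weight M = deg \<mu> \<Longrightarrow> coeff F (M, (\<mu>, \<nu>)) = coeff K (M, (\<mu>, \<nu>))"
  using Exp_V_leading_term by (intro agreeD[of 1]) (auto simp: omega_def)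

lemma heat_coeff:
  assumes "k \<ge> 1"
  shows "coeff (heat k (X.D k (Y.D k F))) (M, (\<rho>, \<rho>)) = of_nat (k\<^sup>2 * (count (parts \<rho>) k + 1)\<^sup>2) *\<^sub>Q
    (adams k (\<iota> S) * coeff F (M, (\<rho> + single_part k, \<rho> + single_part k)))"
  by (simp add: heat_def coeff_scaleQ coeff_pderiv scaleQ_mult_right scaleQ_scaleQ power2_eq_square algebra_simps)

text \<open>For a fixed monomial \<open>M\<close>, the heat equation relates diagonal coefficients
  to diagonal ones, as \<open>x_k y_k\<close> shifts both partitions by the same part. Normalised as
  \<open>G\<close>, they satisfy the recursion of \<open>heat_flow_at_zero\<close>, and in degree
  \<open>X_weight M\<close> they come from \<open>K\<close>.\<close>

lemma F_constant_term:
  "coeff F (M, 0) = (\<Sum>\<sigma> | deg \<sigma> = X_weight M. of_nat (zee \<sigma>) *\<^sub>Q (padams \<sigma> (\<iota> S) * coeff K (M, (\<sigma>, \<sigma>))))"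
proof -
  define N where "N = X_weight M"
  define G where "G \<rho> = of_nat (zee \<rho>) *\<^sub>Q (padams \<rho> (\<iota> S) * coeff F (M, (\<rho>, \<rho>)))" for \<rho>
  have "G 0 = (\<Sum>\<sigma> | deg \<sigma> = N. G \<sigma>)"
  proof (rule heat_flow_at_zero)
    show "G \<rho> = 0" if "deg \<rho> > N" for \<rho>
      using that by (simp add: G_def N_def F_zero scaleQ_zero_right)
    show "of_nat (N - deg \<rho>) *\<^sub>Q G \<rho> =
        (\<Sum>k\<in>{1..N}. of_nat (k * (count (parts \<rho>) k + 1)) *\<^sub>Q G (\<rho> + single_part k))"
      if lt: "deg \<rho> < N" for \<rho>
    proof -
      let ?x = "(M, (\<rho>, \<rho>))"
      have "omega ?x = int (N - deg \<rho>)" using lt by (simp add: omega_def N_def)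
      then have "of_nat (N - deg \<rho>) *\<^sub>Q coeff F ?x = coeff (euler omega F) ?x"
        by (simp add: coeff_euler)
      also have "\<dots> = fsum (\<lambda>k. coeff (heat k (X.D k (Y.D k F))) ?x) {1..}"
        unfolding heat_equation(2) by (rule coeff_fsum[OF heat_equation(1)])
      also have "\<dots> = (\<Sum>k\<in>{1..N}. coeff (heat k (X.D k (Y.D k F))) ?x)"
      proof (rule fsum_eq_sum)
        fix k assume "k \<in> {1..} - {1..N}"
        then have k: "k \<ge> 1" "k > N" by auto
        then have "coeff F (M, (\<rho> + single_part k, \<rho> + single_part k)) = 0"
          by (intro F_zero) (simp add: deg_add deg_single_part N_def)
        then show "coeff (heat k (X.D k (Y.D k F))) ?x = 0"
          by (simp add: heat_coeff[OF k(1)] scaleQ_zero_right)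
      qed auto
      finally have "of_nat (zee \<rho>) *\<^sub>Q (padams \<rho> (\<iota> S) * (of_nat (N - deg \<rho>) *\<^sub>Q coeff F ?x)) =
          (\<Sum>k\<in>{1..N}. of_nat (zee \<rho>) *\<^sub>Q (padams \<rho> (\<iota> S) * coeff (heat k (X.D k (Y.D k F))) ?x))"
        by (simp add: sum_distrib_left scaleQ_sum_right)
      also have "\<dots> = (\<Sum>k\<in>{1..N}. of_nat (k * (count (parts \<rho>) k + 1)) *\<^sub>Q G (\<rho> + single_part k))"
      proof (rule sum.cong[OF refl])
        fix k assume "k \<in> {1..N}"
        then have k: "k \<ge> 1" by simp
        show "of_nat (zee \<rho>) *\<^sub>Q (padams \<rho> (\<iota> S) * coeff (heat k (X.D k (Y.D k F))) ?x) =
            of_nat (k * (count (parts \<rho>) k + 1)) *\<^sub>Q G (\<rho> + single_part k)"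
          unfolding heat_coeff[OF k] G_def zee_add_single_part[OF k] padams_add padams_single_part[OF k]
            scaleQ_mult_right scaleQ_scaleQ mult.assoc[symmetric]
          by (rule arg_cong[of _ _ "\<lambda>q. q *\<^sub>Q (padams \<rho> (\<iota> S) * adams k (\<iota> S) *
              coeff F (M, (\<rho> + single_part k, \<rho> + single_part k)))"]) (simp add: power2_eq_square algebra_simps)
      qed
      finally show ?thesis
        by (simp add: G_def scaleQ_mult_right scaleQ_scaleQ mult.commute)
    qed
  qed
  moreover have "zee 0 = 1" by (simp add: zee_def parts_zero)
  then have "G 0 = coeff F (M, 0)" by (simp add: G_def padams_zero scaleQ_one zero_prod_def)
  moreover have "(\<Sum>\<sigma> | deg \<sigma> = N. G \<sigma>) =
      (\<Sum>\<sigma> | deg \<sigma> = X_weight M. of_nat (zee \<sigma>) *\<^sub>Q (padams \<sigma> (\<iota> S) * coeff K (M, (\<sigma>, \<sigma>))))"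
    unfolding N_def by (rule sum.cong) (simp_all add: G_def F_eq_K)
  ultimately show ?thesis by simp
qed

text \<open>The trace sums over partitions and, through \<open>B\<close>, over monomials
  \<open>M\<close>. The double family is summable, since \<open>e M\<close> is small outside a
  finite set and each \<open>M\<close> meets only the finitely many \<open>\<sigma>\<close> of
  degree \<open>X_weight M\<close>. Summing over \<open>\<sigma>\<close> first gives
  \<open>F_constant_term\<close>.\<close>

lemma mod_integral_kernel:
  "mod_integral (\<iota> S) (Exp (smult (unit_inv (\<iota> S)) (map_coeff \<iota> (Series a)))) = C.ev F"
proof -
  define T where "T M \<sigma> = of_nat (zee \<sigma>) *\<^sub>Q (padams \<sigma> (\<iota> S) * coeff K (M, (\<sigma>, \<sigma>)))" for M \<sigma>
  have T_zero: "T M \<sigma> = 0" if "deg \<sigma> \<noteq> X_weight M" for M \<sigma>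
    using that by (simp add: T_def K_zero scaleQ_zero_right)
  have sT: "fsummable (\<lambda>(\<sigma>, M). T M \<sigma> * e M) (UNIV \<times> UNIV)"
    unfolding fsummable_def
  proof
    fix k
    have "{x \<in> UNIV \<times> UNIV. (case x of (\<sigma>, M) \<Rightarrow> T M \<sigma> * e M) \<notin> filt k} \<subseteq>
        prod.swap ` Sigma {M. e M \<notin> filt k} (\<lambda>M. {\<sigma>. deg \<sigma> = X_weight M})"
    proof clarify
      fix \<sigma> M assume notin: "T M \<sigma> * e M \<notin> filt k"
      then have "e M \<notin> filt k" using filt_ideal' by blast
      moreover have "deg \<sigma> = X_weight M" using notin T_zero[of \<sigma> M] filt_zero[of k] by force
      ultimately have "(M, \<sigma>) \<in> Sigma {M. e M \<notin> filt k} (\<lambda>M. {\<sigma>. deg \<sigma> = X_weight M})" by simp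
      then show "(\<sigma>, M) \<in> prod.swap ` Sigma {M. e M \<notin> filt k} (\<lambda>M. {\<sigma>. deg \<sigma> = X_weight M})"
        by (rule image_eqI[rotated]) simp
    qed
    then show "finite {x \<in> UNIV \<times> UNIV. (case x of (\<sigma>, M) \<Rightarrow> T M \<sigma> * e M) \<notin> filt k}"
      by (rule finite_subset) (intro finite_imageI finite_SigmaI E.e_filt finite_deg)
  qed
  have kernel: "Exp (smult (unit_inv (\<iota> S)) (map_coeff \<iota> (Series a))) = B.ev K"
    unfolding B_ev_generic[symmetric] by (rule Exp_hom[OF B.ev_hom Exp_converges_series[OF L_order]])
  have inner: "of_nat (zee \<sigma>) *\<^sub>Q (padams \<sigma> (\<iota> S) * coeff (B.ev K) (\<sigma>, \<sigma>)) = fsum (\<lambda>M. T M \<sigma> * e M) UNIV" for \<sigma>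
  proof -
    have "continuous_additive (\<lambda>x. of_nat (zee \<sigma>) *\<^sub>Q (padams \<sigma> (\<iota> S) * x :: 'b))"
      unfolding continuous_additive_def
      by (auto simp: distrib_left scaleQ_add_right intro: filt_scaleQ filt_ideal')
    then have "of_nat (zee \<sigma>) *\<^sub>Q (padams \<sigma> (\<iota> S) * coeff (B.ev K) (\<sigma>, \<sigma>)) =
        fsum (\<lambda>M. of_nat (zee \<sigma>) *\<^sub>Q (padams \<sigma> (\<iota> S) * (coeff K (M, (\<sigma>, \<sigma>)) * e M))) UNIV"
      unfolding coeff_B_ev by (rule fsum_map) (rule E.fsummable_ev)
    then show ?thesis by (simp add: T_def scaleQ_mult_left mult.assoc)
  qed
  have "mod_integral (\<iota> S) (B.ev K) = fsum (\<lambda>\<sigma>. of_nat (zee \<sigma>) *\<^sub>Q (padams \<sigma> (\<iota> S) * coeff (B.ev K) (\<sigma>, \<sigma>))) UNIV"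
    by (rule mod_integral_eq) (use fsummable_Sigma_outer[OF sT] in \<open>simp add: inner\<close>)
  also have "\<dots> = fsum (\<lambda>\<sigma>. fsum (\<lambda>M. T M \<sigma> * e M) UNIV) UNIV" by (simp only: inner)
  also have "\<dots> = fsum (\<lambda>M. fsum (\<lambda>\<sigma>. T M \<sigma> * e M) UNIV) UNIV"
    by (rule fsum_swap[OF sT])
  also have "\<dots> = fsum (\<lambda>M. coeff F (M, 0) * e M) UNIV"
  proof (rule fsum_cong)
    fix M
    have "fsum (\<lambda>\<sigma>. T M \<sigma> * e M) UNIV = (\<Sum>\<sigma> | deg \<sigma> = X_weight M. T M \<sigma> * e M)"
      by (rule fsum_eq_sum) (auto simp: finite_deg T_zero)
    then show "fsum (\<lambda>\<sigma>. T M \<sigma> * e M) UNIV = coeff F (M, 0) * e M"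
      by (simp add: F_constant_term T_def sum_distrib_right)
  qed
  finally show ?thesis by (simp only: kernel C_ev)
qed

text \<open>The required \<open>L\<close> arises by lifting the coefficients of \<open>S V\<close>
  at X = Y = 0 along \<open>\<iota>\<close> and evaluating the lifted series in
  \<open>\<Lambda>\<close> by \<open>A\<close>.\<close>

lemma admissible_constant_term: "admissible_elem S \<iota> (C.ev F)"
proof -
  \<comment> \<open>\<open>\<iota>\<close> need not be injective, so a choice could return a nonzero
    element at \<open>M = 0\<close>. The value 0 there gives the lifted series positive order, which
    \<open>well_behaved_ev\<close> requires.\<close>
  define c where "c M = (if M = 0 then 0 else SOME y. \<iota> y = \<iota> S * coeff V (M, 0))" for M
  have c: "\<iota> (c M) = \<iota> S * coeff V (M, 0)" for M
  proof (cases "M = 0")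
    case True
    have "coeff V 0 = 0" using order_geD[OF order_ge_V, of 0] by (metis deg_zero not_one_le_zero)
    moreover have "(M, 0 :: partition \<times> partition) = 0" using True by (simp add: zero_prod_def)
    moreover have "\<iota> 0 = 0" by (rule additive_zero[OF continuous_additive_add[OF lambda_hom_continuous[OF hom_\<iota>]]])
    ultimately show ?thesis using True by (simp add: c_def)
  next
    case False
    have "\<iota> S * coeff V (M, 0) \<in> range \<iota>" using V_integral[of "(M, 0)"] unfolding adams_1 .
    then obtain y where "\<iota> S * coeff V (M, 0) = \<iota> y" by (rule imageE)
    from this[symmetric] have "\<iota> (SOME y. \<iota> y = \<iota> S * coeff V (M, 0)) = \<iota> S * coeff V (M, 0)" by (rule someI)
    then show ?thesis using False by (simp add: c_def)
  qed
  have ord: "order_ge 1 (Series c)"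
  proof (rule order_geI)
    fix M assume "coeff (Series c) M \<noteq> 0"
    then have "M \<noteq> {#}" by (auto simp: c_def)
    then have "size M \<noteq> 0" by simp
    then show "1 \<le> deg M" using size_le_deg[of M] by linarith
  qed
  have "\<iota> (A.ev (Series c)) = fsum (\<lambda>M. \<iota> (coeff (Series c) M * power_monomial a M)) UNIV"
    unfolding A.ev_def by (rule fsum_map[OF lambda_hom_continuous[OF hom_\<iota>] A.fsummable_ev])
  also have "\<dots> = fsum (\<lambda>M. \<iota> S * (coeff V (M, 0) * e M)) UNIV"
    by (simp add: lambda_hom_mult[OF hom_\<iota>] c e_eq mult.assoc)
  also have "\<dots> = \<iota> S * C.ev V"
    unfolding C_ev by (rule fsum_map[OF continuous_additive_mult_left E.fsummable_ev, symmetric])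
  finally have "unit_inv (\<iota> S) * \<iota> (A.ev (Series c)) = C.ev V"
    using inverse_S by (simp add: mult.assoc[symmetric] mult.commute[of "unit_inv (\<iota> S)"])
  moreover have "C.ev F = Exp (C.ev V)"
    by (rule Exp_hom[OF C.ev_hom Exp_converges_series[OF order_ge_V], symmetric])
  ultimately show ?thesis
    unfolding admissible_elem_def using A.well_behaved_ev[OF ord] by auto
qed

end

theorem theorem5p5:
  fixes S :: "'a::complete_lambda_ring"
    and \<iota> :: "'a \<Rightarrow> 'b::complete_lambda_ring"
    and U :: "(partition, 'a) series \<Rightarrow> (partition, 'b) series"
  assumes "good_modifier S"
    and "completed_localization S \<iota>"
    and "Lambda_linear \<iota> U"
    and "admissible_op S \<iota> U"
    and "trace_class S \<iota> U"
  shows "admissible_elem S \<iota> (trace S \<iota> U)"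
proof -
  obtain L where L: "is_log_kernel S \<iota> U L" "well_behaved_coeffs L"
    using assms(5) unfolding trace_class_def by blast
  obtain f :: "nat \<Rightarrow> partition \<times> partition" where f: "bij f" "well_behaved (\<lambda>i. coeff L (f i))"
    using L(2) unfolding well_behaved_coeffs_def by blast
  interpret trace_setup S \<iota> "coeff L"
    by standard (rule assms(1), rule assms(2), rule finite_power_monomial_notin_filt[OF f])
  have "kernel S \<iota> U = Exp (smult (unit_inv (\<iota> S)) (map_coeff \<iota> (Series (coeff L))))"
    using L(1) by (simp add: is_log_kernel_def coeff_inverse)
  then have "trace S \<iota> U = C.ev F" by (simp add: trace_def mod_integral_kernel)
  then show ?thesis using admissible_constant_term by simp
qed

end
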